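(* Fix $0<\alpha_0<\alpha_c=\frac{3\sqrt3}{2}$. There exist constants $K,c,C>0$, depending only on $\alpha_0$, with the following property. Let $(\lambda_m)$ be a sequence of positive numbers such that $$0<\alpha_m:=\frac{\lambda_m}{m}\le\alpha_0,\qquad \Lambda_m:=(\lambda_m m^2)^{1/3}\longrightarrow\infty,$$ and set $\delta_m=\alpha_m^{1/3}$ and $J_m:=\lceil K/\delta_m\rceil$. Then $J_m=o(m)$ and, for all sufficiently large $m$, $$\sum_{j=1}^{J_m}\cos^2\vartheta(m+j;\lambda_m)\ge cJ_m .$$ Moreover, uniformly for $1\le j\le J_m$ (and all sufficiently large $m$), $$\frac{\lambda_m^{1/6}e^{\mathcal A(m;\lambda_m)}}{C\,m^{2/3}}\le P(m+j;\lambda_m)\,e^{\mathcal A(m+j;\lambda_m)}\le\frac{C\,\lambda_m^{1/6}e^{\mathcal A(m;\lambda_m)}}{m^{2/3}} .$$ Consequently, for all sufficiently large $m$, $$\sum_{j=1}^{J_m}|a_{m+j}(\lambda_m)|^2\ge c\,m^{-1}e^{2\mathcal A(m;\lambda_m)} .$$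
   Context: For $\lambda>0$, $F_\lambda(x)=\exp\!\left(-\lambda\frac{1-x}{1+x}\right)$ for $-1<x\le 1$ and $F_\lambda(-1)=0$. For $n\ge1$, $a_n(\lambda)=\frac2\pi\int_{-1}^1\frac{F_\lambda(x)T_n(x)}{\sqrt{1-x^2}}\,dx$, where $T_n$ is the Chebyshev polynomial of the first kind. For $0<\alpha<\alpha_c$ let $\zeta_\alpha$ be the unique root of $\alpha(\zeta^3-\zeta)+1=0$ in the open first quadrant, and $\psi_\alpha(\zeta)=\log\frac{\zeta-1}{\zeta+1}+\alpha\zeta^2$, where at $\zeta=\zeta_\alpha$ the logarithm is the branch with argument in $(0,\pi)$ (the number $\frac{\zeta_\alpha-1}{\zeta_\alpha+1}$ lies in the open upper half-plane). Define $$C(\alpha)=\frac{4\sqrt\alpha}{\sqrt\pi}\,\frac{\zeta_\alpha}{\sqrt{3-2\alpha\zeta_\alpha}}=B(\alpha)e^{i\beta(\alpha)},$$ where $\sqrt{3-2\alpha\zeta_\alpha}$ is chosen continuously from the positive square root of $3$ as $\alpha\downarrow0$, $B(\alpha)>0$, and $\beta$ is a continuous argument of $C(\alpha)$ (with $\beta(\alpha)\to\pi/3$ as $\alpha\downarrow0$). (This function $C(\cdot)$ is unrelated to the constant $C$ in the claim.) For $x>0$ with $0<\lambda/x<\alpha_c$ define $$\mathcal S(x;\lambda)=x\,\psi_{\lambda/x}(\zeta_{\lambda/x}),\qquad \mathcal A(x;\lambda)=\operatorname{Re}\mathcal S(x;\lambda),$$ $$P(x;\lambda)=x^{-1/2}B(\lambda/x),\qquad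 \vartheta(x;\lambda)=\operatorname{Im}\mathcal S(x;\lambda)+\beta(\lambda/x).$$ *)

theory Defs
  imports "HOL-Analysis.Analysis" "HOL-Library.Landau_Symbols"
begin

fun Cheb_T :: "nat \<Rightarrow> real poly" where
  "Cheb_T 0 = 1"
| "Cheb_T (Suc 0) = [:0, 1:]"
| "Cheb_T (Suc (Suc n)) = [:0, 2:] * Cheb_T (Suc n) - Cheb_T n"

definition F :: "real \<Rightarrow> real \<Rightarrow> real" where
  "F lam x = (if x = -1 then 0 else exp (- lam * ((1 - x) / (1 + x))))"

text \<open>At the endpoints the integrand takes the value 0, since division by 0 yields 0.\<close>

definition cheb_coeff :: "nat \<Rightarrow> real \<Rightarrow> real" where
  "cheb_coeff n lam =
     2 / pi * integral {-1..1} (\<lambda>x. F lam x * poly (Cheb_T n) x / sqrt (1 - x\<^sup>2))"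

definition alpha_c :: real where
  "alpha_c = 3 * sqrt 3 / 2"

text \<open>The functions below are meaningful for \<open>0 < \<alpha> < alpha_c\<close> only.
  In that range the cubic has exactly one root in the open first quadrant.\<close>

definition zeta :: "real \<Rightarrow> complex" where
  "zeta \<alpha> = (THE z. Re z > 0 \<and> Im z > 0 \<and> of_real \<alpha> * (z ^ 3 - z) + 1 = 0)"

text \<open>The argument of the logarithm at \<open>zeta \<alpha>\<close> lies in the open upper half-plane, where the
  principal branch \<^const>\<open>Ln\<close> is the one with argument in \<open>(0, \<pi>)\<close>.\<close>

definition psi :: "real \<Rightarrow> complex \<Rightarrow> complex" where
  "psi \<alpha> z = Ln ((z - 1) / (z + 1)) + of_real \<alpha> * z\<^sup>2"

text \<open>The continuous branch of \<open>sqrt (3 - 2 \<alpha> zeta \<alpha>)\<close> starting at the positive square root of 3.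
  The radicand does not vanish, so the conditions determine the branch uniquely
  on \<open>(0, alpha_c)\<close>; its values elsewhere are irrelevant.\<close>

definition sqrt_branch :: "real \<Rightarrow> complex" where
  "sqrt_branch = (SOME s. continuous_on {0<..<alpha_c} s
      \<and> (\<forall>\<alpha>\<in>{0<..<alpha_c}. (s \<alpha>)\<^sup>2 = 3 - 2 * of_real \<alpha> * zeta \<alpha>)
      \<and> (s \<longlongrightarrow> of_real (sqrt 3)) (at_right 0))"

definition C_amp :: "real \<Rightarrow> complex" where
  "C_amp \<alpha> = of_real (4 * sqrt \<alpha> / sqrt pi) * (zeta \<alpha> / sqrt_branch \<alpha>)"

definition B_amp :: "real \<Rightarrow> real" where
  "B_amp \<alpha> = cmod (C_amp \<alpha>)"

text \<open>The continuous argument of \<open>C_amp\<close> tending to \<open>\<pi>/3\<close> at 0, again unique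
  on \<open>(0, alpha_c)\<close>.\<close>

definition beta :: "real \<Rightarrow> real" where
  "beta = (SOME b. continuous_on {0<..<alpha_c} b
      \<and> (\<forall>\<alpha>\<in>{0<..<alpha_c}. C_amp \<alpha> = of_real (B_amp \<alpha>) * exp (\<i> * of_real (b \<alpha>)))
      \<and> (b \<longlongrightarrow> pi / 3) (at_right 0))"

definition S_phase :: "real \<Rightarrow> real \<Rightarrow> complex" where
  "S_phase x lam = of_real x * psi (lam / x) (zeta (lam / x))"

definition A_exp :: "real \<Rightarrow> real \<Rightarrow> real" where
  "A_exp x lam = Re (S_phase x lam)"

definition P_amp :: "real \<Rightarrow> real \<Rightarrow> real" where
  "P_amp x lam = x powr (-1/2) * B_amp (lam / x)"

definition vartheta :: "real \<Rightarrow> real \<Rightarrow> real" where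
  "vartheta x lam = Im (S_phase x lam) + beta (lam / x)"

end

theory Submission
  imports Defs "HOL-Complex_Analysis.Cauchy_Integral_Theorem" "HOL-Probability.Sinc_Integral"
    "HOL-Real_Asymp.Real_Asymp"
begin

text \<open>With \<open>x = (1 - t\<^sup>2) / (1 + t\<^sup>2)\<close> the coefficient \<open>a\<^sub>n\<close> becomes the real part of an integral of
\<open>(1 - z)^(n-1) / (1 + z)^(n+1) * exp (\<lambda> z\<^sup>2)\<close> along the positive imaginary axis. This function is
holomorphic for \<open>Re z > -1\<close>, real on the real axis and small at large height, so the line of
integration can be moved to \<open>Re z = r\<close> for any \<open>r \<ge> 0\<close>; take \<open>r = Re \<zeta>\<close> with \<open>\<zeta>\<close> the saddle for
\<open>\<alpha> = \<lambda> / n\<close>. Up to sign the integrand is \<open>exp (n \<psi>(z)) / (1 - z\<^sup>2)\<close>.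

The saddle is explicit in terms of \<open>r\<close>: \<open>(Im \<zeta>)\<^sup>2 = 3 r\<^sup>2 - 1\<close> and \<open>\<alpha> (8 r\<^sup>3 - 2 r) = 1\<close>. The inequality
\<open>1 + x \<le> exp x\<close> then shows that \<open>Re \<psi>\<close> lies below its saddle value by at least a multiple of
\<open>\<alpha> (y - Im \<zeta>)\<^sup>2\<close> at every height \<open>y > 0\<close> of the line, not only near the saddle (\<open>psi_decay\<close>).
Together with a third-order Taylor expansion this compares the normalised integrand with a complex
Gaussian (\<open>kern_ratio_gauss\<close>) and gives
\<open>\<bar>a\<^sub>n\<bar> = P exp(A) (\<bar>cos \<theta>\<bar> + O((r\<^sup>2 \<lambda>)^(-1/2)))\<close> (\<open>cheb_coeff_asymptotics\<close>). All constants depend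
only on \<open>\<kappa>\<close>, a lower bound for \<open>Im \<zeta> / Re \<zeta>\<close>, which is where \<open>\<alpha> \<le> \<alpha>\<^sub>0 < alpha_c\<close> enters;
\<open>r\<^sup>2 \<lambda>\<close> is comparable with \<open>\<Lambda> = (\<lambda> n\<^sup>2)^(1/3)\<close>.

Let \<open>\<delta> = \<alpha>^(1/3)\<close>, which is comparable with \<open>1 / r\<close>. As \<open>\<psi>\<close> is stationary at \<open>\<zeta>\<close>, the derivative
of \<open>S(x) = x \<psi>(\<zeta>)\<close> in \<open>x\<close> is the logarithm \<open>L = log ((\<zeta> - 1) / (\<zeta> + 1))\<close>, and
\<open>S(x + h) - S(x) = h L + O(\<delta> h\<^sup>2 / x)\<close> (\<open>S_phase_increment\<close>). For \<open>h \<le> J \<approx> K / \<delta>\<close> the error is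
\<open>O(1 / \<Lambda>)\<close>. Hence the phases in a window form an arithmetic progression up to a small error, and
\<open>\<Sum> cos\<^sup>2 \<theta> = J / 2 + Re (\<Sum> exp (2 i \<theta>)) / 2\<close> is governed by a geometric sum, of size at most
\<open>1 / sin (Im L) = O(1 / \<delta>)\<close>. Choosing \<open>K\<close> large makes this a small fraction of \<open>J\<close>. Since
\<open>\<bar>Re L\<bar> = O(\<delta>)\<close>, the factor \<open>exp A\<close> changes by at most a constant factor in the window. Squaring
the asymptotic formula and summing yields the lower bound for the energy.\<close>

section \<open>The saddle point\<close>

lemmas expand_powers = power2_eq_square power3_eq_cube algebra_simps

text \<open>For positive \<open>r\<close> and \<open>y\<close> the two equations express \<open>\<alpha> (\<zeta>\<^sup>3 - \<zeta>) + 1 = 0\<close> with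
\<open>\<zeta> = r + i y\<close>. The parameter \<open>\<kappa>\<close> measures the distance to the critical value of \<open>\<alpha>\<close>, at which the
saddle meets the real axis; one \<open>\<kappa>\<close> serves a whole range \<open>0 < \<alpha> \<le> \<alpha>\<^sub>0\<close>.\<close>

definition saddle :: "real \<Rightarrow> real \<Rightarrow> real \<Rightarrow> real \<Rightarrow> bool" where
  "saddle \<kappa> \<alpha> r y \<longleftrightarrow> 0 < \<kappa> \<and> \<kappa> \<le> 1 \<and> 0 < r \<and> \<kappa> * r \<le> y \<and> y\<^sup>2 = 3 * r\<^sup>2 - 1 \<and> \<alpha> * (8 * r ^ 3 - 2 * r) = 1"

abbreviation radicand :: "real \<Rightarrow> complex \<Rightarrow> complex" where
  "radicand \<alpha> z \<equiv> 3 - 2 * of_real \<alpha> * z"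

text \<open>Where \<open>3 r\<^sup>2 \<ge> 1\<close> the cubic \<open>8 r\<^sup>3 - 2 r\<close>, which equals \<open>1 / \<alpha>\<close> at the saddle, has derivative at
least \<open>18 r\<^sup>2\<close>. This controls how the saddle moves when \<open>\<alpha>\<close> changes.\<close>

lemma cubic_strict_mono:
  fixes r r' :: real
  assumes "0 < r" "1 \<le> 3 * r\<^sup>2" "r < r'"
  shows "18 * r\<^sup>2 * (r' - r) \<le> (8 * r' ^ 3 - 2 * r') - (8 * r ^ 3 - 2 * r)"
proof -
  have "r\<^sup>2 \<le> r'\<^sup>2" using assms by (intro power_mono) auto
  moreover have "r\<^sup>2 \<le> r * r'" using assms by (simp add: power2_eq_square)
  ultimately have "18 * r\<^sup>2 \<le> 8 * (r'\<^sup>2 + r * r' + r\<^sup>2) - 2"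
    using assms(2) by argo
  then have "18 * r\<^sup>2 * (r' - r) \<le> (8 * (r'\<^sup>2 + r * r' + r\<^sup>2) - 2) * (r' - r)"
    using assms by (intro mult_right_mono) auto
  also have "... = (8 * r' ^ 3 - 2 * r') - (8 * r ^ 3 - 2 * r)"
    by (simp add: expand_powers)
  finally show ?thesis .
qed

lemma cubic_root_iff:
  fixes x y :: real
  assumes "x > 0" "y > 0" "\<alpha> > 0"
  shows "of_real \<alpha> * ((Complex x y) ^ 3 - Complex x y) + 1 = 0 \<longleftrightarrow>
     y\<^sup>2 = 3 * x\<^sup>2 - 1 \<and> \<alpha> * (8 * x ^ 3 - 2 * x) = 1"
proof -
  have c3: "(Complex x y) ^ 3 = Complex (x^3 - 3 * x * y\<^sup>2) (3 * x\<^sup>2 * y - y ^ 3)"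
    by (simp add: expand_powers complex_eq_iff)
  have "of_real \<alpha> * ((Complex x y) ^ 3 - Complex x y) + 1 = 0 \<longleftrightarrow>
     \<alpha> * (x^3 - 3 * x * y\<^sup>2 - x) + 1 = 0 \<and> \<alpha> * y * (3 * x\<^sup>2 - y\<^sup>2 - 1) = 0"
    unfolding c3 by (simp add: expand_powers complex_eq_iff)
  also have "... \<longleftrightarrow> \<alpha> * (x^3 - 3 * x * y\<^sup>2 - x) + 1 = 0 \<and> y\<^sup>2 = 3 * x\<^sup>2 - 1"
    using assms by auto
  also have "... \<longleftrightarrow> \<alpha> * (x^3 - 3 * x * (3 * x\<^sup>2 - 1) - x) + 1 = 0 \<and> y\<^sup>2 = 3 * x\<^sup>2 - 1"
    by auto
  also have "\<alpha> * (x^3 - 3 * x * (3 * x\<^sup>2 - 1) - x) + 1 = 1 - \<alpha> * (8 * x ^ 3 - 2 * x)"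
    by (simp add: expand_powers)
  also have "1 - \<alpha> * (8 * x ^ 3 - 2 * x) = 0 \<and> y\<^sup>2 = 3 * x\<^sup>2 - 1 \<longleftrightarrow> y\<^sup>2 = 3 * x\<^sup>2 - 1 \<and> \<alpha> * (8 * x ^ 3 - 2 * x) = 1"
    by auto
  finally show ?thesis .
qed

text \<open>The value \<open>1 / alpha_c\<close> is attained at \<open>r = 1 / sqrt 3\<close>, where \<open>3 r\<^sup>2 = 1\<close>; above it the
intermediate value theorem applies.\<close>

lemma cubic_preimage:
  fixes q :: real
  assumes "1 / alpha_c < q"
  obtains r where "0 < r" "1 < 3 * r\<^sup>2" "8 * r ^ 3 - 2 * r = q"
proof -
  define a where "a = 1 / sqrt (3::real)"
  have a: "a > 0" "3 * a\<^sup>2 = 1" by (auto simp: a_def field_simps)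
  have qa: "8 * a ^ 3 - 2 * a = 1 / alpha_c"
  proof -
    have "8 * a ^ 3 - 2 * a = 2 / 3 * a"
      using a by (simp add: expand_powers)
    also have "... = 1 / alpha_c" by (simp add: a_def alpha_c_def)
    finally show ?thesis .
  qed
  have q0: "q > 0" using assms by (smt (verit) alpha_c_def divide_pos_pos real_sqrt_gt_zero zero_less_divide_1_iff)
  \<comment> \<open>an upper end for the intermediate value theorem: \<open>8 b\<^sup>3 - 2 b \<ge> b > q\<close> as \<open>b \<ge> 1\<close>\<close>
  define b where "b = 1 + q"
  have "b\<^sup>2 \<ge> 1" unfolding b_def using q0 by (simp add: one_le_power)
  then have "b * (8 * b\<^sup>2 - 2) \<ge> b * 1" using q0 \<open>b\<^sup>2 \<ge> 1\<close> by (intro mult_left_mono) (linarith, simp add: b_def)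
  then have qb: "8 * b ^ 3 - 2 * b \<ge> q" unfolding b_def power3_eq_cube power2_eq_square by (simp add: algebra_simps)
  have ab: "a \<le> b" using q0 unfolding a_def b_def by (smt (verit) divide_le_eq_1 real_sqrt_ge_1_iff)
  have "\<exists>r\<ge>a. r \<le> b \<and> 8 * r ^ 3 - 2 * r = q"
    using ab qa qb assms by (intro IVT) auto
  then obtain r where r: "a \<le> r" "8 * r ^ 3 - 2 * r = q" by blast
  then have "r \<noteq> a" using qa assms by auto
  then have "a < r" using r by simp
  then have "a\<^sup>2 < r\<^sup>2" using a by (intro power_strict_mono) auto
  then show ?thesis using that[of r] r a \<open>a < r\<close> by auto
qed

lemma alpha_c_pos: "alpha_c > 0" by (simp add: alpha_c_def)

lemma zeta_coords:
  assumes "0 < \<alpha>" "\<alpha> < alpha_c"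
  obtains r y where "zeta \<alpha> = Complex r y" "0 < r" "0 < y" "1 < 3 * r\<^sup>2"
    "y\<^sup>2 = 3 * r\<^sup>2 - 1" "\<alpha> * (8 * r ^ 3 - 2 * r) = 1"
proof -
  have "1 / alpha_c < 1 / \<alpha>" using assms by (intro divide_strict_left_mono) (auto simp: alpha_c_pos)
  then obtain r where r: "0 < r" "1 < 3 * r\<^sup>2" "8 * r ^ 3 - 2 * r = 1 / \<alpha>"
    using cubic_preimage by blast
  define y where "y = sqrt (3 * r\<^sup>2 - 1)"
  have y: "y > 0" "y\<^sup>2 = 3 * r\<^sup>2 - 1" using r by (auto simp: y_def)
  have ar: "\<alpha> * (8 * r ^ 3 - 2 * r) = 1" using r assms by simp
  have "zeta \<alpha> = Complex r y"
    unfolding zeta_def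
  proof (rule the_equality)
    show "Re (Complex r y) > 0 \<and> Im (Complex r y) > 0 \<and>
      of_real \<alpha> * ((Complex r y) ^ 3 - Complex r y) + 1 = 0"
      using cubic_root_iff[of r y \<alpha>] r y ar assms by auto
  next
    fix z assume z: "0 < Re z \<and> 0 < Im z \<and> complex_of_real \<alpha> * (z ^ 3 - z) + 1 = 0"
    then have *: "(Im z)\<^sup>2 = 3 * (Re z)\<^sup>2 - 1" "\<alpha> * (8 * (Re z) ^ 3 - 2 * Re z) = 1"
      using cubic_root_iff[of "Re z" "Im z" \<alpha>] assms by auto
    have q: "8 * (Re z) ^ 3 - 2 * Re z = 8 * r ^ 3 - 2 * r" using *(2) ar assms(1)
      by (metis mult_left_cancel order_less_irrefl)
    have 3: "1 < 3 * (Re z)\<^sup>2" using * z by (smt (verit) zero_less_power)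
    have "Re z = r"
      using cubic_strict_mono[of r "Re z"] cubic_strict_mono[of "Re z" r] r 3 z q
      by (smt (verit) mult_pos_pos zero_less_power)
    then have "(Im z)\<^sup>2 = y\<^sup>2" using * y by simp
    then have "Im z = y" using z y(1) by (meson less_imp_le power2_eq_imp_eq)
    then show "z = Complex r y" using \<open>Re z = r\<close> by (simp add: complex_eq_iff)
  qed
  then show ?thesis using that r y ar by blast
qed

text \<open>The real part of the saddle decreases when \<open>\<alpha>\<close> grows, so \<open>(Im \<zeta> / Re \<zeta>)\<^sup>2 = 3 - 1 / (Re \<zeta>)\<^sup>2\<close> is
smallest at \<open>\<alpha> = \<alpha>\<^sub>0\<close>.\<close>

lemma saddle_exists:
  assumes "0 < \<alpha>\<^sub>0" "\<alpha>\<^sub>0 < alpha_c"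
  obtains \<kappa> where "\<And>\<alpha>. 0 < \<alpha> \<Longrightarrow> \<alpha> \<le> \<alpha>\<^sub>0 \<Longrightarrow> saddle \<kappa> \<alpha> (Re (zeta \<alpha>)) (Im (zeta \<alpha>))"
proof -
  obtain a b where ab: "zeta \<alpha>\<^sub>0 = Complex a b" "0 < a" "0 < b" "1 < 3 * a\<^sup>2"
    "b\<^sup>2 = 3 * a\<^sup>2 - 1" "\<alpha>\<^sub>0 * (8 * a ^ 3 - 2 * a) = 1"
    using zeta_coords[OF assms] by blast
  define \<kappa> where "\<kappa> = min 1 (b / a)"
  have k: "0 < \<kappa>" "\<kappa> \<le> 1" "\<kappa> \<le> b / a" using ab by (auto simp: \<kappa>_def)
  show ?thesis
  proof (rule that[of \<kappa>])
    fix \<alpha> assume al: "0 < \<alpha>" "\<alpha> \<le> \<alpha>\<^sub>0"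
    obtain r y where ry: "zeta \<alpha> = Complex r y" "0 < r" "0 < y" "1 < 3 * r\<^sup>2"
    "y\<^sup>2 = 3 * r\<^sup>2 - 1" "\<alpha> * (8 * r ^ 3 - 2 * r) = 1"
      using zeta_coords[of \<alpha>] al assms by auto
    have ar: "a \<le> r"
    proof (rule ccontr)
      assume "\<not> a \<le> r"
      then have "18 * r\<^sup>2 * (a - r) \<le> (8 * a ^ 3 - 2 * a) - (8 * r ^ 3 - 2 * r)"
        using ry by (intro cubic_strict_mono) auto
      moreover have "8 * a ^ 3 - 2 * a = 1 / \<alpha>\<^sub>0" "8 * r ^ 3 - 2 * r = 1 / \<alpha>"
        using ab ry al by (auto simp: field_simps)
      moreover have "1 / \<alpha>\<^sub>0 \<le> 1 / \<alpha>" using al by (simp add: frac_le)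
      moreover have "18 * r\<^sup>2 * (a - r) > 0" using ry \<open>\<not> a \<le> r\<close> by auto
      ultimately show False by linarith
    qed
    have "(b / a * r)\<^sup>2 \<le> y\<^sup>2"
    proof -
      have "(b / a * r)\<^sup>2 = (3 * a\<^sup>2 - 1) / a\<^sup>2 * r\<^sup>2"
        by (simp only: power_mult_distrib power_divide ab(5))
      also have "... = 3 * r\<^sup>2 - r\<^sup>2 / a\<^sup>2" using ab(2) by (simp add: field_simps)
      finally have "(b / a * r)\<^sup>2 = 3 * r\<^sup>2 - r\<^sup>2 / a\<^sup>2" .
      moreover have "a\<^sup>2 \<le> r\<^sup>2" using ar ab by (intro power_mono) auto
      then have "r\<^sup>2 / a\<^sup>2 \<ge> 1" using ab by (simp add: field_simps)
      ultimately show ?thesis using ry by linarith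
    qed
    then have "b / a * r \<le> y" by (rule power2_le_imp_le) (use ry in simp)
    moreover have "\<kappa> * r \<le> b / a * r" using k ry by (intro mult_right_mono) auto
    ultimately show "saddle \<kappa> \<alpha> (Re (zeta \<alpha>)) (Im (zeta \<alpha>))"
      unfolding saddle_def using ry k by auto
  qed
qed

context
  fixes \<kappa> \<alpha> r y assumes sad: "saddle \<kappa> \<alpha> r y"
begin

lemma saddle_basic:
  shows "0 < \<kappa>" "\<kappa> \<le> 1" "0 < r" "\<kappa> * r \<le> y" "0 < y" "y\<^sup>2 = 3 * r\<^sup>2 - 1" "1 < 3 * r\<^sup>2"
    "0 < \<alpha>" "\<alpha> * (8 * r ^ 3 - 2 * r) = 1" "1/2 < r" "y\<^sup>2 < 3 * r\<^sup>2"
proof -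
  show *: "0 < \<kappa>" "\<kappa> \<le> 1" "0 < r" "\<kappa> * r \<le> y" "y\<^sup>2 = 3 * r\<^sup>2 - 1"
    "\<alpha> * (8 * r ^ 3 - 2 * r) = 1" using sad by (auto simp: saddle_def)
  show y: "0 < y" using * by (smt (verit) mult_pos_pos)
  then have "y\<^sup>2 > 0" by simp
  then show 3: "1 < 3 * r\<^sup>2" "y\<^sup>2 < 3 * r\<^sup>2" using * by linarith+
  have "(1/2)^2 < r^2" using 3 by (simp add: power2_eq_square)
  then show "1/2 < r" using * power2_less_imp_less by force
  have "8 * r ^ 3 - 2 * r = r * (8 * r\<^sup>2 - 2)" by (simp add: expand_powers)
  then have "8 * r ^ 3 - 2 * r > 0" using 3 * by simp
  then show "0 < \<alpha>" using *(6) by (metis zero_less_mult_pos2 zero_less_one)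
qed

text \<open>The equation \<open>8 \<alpha> r\<^sup>3 = 1 + 2 \<alpha> r\<close> pins \<open>\<alpha>\<close> between constant multiples of \<open>r\<^sup>-\<^sup>3\<close>, uniformly up to
the critical value.\<close>

lemma saddle_alpha: "1 / 8 \<le> \<alpha> * r ^ 3" "\<alpha> * r ^ 3 \<le> 1 / 2" "\<alpha> * r\<^sup>2 \<le> 1 / (2 * r)" "\<alpha> * r \<le> 3/2"
   "\<alpha> * r\<^sup>2 \<le> 1"
proof -
  note b = saddle_basic
  have e: "8 * (\<alpha> * r ^ 3) = 1 + 2 * (\<alpha> * r)" using b(9) by (simp add: algebra_simps)
  have "\<alpha> * r > 0" using b by simp
  then show "1 / 8 \<le> \<alpha> * r ^ 3" using e by linarith
  have "\<alpha> * r * 1 \<le> \<alpha> * r * (3 * r\<^sup>2)" using b by (intro mult_left_mono) auto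
  then have f: "\<alpha> * r \<le> 3 * (\<alpha> * r ^ 3)" by (simp add: expand_powers)
  then show g: "\<alpha> * r ^ 3 \<le> 1 / 2" using e by linarith
  then show "\<alpha> * r \<le> 3/2" using f by linarith
  show h: "\<alpha> * r\<^sup>2 \<le> 1 / (2 * r)" using g b by (simp add: field_simps power2_eq_square power3_eq_cube)
  have "1 / (2 * r) \<le> 1" using b by simp
  then show "\<alpha> * r\<^sup>2 \<le> 1" using h by linarith
qed

lemma saddle_norms:
  shows "(cmod (Complex r y))\<^sup>2 = 4 * r\<^sup>2 - 1" "(cmod (Complex r y - 1))\<^sup>2 = 4 * r\<^sup>2 - 2 * r"
   "(cmod (Complex r y + 1))\<^sup>2 = 4 * r\<^sup>2 + 2 * r" "r \<le> cmod (Complex r y)" "cmod (Complex r y) \<le> 2 * r"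
proof -
  note b = saddle_basic
  have e: "(r - 1)\<^sup>2 = r\<^sup>2 - 2 * r + 1" "(r + 1)\<^sup>2 = r\<^sup>2 + 2 * r + 1"
    by (simp_all add: expand_powers)
  show *: "(cmod (Complex r y))\<^sup>2 = 4 * r\<^sup>2 - 1" "(cmod (Complex r y - 1))\<^sup>2 = 4 * r\<^sup>2 - 2 * r"
   "(cmod (Complex r y + 1))\<^sup>2 = 4 * r\<^sup>2 + 2 * r"
    unfolding cmod_power2 by (simp_all add: b(6) e)
  show "r \<le> cmod (Complex r y)" using complex_Re_le_cmod[of "Complex r y"] by simp
  show "cmod (Complex r y) \<le> 2 * r"
    by (rule power2_le_imp_le) (use * b in \<open>auto simp: power_mult_distrib\<close>)
qed

lemma saddle_eqn: "of_real \<alpha> * ((Complex r y) ^ 3 - Complex r y) + 1 = 0"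
    "of_real \<alpha> * Complex r y = 1 / (1 - (Complex r y)\<^sup>2)" "(Complex r y)\<^sup>2 \<noteq> 1"
proof -
  note b = saddle_basic
  show *: "of_real \<alpha> * ((Complex r y) ^ 3 - Complex r y) + 1 = 0"
    using cubic_root_iff[of r y \<alpha>] b by auto
  then have e: "of_real \<alpha> * Complex r y * (1 - (Complex r y)\<^sup>2) = 1"
    by (simp add: expand_powers add_eq_0_iff)
  then show "(Complex r y)\<^sup>2 \<noteq> 1" by auto
  then show "of_real \<alpha> * Complex r y = 1 / (1 - (Complex r y)\<^sup>2)" using e
    by (simp add: eq_divide_eq)
qed

text \<open>The radicand is \<open>\<psi>''(\<zeta>) / (2 \<alpha>)\<close>. Its real part is \<open>4 y\<^sup>2 / (4 r\<^sup>2 - 1)\<close>, so it degenerates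
exactly when the saddle reaches the real axis.\<close>

lemma saddle_radicand:
  "Re (radicand \<alpha> (Complex r y)) \<ge> \<kappa>\<^sup>2" "cmod (radicand \<alpha> (Complex r y)) \<le> 9"
   "Re (radicand \<alpha> (Complex r y)) > 0"
proof -
  note b = saddle_basic
  have "8 * r ^ 3 - 2 * r = 2 * r * (4 * r\<^sup>2 - 1)" by (simp add: expand_powers)
  then have "2 * \<alpha> * r * (4 * r\<^sup>2 - 1) = 1" using b(9) by (simp add: mult_ac)
  moreover have "4 * r\<^sup>2 - 1 > 0" using b by simp
  ultimately have a: "2 * \<alpha> * r = 1 / (4 * r\<^sup>2 - 1)" by (simp add: eq_divide_eq)
  have "(\<kappa> * r)\<^sup>2 \<le> y\<^sup>2" using b by (intro power_mono) auto
  then have k: "\<kappa>\<^sup>2 * r\<^sup>2 \<le> y\<^sup>2" by (simp add: power_mult_distrib)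
  have "\<kappa>\<^sup>2 * (4 * r\<^sup>2 - 1) \<le> \<kappa>\<^sup>2 * (4 * r\<^sup>2)" using b by (intro mult_left_mono) auto
  then have "\<kappa>\<^sup>2 * (4 * r\<^sup>2 - 1) \<le> 4 * y\<^sup>2" using k by linarith
  then have "\<kappa>\<^sup>2 \<le> 4 * y\<^sup>2 / (4 * r\<^sup>2 - 1)" using \<open>4 * r\<^sup>2 - 1 > 0\<close> by (simp add: field_simps)
  also have "... = 3 - 2 * \<alpha> * r" unfolding a b(6) using \<open>4 * r\<^sup>2 - 1 > 0\<close> by (simp add: field_simps)
  finally show 1: "Re (radicand \<alpha> (Complex r y)) \<ge> \<kappa>\<^sup>2" by simp
  then show "Re (radicand \<alpha> (Complex r y)) > 0" using b by (smt (verit) zero_less_power)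
  have "cmod (radicand \<alpha> (Complex r y)) \<le> 3 + cmod (2 * of_real \<alpha> * Complex r y)"
    by (metis norm_numeral norm_triangle_ineq4)
  also have "cmod (2 * of_real \<alpha> * Complex r y) = 2 * \<alpha> * cmod (Complex r y)"
    using b by (simp add: norm_mult)
  also have "... \<le> 2 * \<alpha> * (2 * r)" using b saddle_norms by (intro mult_left_mono) auto
  finally show "cmod (radicand \<alpha> (Complex r y)) \<le> 9" using saddle_alpha(4) by simp
qed

end

section \<open>Branches of the square root and of the argument\<close>

definition zre :: "real \<Rightarrow> real" where "zre \<alpha> = Re (zeta \<alpha>)"
definition zim :: "real \<Rightarrow> real" where "zim \<alpha> = Im (zeta \<alpha>)"

abbreviation zeta_saddle :: "real \<Rightarrow> real \<Rightarrow> bool" where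
  "zeta_saddle \<kappa> \<alpha> \<equiv> saddle \<kappa> \<alpha> (zre \<alpha>) (zim \<alpha>)"

lemma zeta_Complex: "zeta \<alpha> = Complex (zre \<alpha>) (zim \<alpha>)"
  by (simp add: zre_def zim_def)

lemma saddle_at:
  assumes "0 < \<alpha>" "\<alpha> < alpha_c"
  obtains \<kappa> where "zeta_saddle \<kappa> \<alpha>"
proof -
  obtain \<kappa> where "\<And>a. 0 < a \<Longrightarrow> a \<le> \<alpha> \<Longrightarrow> saddle \<kappa> a (Re (zeta a)) (Im (zeta a))"
    using saddle_exists[OF assms] by blast
  then show ?thesis using that assms unfolding zre_def zim_def by blast
qed

lemma zim_eq:
  assumes "0 < \<alpha>" "\<alpha> < alpha_c"
  shows "zim \<alpha> = sqrt (3 * (zre \<alpha>)\<^sup>2 - 1)"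
proof -
  obtain \<kappa> where s: "zeta_saddle \<kappa> \<alpha>" using saddle_at[OF assms] .
  show ?thesis using saddle_basic(5,6)[OF s] by (simp flip: saddle_basic(6)[OF s])
qed

lemma saddle_Re_lipschitz:
  assumes "saddle \<kappa> \<alpha> r y" "saddle \<kappa>' \<alpha>' r' y'"
  shows "\<bar>r' - r\<bar> \<le> \<bar>1 / \<alpha>' - 1 / \<alpha>\<bar>"
proof -
  note b = saddle_basic[OF assms(1)] and b' = saddle_basic[OF assms(2)]
  have q: "8 * r ^ 3 - 2 * r = 1 / \<alpha>" "8 * r' ^ 3 - 2 * r' = 1 / \<alpha>'"
    using b b' by (auto simp: field_simps)
  have *: "b - a \<le> 18 * a\<^sup>2 * (b - a)" if "1 < 3 * a\<^sup>2" "a < b" for a b :: real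
  proof -
    have "1 * (b - a) \<le> 18 * a\<^sup>2 * (b - a)" using that by (intro mult_right_mono) auto
    then show ?thesis by simp
  qed
  show ?thesis
    using cubic_strict_mono[of r r'] cubic_strict_mono[of r' r] *[of r r'] *[of r' r] b(3,7) b'(3,7)
    unfolding q by (cases r r' rule: linorder_cases) linarith+
qed

lemma continuous_zre: "continuous_on {0<..<alpha_c} zre"
  unfolding continuous_on_def
proof
  fix \<alpha> assume al: "\<alpha> \<in> {0<..<alpha_c}"
  have "((\<lambda>x. \<bar>1 / x - 1 / \<alpha>\<bar>) \<longlongrightarrow> \<bar>1 / \<alpha> - 1 / \<alpha>\<bar>) (at \<alpha> within {0<..<alpha_c})"
    using al by (intro tendsto_intros) auto
  then have lim: "((\<lambda>x. \<bar>1 / x - 1 / \<alpha>\<bar>) \<longlongrightarrow> 0) (at \<alpha> within {0<..<alpha_c})" by simp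
  have "\<forall>\<^sub>F x in at \<alpha> within {0<..<alpha_c}. norm (zre x - zre \<alpha>) \<le> \<bar>1 / x - 1 / \<alpha>\<bar>"
    unfolding eventually_at_filter
  proof (rule always_eventually, intro allI impI)
    fix x assume x: "x \<in> {0<..<alpha_c}"
    show "norm (zre x - zre \<alpha>) \<le> \<bar>1 / x - 1 / \<alpha>\<bar>"
    proof -
      obtain \<kappa> where 1: "zeta_saddle \<kappa> \<alpha>" using saddle_at[of \<alpha>] al by auto
      obtain \<kappa>' where 2: "zeta_saddle \<kappa>' x" using saddle_at[of x] x by auto
      show ?thesis using saddle_Re_lipschitz[OF 1 2] by simp
    qed
  qed
  then have "((\<lambda>x. zre x - zre \<alpha>) \<longlongrightarrow> 0) (at \<alpha> within {0<..<alpha_c})"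
    using lim by (rule Lim_null_comparison)
  then show "(zre \<longlongrightarrow> zre \<alpha>) (at \<alpha> within {0<..<alpha_c})" by (rule LIM_zero_cancel)
qed

lemma continuous_zeta: "continuous_on {0<..<alpha_c} zeta"
proof -
  have "continuous_on {0<..<alpha_c} (\<lambda>\<alpha>. of_real (zre \<alpha>) + \<i> * of_real (sqrt (3 * (zre \<alpha>)\<^sup>2 - 1)))"
    by (intro continuous_intros continuous_zre)
  also have "?this \<longleftrightarrow> ?thesis"
    by (intro continuous_on_cong) (auto simp: zeta_Complex zim_eq complex_eq_iff)
  finally show ?thesis .
qed

lemma eventually_at_right_alpha: "\<forall>\<^sub>F \<alpha> in at_right 0. \<alpha> \<in> {0<..<alpha_c}"
  by (rule eventually_at_rightI[of 0 alpha_c]) (simp_all add: alpha_c_pos)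

lemma saddle_small:
  assumes "0 < \<alpha>" "\<alpha> < alpha_c"
  shows "\<alpha> * zre \<alpha> \<le> sqrt \<alpha>" "1 / (zre \<alpha>)\<^sup>2 \<le> 8 * sqrt \<alpha>"
proof -
  obtain \<kappa> where s: "zeta_saddle \<kappa> \<alpha>" using saddle_at[OF assms] .
  note b = saddle_basic[OF s] and a = saddle_alpha[OF s]
  have "(\<alpha> * zre \<alpha>)\<^sup>2 = \<alpha> * (\<alpha> * (zre \<alpha>)\<^sup>2)" by (simp add: power2_eq_square)
  also have "... \<le> \<alpha> * 1" using a assms by (intro mult_left_mono) auto
  finally show 1: "\<alpha> * zre \<alpha> \<le> sqrt \<alpha>" by (simp add: real_le_rsqrt)
  have "1 / (zre \<alpha>)\<^sup>2 \<le> 8 * (\<alpha> * zre \<alpha>)" using a(1) b(3)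
    by (simp add: field_simps power2_eq_square power3_eq_cube)
  then show "1 / (zre \<alpha>)\<^sup>2 \<le> 8 * sqrt \<alpha>" using 1 by linarith
qed

lemma radicand_limit: "((\<lambda>\<alpha>. 3 - 2 * of_real \<alpha> * zeta \<alpha>) \<longlongrightarrow> 3) (at_right 0)"
proof -
  have ev: "\<forall>\<^sub>F \<alpha> in at_right 0. norm (2 * of_real \<alpha> * zeta \<alpha>) \<le> 4 * sqrt \<alpha>"
    using eventually_at_right_alpha
  proof eventually_elim
    case (elim \<alpha>)
    then obtain \<kappa> where s: "zeta_saddle \<kappa> \<alpha>" using saddle_at[of \<alpha>] by auto
    have "norm (2 * of_real \<alpha> * zeta \<alpha>) = 2 * \<alpha> * cmod (zeta \<alpha>)" using elim by (simp add: norm_mult)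
    also have "... \<le> 2 * \<alpha> * (2 * zre \<alpha>)"
      using saddle_norms[OF s] elim by (intro mult_left_mono) (auto simp: zeta_Complex)
    also have "... \<le> 4 * sqrt \<alpha>" using saddle_small(1)[of \<alpha>] elim by auto
    finally show ?case .
  qed
  have "((\<lambda>\<alpha>. 4 * sqrt \<alpha>) \<longlongrightarrow> 4 * sqrt 0) (at_right 0)" by (intro tendsto_intros)
  then have "((\<lambda>\<alpha>. 4 * sqrt \<alpha>) \<longlongrightarrow> 0) (at_right 0)" by simp
  from Lim_null_comparison[OF ev this]
  have "((\<lambda>\<alpha>. 3 - 2 * of_real \<alpha> * zeta \<alpha>) \<longlongrightarrow> 3 - 0) (at_right 0)" by (intro tendsto_intros)
  then show ?thesis by simp
qed

lemma Re_radicand_pos: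
  assumes "0 < \<alpha>" "\<alpha> < alpha_c"
  shows "Re (radicand \<alpha> (zeta \<alpha>)) > 0"
proof -
  obtain \<kappa> where s: "zeta_saddle \<kappa> \<alpha>" using saddle_at[OF assms] .
  show ?thesis unfolding zeta_Complex by (rule saddle_radicand(3)[OF s])
qed

text \<open>The radicand stays in the right half-plane, so the principal root is a witness for the choice.\<close>

lemma sqrt_branch_spec:
  shows "continuous_on {0<..<alpha_c} sqrt_branch"
    and "\<And>\<alpha>. 0 < \<alpha> \<Longrightarrow> \<alpha> < alpha_c \<Longrightarrow> (sqrt_branch \<alpha>)\<^sup>2 = 3 - 2 * of_real \<alpha> * zeta \<alpha>"
    and "(sqrt_branch \<longlongrightarrow> of_real (sqrt 3)) (at_right 0)"
proof -
  define s where "s = (\<lambda>\<alpha>. csqrt (radicand \<alpha> (zeta \<alpha>)))"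
  have nn: "3 - 2 * of_real \<alpha> * zeta \<alpha> \<notin> \<real>\<^sub>\<le>\<^sub>0" if "\<alpha> \<in> {0<..<alpha_c}" for \<alpha>
    using Re_radicand_pos[of \<alpha>] that by (auto simp: complex_nonpos_Reals_iff)
  have "continuous_on {0<..<alpha_c} s" unfolding s_def
    by (intro continuous_on_compose2[OF continuous_on_csqrt] continuous_intros continuous_zeta)
       (use nn in auto)
  moreover have "\<forall>\<alpha>\<in>{0<..<alpha_c}. (s \<alpha>)\<^sup>2 = 3 - 2 * of_real \<alpha> * zeta \<alpha>" by (simp add: s_def)
  moreover have "isCont csqrt 3" by (rule continuous_at_csqrt) (auto simp: complex_nonpos_Reals_iff)
  then have "(s \<longlongrightarrow> csqrt 3) (at_right 0)"
    unfolding s_def using radicand_limit isCont_tendsto_compose by blast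
  moreover have "csqrt 3 = of_real (sqrt 3)" using csqrt_of_real_nonneg[of 3] by simp
  ultimately have "\<exists>s. continuous_on {0<..<alpha_c} s
      \<and> (\<forall>\<alpha>\<in>{0<..<alpha_c}. (s \<alpha>)\<^sup>2 = 3 - 2 * of_real \<alpha> * zeta \<alpha>)
      \<and> (s \<longlongrightarrow> of_real (sqrt 3)) (at_right 0)" by auto
  from someI_ex[OF this, folded sqrt_branch_def]
  show "continuous_on {0<..<alpha_c} sqrt_branch"
    "\<And>\<alpha>. 0 < \<alpha> \<Longrightarrow> \<alpha> < alpha_c \<Longrightarrow> (sqrt_branch \<alpha>)\<^sup>2 = 3 - 2 * of_real \<alpha> * zeta \<alpha>"
    "(sqrt_branch \<longlongrightarrow> of_real (sqrt 3)) (at_right 0)" by auto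
qed

text \<open>A square root of a number with positive real part has nonzero real part; by connectedness its
sign is the one near \<open>0\<close>.\<close>

lemma Re_sqrt_branch_pos:
  assumes "0 < \<alpha>" "\<alpha> < alpha_c"
  shows "Re (sqrt_branch \<alpha>) > 0"
proof (rule ccontr)
  assume neg: "\<not> Re (sqrt_branch \<alpha>) > 0"
  have nz: "Re (sqrt_branch a) \<noteq> 0" if "a \<in> {0<..<alpha_c}" for a
  proof
    assume "Re (sqrt_branch a) = 0"
    then have "Re ((sqrt_branch a)\<^sup>2) \<le> 0" by (simp add: power2_eq_square)
    then show False using sqrt_branch_spec(2)[of a] Re_radicand_pos[of a] that by auto
  qed
  have "((\<lambda>a. Re (sqrt_branch a)) \<longlongrightarrow> sqrt 3) (at_right 0)"
    using tendsto_Re[OF sqrt_branch_spec(3)] by simp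
  then have "\<forall>\<^sub>F a in at_right 0. Re (sqrt_branch a) > 0"
    by (rule order_tendstoD) simp
  then have "\<forall>\<^sub>F a in at_right 0. Re (sqrt_branch a) > 0 \<and> a \<in> {0<..<alpha_c}"
    using eventually_at_right_alpha by eventually_elim auto
  then obtain a where a: "Re (sqrt_branch a) > 0" "a \<in> {0<..<alpha_c}"
    using eventually_happens trivial_limit_at_right_real by blast
  have "connected ((\<lambda>a. Re (sqrt_branch a)) ` {0<..<alpha_c})"
    by (intro connected_continuous_image continuous_intros sqrt_branch_spec(1)) auto
  then have "0 \<in> (\<lambda>a. Re (sqrt_branch a)) ` {0<..<alpha_c}"
    by (rule connectedD_interval[of _ "Re (sqrt_branch \<alpha>)" "Re (sqrt_branch a)"])
       (use assms a neg in auto)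
  then show False using nz by auto
qed

lemma polar_Ln:
  assumes "k > 0" "w \<noteq> 0"
  shows "of_real k * w = of_real (cmod (of_real k * w)) * exp (\<i> * of_real (Im (Ln w)))"
proof -
  have "w = exp (Ln w)" using assms by simp
  also have "exp (Ln w) = of_real (cmod w) * exp (\<i> * of_real (Im (Ln w)))"
    using assms by (subst exp_eq_polar) (simp add: cis_conv_exp)
  finally have "of_real k * w = of_real k * (of_real (cmod w) * exp (\<i> * of_real (Im (Ln w))))"
    by simp
  then show ?thesis using assms by (simp add: norm_mult)
qed

text \<open>After division by the positive factor \<open>4 sqrt \<alpha> / sqrt pi * Re \<zeta>\<close> the amplitude tends to
\<open>(1 + i sqrt 3) / sqrt 3\<close> and never meets the negative real axis, since its product with the root,
which has positive real part, has real part \<open>1\<close>. Hence the imaginary part of the principal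
logarithm is a continuous argument with the limit \<open>\<pi> / 3\<close>.\<close>

lemma beta_spec:
  assumes "0 < \<alpha>" "\<alpha> < alpha_c"
  shows "C_amp \<alpha> = of_real (B_amp \<alpha>) * exp (\<i> * of_real (beta \<alpha>))"
proof -
  let ?I = "{0<..<alpha_c}"
  define w where "w = (\<lambda>\<alpha>. Complex 1 (sqrt (3 - 1 / (zre \<alpha>)\<^sup>2)) / sqrt_branch \<alpha>)"
  define b where "b = (\<lambda>\<alpha>. Im (Ln (w \<alpha>)))"
  have w: "C_amp \<alpha> = of_real (4 * sqrt \<alpha> / sqrt pi * zre \<alpha>) * w \<alpha>" "0 < 4 * sqrt \<alpha> / sqrt pi * zre \<alpha>"
     "w \<alpha> \<notin> \<real>\<^sub>\<le>\<^sub>0" "sqrt_branch \<alpha> \<noteq> 0" "zre \<alpha> \<noteq> 0"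
    if al: "\<alpha> \<in> ?I" for \<alpha>
  proof -
    obtain \<kappa> where s: "zeta_saddle \<kappa> \<alpha>" using saddle_at[of \<alpha>] al by auto
    note bb = saddle_basic[OF s]
    have "(zim \<alpha> / zre \<alpha>)\<^sup>2 = 3 - 1 / (zre \<alpha>)\<^sup>2"
      using bb by (simp add: power_divide diff_divide_distrib)
    then have "zim \<alpha> / zre \<alpha> = sqrt (3 - 1 / (zre \<alpha>)\<^sup>2)"
      by (intro real_sqrt_unique[symmetric] divide_nonneg_nonneg) (use bb in auto)
    then have "zeta \<alpha> = of_real (zre \<alpha>) * Complex 1 (sqrt (3 - 1 / (zre \<alpha>)\<^sup>2))"
      using bb(3) by (simp add: zeta_Complex complex_eq_iff field_simps)
    then show "C_amp \<alpha> = of_real (4 * sqrt \<alpha> / sqrt pi * zre \<alpha>) * w \<alpha>"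
      by (simp add: C_amp_def w_def)
    show "0 < 4 * sqrt \<alpha> / sqrt pi * zre \<alpha>" using bb by simp
    show "zre \<alpha> \<noteq> 0" using bb by simp
    have s0: "Re (sqrt_branch \<alpha>) > 0" using Re_sqrt_branch_pos al by auto
    then show s1: "sqrt_branch \<alpha> \<noteq> 0" by auto
    show "w \<alpha> \<notin> \<real>\<^sub>\<le>\<^sub>0"
    proof
      assume "w \<alpha> \<in> \<real>\<^sub>\<le>\<^sub>0"
      then obtain t where t: "w \<alpha> = of_real t" "t \<le> 0" by (auto elim!: nonpos_Reals_cases)
      then have "Complex 1 (sqrt (3 - 1 / (zre \<alpha>)\<^sup>2)) = of_real t * sqrt_branch \<alpha>"
        using s1 by (simp add: w_def field_simps)
      then have "1 = t * Re (sqrt_branch \<alpha>)" by (simp add: complex_eq_iff)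
      then show False using t s0 by (smt (verit) mult_nonneg_nonneg mult_minus_left)
    qed
  qed
  have "continuous_on ?I (\<lambda>\<alpha>. (1 + \<i> * of_real (sqrt (3 - 1 / (zre \<alpha>)\<^sup>2))) / sqrt_branch \<alpha>)"
    by (intro continuous_intros continuous_zre sqrt_branch_spec(1)) (use w in auto)
  also have "(\<lambda>\<alpha>. (1 + \<i> * of_real (sqrt (3 - 1 / (zre \<alpha>)\<^sup>2))) / sqrt_branch \<alpha>) = w"
    by (simp add: w_def fun_eq_iff Complex_eq)
  finally have cw: "continuous_on ?I w" .
  have cb: "continuous_on ?I b" unfolding b_def
    by (intro continuous_intros cw) (use w in auto)
  have eb: "\<forall>\<alpha>\<in>?I. C_amp \<alpha> = of_real (B_amp \<alpha>) * exp (\<i> * of_real (b \<alpha>))"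
  proof
    fix \<alpha> assume al: "\<alpha> \<in> ?I"
    have "w \<alpha> \<noteq> 0" using w(3)[OF al] by auto
    then show "C_amp \<alpha> = of_real (B_amp \<alpha>) * exp (\<i> * of_real (b \<alpha>))"
      unfolding B_amp_def b_def w(1)[OF al] by (intro polar_Ln w al)
  qed
  have lb: "(b \<longlongrightarrow> pi / 3) (at_right 0)"
  proof -
    have ev: "\<forall>\<^sub>F \<alpha> in at_right 0. norm (1 / (zre \<alpha>)\<^sup>2) \<le> 8 * sqrt \<alpha>"
      using eventually_at_right_alpha by eventually_elim (use saddle_small in auto)
    have "((\<lambda>\<alpha>. 8 * sqrt \<alpha>) \<longlongrightarrow> 8 * sqrt 0) (at_right 0)" by (intro tendsto_intros)
    then have "((\<lambda>\<alpha>. 8 * sqrt \<alpha>) \<longlongrightarrow> 0) (at_right 0)" by simp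
    from Lim_null_comparison[OF ev this]
    have "((\<lambda>\<alpha>. Complex 1 (sqrt (3 - 1 / (zre \<alpha>)\<^sup>2)) / sqrt_branch \<alpha>)
       \<longlongrightarrow> Complex 1 (sqrt (3 - 0)) / of_real (sqrt 3)) (at_right 0)"
      by (intro tendsto_intros sqrt_branch_spec(3)) auto
    also have "Complex 1 (sqrt (3 - 0)) / of_real (sqrt 3) = of_real (2 / sqrt 3) * exp (\<i> * of_real (pi / 3))"
      unfolding cis_conv_exp [symmetric] by (simp add: complex_eq_iff cos_60 sin_60 field_simps)
    finally have lw: "(w \<longlongrightarrow> of_real (2 / sqrt 3) * exp (\<i> * of_real (pi / 3))) (at_right 0)"
      unfolding w_def .
    have L: "Ln (of_real (2 / sqrt 3) * exp (\<i> * of_real (pi / 3))) = of_real (ln (2 / sqrt 3)) + \<i> * of_real (pi / 3)"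
      using Ln_of_real[of "2 / sqrt 3"] by (subst Ln_times_of_real) auto
    have "Re (of_real (2 / sqrt 3) * exp (\<i> * of_real (pi / 3))) > 0"
      unfolding cis_conv_exp [symmetric] by (simp add: cos_60)
    then have "((\<lambda>\<alpha>. Im (Ln (w \<alpha>))) \<longlongrightarrow> Im (Ln (of_real (2 / sqrt 3) * exp (\<i> * of_real (pi / 3))))) (at_right 0)"
      by (intro tendsto_intros lw) (auto simp: complex_nonpos_Reals_iff)
    then show ?thesis unfolding L b_def by simp
  qed
  have "\<exists>b. continuous_on ?I b
      \<and> (\<forall>\<alpha>\<in>?I. C_amp \<alpha> = of_real (B_amp \<alpha>) * exp (\<i> * of_real (b \<alpha>)))
      \<and> (b \<longlongrightarrow> pi / 3) (at_right 0)" using cb eb lb by blast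
  from someI_ex[OF this, folded beta_def] show ?thesis using assms by auto
qed

section \<open>Gaussian integrals\<close>

lemma gauss_integral:
  fixes a :: real assumes "0 < a"
  shows gauss_integrable: "integrable lborel (\<lambda>x. exp (- a * x\<^sup>2))"
    and gauss_half_moment: "has_bochner_integral lborel (\<lambda>x. indicator {0..} x *\<^sub>R (\<bar>x\<bar> * exp (- a * x\<^sup>2))) (1 / (2 * a))"
    and gauss_abs_moment: "has_bochner_integral lborel (\<lambda>x. \<bar>x\<bar> * exp (- a * x\<^sup>2)) (1 / a)"
proof -
  have "has_bochner_integral lborel (\<lambda>x::real. exp (- x\<^sup>2)) (2 *\<^sub>R (sqrt pi / 2))"
    using has_bochner_integral_even_function[OF gaussian_moment_0] by simp
  then have "integrable lborel (\<lambda>x::real. exp (- x\<^sup>2))" by (simp add: has_bochner_integral_iff)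
  from lborel_integrable_real_affine[OF this, of "sqrt a" 0]
  show "integrable lborel (\<lambda>x. exp (- a * x\<^sup>2))"
    using assms by (simp add: power_mult_distrib)
  have "has_bochner_integral lborel (\<lambda>x::real. indicator {0..} x *\<^sub>R (\<bar>x\<bar> * exp (- x\<^sup>2))) (1 / 2)"
    using gaussian_moment_odd_pos[of 0]
    by (rule has_bochner_integral_cong[THEN iffD1, rotated -1]) (auto split: split_indicator)
  then have "has_bochner_integral lborel (\<lambda>x. indicator {0..} (0 + sqrt a * x) *\<^sub>R
      (\<bar>0 + sqrt a * x\<bar> * exp (- (0 + sqrt a * x)\<^sup>2))) ((1 / 2) /\<^sub>R \<bar>sqrt a\<bar>)"
    by (subst (asm) lborel_has_bochner_integral_real_affine_iff[where c="sqrt a" and t=0]) (use assms in auto)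
  also have "(\<lambda>x. indicator {0..} (0 + sqrt a * x) *\<^sub>R (\<bar>0 + sqrt a * x\<bar> * exp (- (0 + sqrt a * x)\<^sup>2)))
      = (\<lambda>x. sqrt a * (indicator {0..} x *\<^sub>R (\<bar>x\<bar> * exp (- a * x\<^sup>2))))"
    using assms by (auto simp: fun_eq_iff power_mult_distrib abs_mult zero_le_mult_iff split: split_indicator)
  finally have "has_bochner_integral lborel (\<lambda>x. 1 / sqrt a * (sqrt a * (indicator {0..} x *\<^sub>R (\<bar>x\<bar> * exp (- a * x\<^sup>2)))))
      (1 / sqrt a * ((1 / 2) /\<^sub>R \<bar>sqrt a\<bar>))"
    by (intro has_bochner_integral_mult_right) auto
  also have "(\<lambda>x. 1 / sqrt a * (sqrt a * (indicator {0..} x *\<^sub>R (\<bar>x\<bar> * exp (- a * x\<^sup>2))))) =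
      (\<lambda>x. indicator {0..} x *\<^sub>R (\<bar>x\<bar> * exp (- a * x\<^sup>2)))" using assms by (auto simp: fun_eq_iff)
  also have "1 / sqrt a * ((1 / 2) /\<^sub>R \<bar>sqrt a\<bar>) = 1 / (2 * (sqrt a * sqrt a))" using assms by (simp add: field_simps)
  also have "sqrt a * sqrt a = a" using assms by simp
  finally show half: "has_bochner_integral lborel (\<lambda>x. indicator {0..} x *\<^sub>R (\<bar>x\<bar> * exp (- a * x\<^sup>2))) (1 / (2 * a))" .
  from has_bochner_integral_even_function[OF half]
  show "has_bochner_integral lborel (\<lambda>x. \<bar>x\<bar> * exp (- a * x\<^sup>2)) (1 / a)" by simp
qed

lemma cmod_exp_quadratic: "cmod (exp (- b * of_real (x\<^sup>2))) = exp (- Re b * x\<^sup>2)"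
  by (simp flip: of_real_power)

lemma integral_gauss_first_moment:
  fixes b :: complex assumes b: "0 < Re b"
  shows "has_bochner_integral lborel (\<lambda>x. indicator {0..} x *\<^sub>R (of_real x * exp (- b * of_real (x\<^sup>2)))) (1 / (2 * b))"
proof -
  let ?f = "\<lambda>x::real. of_real x * exp (- b * of_real (x\<^sup>2))"
  let ?G = "\<lambda>x::real. - exp (- b * of_real (x\<^sup>2)) / (2 * b)"
  have b0: "b \<noteq> 0" using b by auto
  have "integrable lborel (\<lambda>x. \<bar>x\<bar> * exp (- Re b * x\<^sup>2))"
    using gauss_abs_moment[OF b] by (simp add: has_bochner_integral_iff)
  then have int0: "integrable lborel ?f"
    by (rule Bochner_Integration.integrable_bound)
       (auto simp: norm_mult intro!: AE_I2 borel_measurable_continuous_onI continuous_intros simp flip: of_real_power)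
  have int: "set_integrable lborel {0..} ?f"
    unfolding set_integrable_def using int0 by (intro integrable_mult_indicator) auto
  have FTC: "set_lebesgue_integral lborel {0..R} ?f = ?G R - ?G 0" if "R \<ge> 0" for R
    unfolding set_lebesgue_integral_def
  proof (rule integral_FTC_Icc[OF that])
    show "(?G has_vector_derivative ?f x) (at x within {0..R})" for x
      using b0 by (auto intro!: derivative_eq_intros has_vector_derivative_real_field simp: field_simps)
    show "continuous_on {0..R} ?f" by (intro continuous_intros)
  qed
  have "((\<lambda>R. set_lebesgue_integral lborel {0..R} ?f) \<longlongrightarrow> set_lebesgue_integral lborel {0..} ?f) at_top"
    by (rule tendsto_set_lebesgue_integral_at_top[OF _ int]) auto
  moreover have "((\<lambda>R. ?G R - ?G 0) \<longlongrightarrow> 0 - ?G 0) at_top"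
  proof (intro tendsto_intros)
    have "((\<lambda>R::real. exp (- c * R\<^sup>2) / d) \<longlongrightarrow> 0) at_top" if "c > 0" for c d :: real
    proof (rule tendsto_divide_zero)
      show "((\<lambda>R::real. exp (- c * R\<^sup>2)) \<longlongrightarrow> 0) at_top" using that by real_asymp
    qed
    from this[OF b, of "cmod (2 * b)"]
    have "((\<lambda>R. norm (?G R)) \<longlongrightarrow> 0) at_top"
      by (simp only: norm_divide norm_minus_cancel cmod_exp_quadratic)
    then show "(?G \<longlongrightarrow> 0) at_top" by (rule tendsto_norm_zero_cancel)
  qed
  then have "((\<lambda>R. set_lebesgue_integral lborel {0..R} ?f) \<longlongrightarrow> 0 - ?G 0) at_top"
    by (rule Lim_transform_eventually)
       (rule eventually_mono[OF eventually_ge_at_top[of 0]], rule FTC[symmetric])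
  ultimately have "set_lebesgue_integral lborel {0..} ?f = 0 - ?G 0"
    by (rule tendsto_unique[OF trivial_limit_at_top_linorder])
  then show ?thesis using int
    unfolding set_lebesgue_integral_def set_integrable_def by (simp add: has_bochner_integral_iff)
qed

lemma arctan_density: "has_bochner_integral lborel (\<lambda>s. indicator {0..} s *\<^sub>R (1 / (1 + s\<^sup>2))) (pi / 2 :: real)"
proof -
  have e: "einterval 0 \<infinity> = {0<..}" by (auto simp: einterval_def)
  have "has_bochner_integral lborel (\<lambda>s. indicator {0<..} s *\<^sub>R (1 / (1 + s\<^sup>2))) (pi / 2 :: real)"
    using integrable_I0i_1_div_plus_square LBINT_I0i_1_div_plus_square
    by (simp add: has_bochner_integral_iff interval_lebesgue_integrable_def interval_lebesgue_integral_def
        e set_integrable_def set_lebesgue_integral_def)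
  also have "?this \<longleftrightarrow> ?thesis"
  proof (rule has_bochner_integral_cong_AE)
    show "AE s::real in lborel. indicator {0<..} s *\<^sub>R (1 / (1 + s\<^sup>2)) = indicator {0..} s *\<^sub>R (1 / (1 + s\<^sup>2))"
      using AE_lborel_singleton[of 0] by eventually_elim (auto simp: indicator_def)
  qed auto
  finally show ?thesis .
qed

text \<open>The polar-coordinate substitution \<open>y = x s\<close> turns the square of the half-line integral into
\<open>\<integral>\<integral> x exp (- a x\<^sup>2 (1 + s\<^sup>2))\<close>, in which the inner integral over \<open>x\<close> is elementary also for complex
\<open>a\<close>. The square determines the integral up to sign, which suffices for comparing absolute values of
real parts.\<close>

lemma complex_gauss_integral:
  fixes a :: complex assumes a: "0 < Re a"
  shows complex_gauss_integrable: "integrable lborel (\<lambda>x. exp (- a * of_real (x\<^sup>2)))"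
    and complex_gauss_square: "(LINT x|lborel. exp (- a * of_real (x\<^sup>2)))\<^sup>2 = of_real pi / a"
proof -
  let ?g = "\<lambda>x. exp (- a * of_real (x\<^sup>2))"
  show int: "integrable lborel ?g"
    by (rule Bochner_Integration.integrable_bound[OF gauss_integrable[OF a]])
       (auto intro!: AE_I2 borel_measurable_continuous_onI continuous_intros simp flip: of_real_power)
  define I where "I = (LINT x|lborel. indicator {0..} x *\<^sub>R ?g x)"
  have hI: "has_bochner_integral lborel (\<lambda>x. indicator {0..} x *\<^sub>R ?g x) I"
    unfolding I_def has_bochner_integral_iff using int by (intro conjI integrable_mult_indicator) auto
  have half: "(LINT x|lborel. ?g x) = 2 * I"
    using has_bochner_integral_even_function[OF hI] by (simp add: has_bochner_integral_iff scaleR_conv_of_real)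
  define K where "K = (\<lambda>s x::real. indicator {0..} s *\<^sub>R (indicator {0..} x *\<^sub>R
      (of_real x * exp (- (a * of_real (1 + s\<^sup>2)) * of_real (x\<^sup>2)))))"
  have Kx: "has_bochner_integral lborel (K s) (indicator {0..} s *\<^sub>R (1 / (2 * (a * of_real (1 + s\<^sup>2)))))" for s
  proof -
    have "Re (a * of_real (1 + s\<^sup>2)) > 0" using a by (simp add: add_pos_nonneg)
    then show ?thesis unfolding K_def
      by (intro has_bochner_integral_scaleR_right integral_gauss_first_moment)
  qed
  have nKx: "(LINT x|lborel. norm (K s x)) = indicator {0..} s *\<^sub>R (1 / (1 + s\<^sup>2)) * (1 / (2 * Re a))" for s
  proof -
    have p: "Re a * (1 + s\<^sup>2) > 0" using a by (simp add: add_pos_nonneg)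
    have "norm (K s x) = indicator {0..} s * (indicator {0..} x *\<^sub>R (\<bar>x\<bar> * exp (- (Re a * (1 + s\<^sup>2)) * x\<^sup>2)))" for x
      unfolding K_def norm_scaleR norm_mult cmod_exp_quadratic by simp
    then show ?thesis
      using gauss_half_moment[OF p] by (simp add: has_bochner_integral_iff)
  qed
  have "integrable (lborel \<Otimes>\<^sub>M lborel) (case_prod K)"
  proof (rule lborel_pair.Fubini_integrable)
    show "case_prod K \<in> borel_measurable (lborel \<Otimes>\<^sub>M lborel)"
      unfolding K_def by measurable
    show "integrable lborel (\<lambda>s. LINT x|lborel. norm (case_prod K (s, x)))"
      using arctan_density unfolding case_prod_conv nKx has_bochner_integral_iff
      by (intro integrable_mult_left) auto
    show "AE s in lborel. integrable lborel (\<lambda>x. case_prod K (s, x))"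
      using Kx by (simp add: has_bochner_integral_iff)
  qed
  then have "(LINT x|lborel. LINT s|lborel. K s x) = (LINT s|lborel. LINT x|lborel. K s x)"
    by (rule lborel_pair.Fubini_integral)
  also have "... = (LINT s|lborel. of_real (indicator {0..} s *\<^sub>R (1 / (1 + s\<^sup>2))) * (1 / (2 * a)))"
    using Kx by (intro Bochner_Integration.integral_cong) (auto simp: has_bochner_integral_iff split: split_indicator)
  also have "... = of_real (pi / 2) * (1 / (2 * a))"
    using arctan_density by (simp only: integral_mult_left_zero integral_complex_of_real has_bochner_integral_iff)
  also have "(LINT x|lborel. LINT s|lborel. K s x) = (LINT x|lborel. (indicator {0..} x *\<^sub>R ?g x) * I)"
  proof (rule integral_cong_AE)
    show "AE x in lborel. (LINT s|lborel. K s x) = (indicator {0..} x *\<^sub>R ?g x) * I"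
      using AE_lborel_singleton[of 0]
    proof eventually_elim
      case (elim x)
      show ?case
      proof (cases "x > 0")
        case True
        have "I = \<bar>x\<bar> *\<^sub>R (LINT s|lborel. indicator {0..} (0 + x * s) *\<^sub>R ?g (0 + x * s))"
          unfolding I_def using elim by (rule lborel_integral_real_affine)
        also have "(\<lambda>s. indicator {0..} (0 + x * s) *\<^sub>R ?g (0 + x * s)) = (\<lambda>s. indicator {0..} s *\<^sub>R ?g (x * s))"
          using True by (auto simp: fun_eq_iff zero_le_mult_iff split: split_indicator)
        finally have "(indicator {0..} x *\<^sub>R ?g x) * I =
           (LINT s|lborel. (?g x * of_real x) * (indicator {0..} s *\<^sub>R ?g (x * s)))"
          unfolding integral_mult_right_zero using True by (simp add: scaleR_conv_of_real)
        also have "... = (LINT s|lborel. K s x)"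
          using True by (intro Bochner_Integration.integral_cong)
             (auto simp: K_def mult_exp_exp algebra_simps power_mult_distrib split: split_indicator)
        finally show ?thesis by simp
      qed (use elim in \<open>simp add: K_def\<close>)
    qed
  qed (auto simp: K_def)
  also have "... = I * I" unfolding integral_mult_left_zero by (simp only: I_def)
  finally have "I * I = of_real (pi / 2) * (1 / (2 * a))" .
  then show "(LINT x|lborel. ?g x)\<^sup>2 = of_real pi / a"
    unfolding half by (simp add: power2_eq_square)
qed

section \<open>The coefficient as an integral along a vertical line\<close>

text \<open>The recursion of the Chebyshev polynomials is that of the powers of \<open>w\<close>, as
\<open>w\<^sup>2 = 2 Re w * w - 1\<close> on the unit circle.\<close>

lemma Cheb_T_unit_circle:
  assumes "cmod w = 1"
  shows "poly (Cheb_T n) (Re w) = Re (w ^ n)"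
proof (induction n rule: Cheb_T.induct)
  case (3 n)
  have "(Re w)\<^sup>2 + (Im w)\<^sup>2 = 1" using assms by (simp add: cmod_def)
  then have "w * w = 2 * of_real (Re w) * w - 1"
    by (simp add: expand_powers complex_eq_iff)
  then have "w ^ Suc (Suc n) = (2 * of_real (Re w) * w - 1) * w ^ n"
    by (metis mult.assoc power_Suc)
  also have "... = of_real (2 * Re w) * w ^ Suc n - w ^ n" by (simp add: left_diff_distrib)
  finally have "Re (w ^ Suc (Suc n)) = 2 * Re w * Re (w ^ Suc n) - Re (w ^ n)"
    by (simp only: Re_complex_of_real minus_complex.sel times_complex.sel Im_complex_of_real mult_zero_left diff_zero)
  then show ?case using 3 by (simp del: power_Suc)
qed auto

lemma power_quotient_split: "u ^ k / v ^ (k + 2) = (u / v) ^ Suc k / (u * v)" if "u \<noteq> 0" "v \<noteq> 0" for u v :: complex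
  using that by (simp add: power_divide power_add power2_eq_square)

text \<open>The kernel for the coefficient of index \<open>n = k + 1\<close>. Written in this way, the pole of
\<open>1 / (1 - z\<^sup>2)\<close> at \<open>1\<close> is absorbed by a zero of \<open>((1 - z) / (1 + z))^n\<close>.\<close>

definition kern :: "nat \<Rightarrow> real \<Rightarrow> complex \<Rightarrow> complex" where
  "kern k lam z = (1 - z) ^ k / (1 + z) ^ (k + 2) * exp (of_real lam * z\<^sup>2)"

lemma kern_bound:
  assumes "0 \<le> x"
  shows "cmod (kern k lam (Complex x y)) \<le> exp (lam * (x\<^sup>2 - y\<^sup>2))"
proof -
  let ?z = "Complex x y"
  have le: "cmod (1 - ?z) \<le> cmod (1 + ?z)"
    unfolding cmod_def using assms by (simp add: expand_powers)
  have ge1: "1 \<le> cmod (1 + ?z)" using complex_Re_le_cmod[of "1 + ?z"] assms by simp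
  have "cmod (1 - ?z) ^ k \<le> cmod (1 + ?z) ^ k" using le by (intro power_mono) auto
  also have "... \<le> cmod (1 + ?z) ^ (k + 2)" using ge1 by (intro power_increasing) auto
  finally have "cmod ((1 - ?z) ^ k / (1 + ?z) ^ (k + 2)) \<le> 1"
    using ge1 by (simp add: norm_divide norm_power divide_le_eq del: power_Suc)
  moreover have "cmod (exp (of_real lam * ?z\<^sup>2)) = exp (lam * (x\<^sup>2 - y\<^sup>2))"
    by (simp add: Re_power2)
  ultimately show ?thesis unfolding kern_def norm_mult
    by (metis exp_ge_zero mult_left_le_one_le norm_ge_zero)
qed

lemma kern_line_integrable:
  assumes "0 \<le> x" "0 < lam"
  shows "integrable lborel (\<lambda>y. kern k lam (Complex x y))"
proof (rule Bochner_Integration.integrable_bound)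
  show "integrable lborel (\<lambda>y. exp (lam * x\<^sup>2) * exp (- lam * y\<^sup>2))"
    by (intro integrable_mult_right gauss_integrable assms)
  have "exp (lam * x\<^sup>2) * exp (- lam * y\<^sup>2) = exp (lam * (x\<^sup>2 - y\<^sup>2))" for y
    unfolding exp_add[symmetric] by (simp add: right_diff_distrib)
  then show "AE y in lborel. norm (kern k lam (Complex x y)) \<le> norm (exp (lam * x\<^sup>2) * exp (- lam * y\<^sup>2))"
    using kern_bound[OF assms(1), of k lam] by simp
  have "1 + (of_real x + \<i> * of_real y) \<noteq> 0" for y using assms by (simp add: complex_eq_iff)
  then have "continuous_on UNIV (\<lambda>y. kern k lam (of_real x + \<i> * of_real y))"
    unfolding kern_def by (intro continuous_intros) auto
  then show "(\<lambda>y. kern k lam (Complex x y)) \<in> borel_measurable lborel"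
    by (simp add: Complex_eq borel_measurable_continuous_onI)
qed

lemma kern_line_set_integrable:
  assumes "0 \<le> x" "0 < lam" and [measurable]: "S \<in> sets borel"
  shows "set_integrable lborel S (\<lambda>y. kern k lam (Complex x y))"
    and "set_integrable lborel S (\<lambda>y. Re (kern k lam (Complex x y)))"
  unfolding set_integrable_def using kern_line_integrable[OF assms(1,2)]
  by (intro integrable_mult_indicator integrable_Re; simp)+

text \<open>For \<open>g t = (1 - t\<^sup>2) / (1 + t\<^sup>2)\<close> one has \<open>(1 - g t) / (1 + g t) = t\<^sup>2\<close>, and \<open>g t\<close> is the real part of
the point \<open>(1 - i t) / (1 + i t)\<close> of the unit circle, so all three factors of the integrand become
explicit.\<close>

lemma cheb_coeff_kern:
  assumes "0 < lam"
  shows "cheb_coeff (Suc k) lam = 4 / pi * integral {0<..} (\<lambda>t. Re (kern k lam (Complex 0 t)))"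
proof -
  define g where "g = (\<lambda>t::real. (1 - t\<^sup>2) / (1 + t\<^sup>2))"
  define g' where "g' = (\<lambda>t::real. - 4 * t / (1 + t\<^sup>2)\<^sup>2)"
  define f where "f = (\<lambda>x. F lam x * poly (Cheb_T (Suc k)) x / sqrt (1 - x\<^sup>2))"
  have p: "1 + t\<^sup>2 > 0" for t :: real by (simp add: add_pos_nonneg)
  have gm: "1 - g t = 2 * t\<^sup>2 / (1 + t\<^sup>2)" "1 + g t = 2 / (1 + t\<^sup>2)" for t
    using p[of t] by (auto simp: g_def field_simps)
  have img: "g ` {0<..} = {-1<..<1}"
  proof (intro equalityI subsetI)
    fix x assume "x \<in> g ` {0<..}"
    then obtain t where t: "x = g t" "t > 0" by auto
    have "1 - x > 0" "1 + x > 0" unfolding t gm using t p[of t] by auto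
    then show "x \<in> {-1<..<1}" by auto
  next
    fix x :: real assume x: "x \<in> {-1<..<1}"
    define t where "t = sqrt ((1 - x) / (1 + x))"
    have t: "t > 0" "t\<^sup>2 = (1 - x) / (1 + x)" using x by (auto simp: t_def)
    have "1 + t\<^sup>2 = 2 / (1 + x)" "1 - t\<^sup>2 = 2 * x / (1 + x)" using x unfolding t(2) by (auto simp: field_simps)
    then have "g t = x" using x by (simp add: g_def)
    then show "x \<in> g ` {0<..}" using t by auto
  qed
  have inj: "inj_on g {0<..}"
  proof (rule inj_onI)
    fix s t :: real assume st: "s \<in> {0<..}" "t \<in> {0<..}" "g s = g t"
    have "1 + s\<^sup>2 = 2 / (1 + g s)" "1 + t\<^sup>2 = 2 / (1 + g t)" unfolding gm by simp_all
    then have "s\<^sup>2 = t\<^sup>2" unfolding st(3) by linarith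
    then show "s = t" by (rule power2_eq_imp_eq) (use st(1,2) in simp_all)
  qed
  have der: "(g has_field_derivative g' t) (at t within S)" for t S
    unfolding g_def g'_def using p[of t]
    by (auto intro!: derivative_eq_intros simp: power2_eq_square field_simps)
  have eq: "\<bar>g' t\<bar> * f (g t) = 2 * Re (kern k lam (Complex 0 t))" if "t \<in> {0<..}" for t
  proof -
    have t: "t > 0" using that by simp
    define w where "w = (1 - Complex 0 t) / (1 + Complex 0 t)"
    have n0: "1 + Complex 0 t \<noteq> 0" by (simp add: complex_eq_iff)
    have "cmod (1 - Complex 0 t) = cmod (1 + Complex 0 t)" unfolding cmod_def by simp
    then have w1: "cmod w = 1" using n0 by (simp add: w_def norm_divide)
    have pr: "(1 - Complex 0 t) * (1 + Complex 0 t) = of_real (1 + t\<^sup>2)"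
      by (simp add: complex_eq_iff power2_eq_square)
    have wg: "Re w = g t"
      using p[of t] by (simp add: w_def g_def Re_divide power2_eq_square)
    have T: "poly (Cheb_T (Suc k)) (g t) = Re (w ^ Suc k)" using Cheb_T_unit_circle[OF w1] wg by metis
    have e: "kern k lam (Complex 0 t) = of_real (exp (- lam * t\<^sup>2) / (1 + t\<^sup>2)) * w ^ Suc k"
    proof -
      have "(1 - Complex 0 t) ^ k / (1 + Complex 0 t) ^ (k + 2) = w ^ Suc k / ((1 - Complex 0 t) * (1 + Complex 0 t))"
      proof -
        have "1 - Complex 0 t \<noteq> 0" by (simp add: complex_eq_iff)
        then show ?thesis unfolding w_def using n0 by (rule power_quotient_split)
      qed
      moreover have "exp (of_real lam * (Complex 0 t)\<^sup>2) = of_real (exp (- lam * t\<^sup>2))"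
        by (simp add: exp_of_real[symmetric] Complex_eq power_mult_distrib)
      ultimately show ?thesis unfolding kern_def pr by simp
    qed
    have F: "F lam (g t) = exp (- lam * t\<^sup>2)"
    proof -
      have "g t \<noteq> -1" using gm(2)[of t] p[of t] by auto
      moreover have "(1 - g t) / (1 + g t) = t\<^sup>2" unfolding gm using p[of t] by (simp add: field_simps)
      ultimately show ?thesis by (simp add: F_def)
    qed
    have "1 - (g t)\<^sup>2 = (1 - g t) * (1 + g t)" by (simp add: expand_powers)
    also have "... = (2 * t / (1 + t\<^sup>2))\<^sup>2" unfolding gm by (simp add: power2_eq_square)
    finally have s: "sqrt (1 - (g t)\<^sup>2) = 2 * t / (1 + t\<^sup>2)" using t p[of t] by simp
    have a: "\<bar>g' t\<bar> = 4 * t / (1 + t\<^sup>2)\<^sup>2" using t by (simp add: g'_def abs_mult)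
    have alg: "4 * t / q\<^sup>2 * (X * R / (2 * t / q)) = 2 * (X / q * R)" if "q > 0" for q X R
      using t that by (simp add: power2_eq_square)
    have "Re (kern k lam (Complex 0 t)) = exp (- lam * t\<^sup>2) / (1 + t\<^sup>2) * Re (w ^ Suc k)"
      unfolding e by (simp only: times_complex.sel Re_complex_of_real Im_complex_of_real mult_zero_left diff_zero)
    then show ?thesis unfolding f_def F T s a using alg[OF p[of t]] by metis
  qed
  have int: "integrable lborel (\<lambda>t. 2 * Re (kern k lam (Complex 0 t)))"
    using kern_line_integrable[of 0 lam k] assms by (intro integrable_mult_right integrable_Re) auto
  have "set_integrable lborel {0<..} (\<lambda>t. 2 * Re (kern k lam (Complex 0 t)))"
    unfolding set_integrable_def using int by (intro integrable_mult_indicator) auto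
  then have "(\<lambda>t. 2 * Re (kern k lam (Complex 0 t))) absolutely_integrable_on {0<..}"
    unfolding set_integrable_def by (subst integrable_completion) auto
  moreover have "(\<lambda>t. \<bar>g' t\<bar> * f (g t)) absolutely_integrable_on {0<..} \<longleftrightarrow>
      (\<lambda>t. 2 * Re (kern k lam (Complex 0 t))) absolutely_integrable_on {0<..}"
    by (rule set_integrable_cong[OF refl refl eq])
  ultimately have ai: "(\<lambda>t. \<bar>g' t\<bar> * f (g t)) absolutely_integrable_on {0<..}" by (simp only:)
  have "{0<..} \<in> sets (lebesgue :: real measure)" by simp
  from has_absolute_integral_change_of_variables_1'[OF this der inj, of f] ai
  have "integral (g ` {0<..}) f = integral {0<..} (\<lambda>t. \<bar>g' t\<bar> * f (g t))"
    by (metis (no_types, lifting))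
  also have "... = integral {0<..} (\<lambda>t. 2 * Re (kern k lam (Complex 0 t)))"
    by (intro Henstock_Kurzweil_Integration.integral_cong eq)
  finally have "integral {-1..1} f = 2 * integral {0<..} (\<lambda>t. Re (kern k lam (Complex 0 t)))"
    unfolding img by (simp add: integral_open_interval_real)
  then show ?thesis unfolding cheb_coeff_def f_def by simp
qed

text \<open>Cauchy's theorem for the rectangle with corners \<open>0\<close> and \<open>r + i R\<close>, expressed through a primitive
\<open>G\<close>: the side on the real axis contributes nothing because the kernel is real there, and the top
side vanishes as \<open>R \<rightarrow> \<infinity>\<close>.\<close>

lemma kern_line_shift:
  assumes "0 \<le> r" "0 < lam"
  shows "(LINT y:{0..}|lborel. Re (kern k lam (Complex r y))) = (LINT y:{0..}|lborel. Re (kern k lam (Complex 0 y)))"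
proof -
  let ?U = "{z. Re z > -1}"
  have nz: "1 + z \<noteq> 0" if "Re z > -1" for z using that by (auto simp: complex_eq_iff)
  have "kern k lam holomorphic_on ?U"
    unfolding kern_def by (intro holomorphic_intros) (use nz in auto)
  then obtain G where G: "\<And>z. z \<in> ?U \<Longrightarrow> (G has_field_derivative kern k lam z) (at z within ?U)"
    using holomorphic_convex_primitive'[of ?U "kern k lam"] convex_halfspace_Re_gt open_halfspace_Re_gt by blast
  then have G': "(G has_field_derivative kern k lam z) (at z within S)" if "Re z > -1" for z S
    using that at_within_open[OF _ open_halfspace_Re_gt] by (metis has_field_derivative_at_within mem_Collect_eq)
  note int = kern_line_set_integrable(2)[OF _ assms(2), where S = "{0..}", simplified]
  have FTC: "(LINT y:{0..R}|lborel. Re (kern k lam (Complex x y))) = Im (G (Complex x R)) - Im (G (of_real x))"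
    if "0 \<le> x" "0 \<le> R" for x R
  proof -
    have "(LINT y:{0..R}|lborel. Re (kern k lam (Complex x y))) = Im (G (Complex x R)) - Im (G (Complex x 0))"
      unfolding set_lebesgue_integral_def
    proof (rule integral_FTC_Icc[OF that(2)])
      fix y assume "0 \<le> y" "y \<le> R"
      have "((\<lambda>y. G (of_real x + \<i> * of_real y)) has_vector_derivative \<i> * kern k lam (of_real x + \<i> * of_real y)) (at y within {0..R})"
        using that by (auto intro!: derivative_eq_intros field_vector_diff_chain_within[OF _ G', unfolded o_def])
      from bounded_linear.has_vector_derivative[OF bounded_linear_Im this]
      show "((\<lambda>y. Im (G (Complex x y))) has_vector_derivative Re (kern k lam (Complex x y))) (at y within {0..R})"
        by (simp add: Complex_eq)
    next
      have "1 + (of_real x + \<i> * of_real y) \<noteq> 0" for y using that by (simp add: complex_eq_iff)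
      then show "continuous_on {0..R} (\<lambda>y. Re (kern k lam (Complex x y)))"
        unfolding kern_def Complex_eq by (intro continuous_intros) auto
    qed
    then show ?thesis by (simp add: complex_of_real_def)
  qed
  have real_axis: "Im (G (of_real r)) = Im (G 0)"
  proof -
    have "\<exists>c. \<forall>x\<in>{0..r}. Im (G (of_real x)) = c"
    proof (rule has_vector_derivative_zero_constant)
      fix x assume x: "x \<in> {0..r}"
      have "((\<lambda>x. G (of_real x)) has_vector_derivative of_real 1 * kern k lam (of_real x)) (at x within {0..r})"
        by (rule field_vector_diff_chain_within[OF _ G', unfolded o_def], rule has_vector_derivative_of_real)
           (use x in auto)
      from bounded_linear.has_vector_derivative[OF bounded_linear_Im this]
      have "((\<lambda>x::real. Im (G (of_real x))) has_vector_derivative Im (kern k lam (of_real x))) (at x within {0..r})" by simp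
      moreover have "kern k lam (of_real x) = of_real ((1 - x) ^ k / (1 + x) ^ (k + 2) * exp (lam * x\<^sup>2))"
        by (simp add: kern_def flip: exp_of_real)
      ultimately show "((\<lambda>x. Im (G (of_real x))) has_vector_derivative 0) (at x within {0..r})" by simp
    qed auto
    then show ?thesis using assms(1) by (metis atLeastAtMost_iff of_real_0 order_refl)
  qed
  have top: "\<bar>Im (G (Complex r R)) - Im (G (Complex 0 R))\<bar> \<le> exp (lam * r\<^sup>2) * r * exp (- lam * R\<^sup>2)" for R
  proof -
    let ?S = "closed_segment (Complex 0 R) (Complex r R)"
    have S: "\<exists>x. z = Complex x R \<and> 0 \<le> x \<and> x \<le> r" if zS: "z \<in> ?S" for z
    proof -
      obtain u where u: "0 \<le> u" "u \<le> 1" "z = (1 - u) *\<^sub>R Complex 0 R + u *\<^sub>R Complex r R"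
        using zS by (auto simp: in_segment)
      have "z = Complex (u * r) R" unfolding u(3) by (simp add: complex_eq_iff left_diff_distrib)
      moreover have "0 \<le> u * r" "u * r \<le> r" using u(1,2) assms(1) by (simp, intro mult_left_le_one_le)
      ultimately show ?thesis by (intro exI[of _ "u * r"] conjI)
    qed
    have "cmod (G (Complex r R) - G (Complex 0 R)) \<le> exp (lam * (r\<^sup>2 - R\<^sup>2)) * cmod (Complex r R - Complex 0 R)"
    proof (rule field_differentiable_bound[where S = ?S and f' = "kern k lam"])
      fix z assume "z \<in> ?S"
      then obtain x where x: "z = Complex x R" "0 \<le> x" "x \<le> r" using S by blast
      show "(G has_field_derivative kern k lam z) (at z within ?S)" using x by (intro G') auto
      have "cmod (kern k lam z) \<le> exp (lam * (x\<^sup>2 - R\<^sup>2))" using kern_bound x by auto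
      also have "... \<le> exp (lam * (r\<^sup>2 - R\<^sup>2))" using x assms by (simp add: power_mono)
      finally show "cmod (kern k lam z) \<le> exp (lam * (r\<^sup>2 - R\<^sup>2))" .
    qed auto
    also have "cmod (Complex r R - Complex 0 R) = r" unfolding cmod_def using assms by simp
    also have "exp (lam * (r\<^sup>2 - R\<^sup>2)) = exp (lam * r\<^sup>2) * exp (- lam * R\<^sup>2)"
      unfolding exp_add[symmetric] by (simp add: right_diff_distrib)
    finally have "cmod (G (Complex r R) - G (Complex 0 R)) \<le> exp (lam * r\<^sup>2) * r * exp (- lam * R\<^sup>2)"
      by (simp only: mult_ac)
    then show ?thesis using abs_Im_le_cmod[of "G (Complex r R) - G (Complex 0 R)"] by simp
  qed
  define D where "D = (\<lambda>R. (LINT y:{0..R}|lborel. Re (kern k lam (Complex r y))) - (LINT y:{0..R}|lborel. Re (kern k lam (Complex 0 y))))"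
  have "(D \<longlongrightarrow> (LINT y:{0..}|lborel. Re (kern k lam (Complex r y))) - (LINT y:{0..}|lborel. Re (kern k lam (Complex 0 y)))) at_top"
    unfolding D_def using assms int by (intro tendsto_intros tendsto_set_lebesgue_integral_at_top) auto
  moreover have "(D \<longlongrightarrow> 0) at_top"
  proof (rule Lim_null_comparison)
    show "\<forall>\<^sub>F R in at_top. norm (D R) \<le> exp (lam * r\<^sup>2) * r * exp (- lam * R\<^sup>2)"
      using eventually_ge_at_top[of 0]
    proof eventually_elim
      case (elim R)
      have "D R = Im (G (Complex r R)) - Im (G (Complex 0 R))"
        unfolding D_def FTC[OF assms(1) elim] FTC[OF order_refl elim] real_axis by simp
      then show ?case using top[of R] by simp
    qed
    have "((\<lambda>R::real. exp (- lam * R\<^sup>2)) \<longlongrightarrow> 0) at_top" using assms(2) by real_asymp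
    then show "((\<lambda>R. exp (lam * r\<^sup>2) * r * exp (- lam * R\<^sup>2)) \<longlongrightarrow> 0) at_top"
      by (rule tendsto_mult_right_zero)
  qed
  ultimately show ?thesis using tendsto_unique[OF trivial_limit_at_top_linorder] by fastforce
qed

theorem cheb_coeff_vertical_line:
  assumes "0 \<le> r" "0 < lam"
  shows "cheb_coeff (Suc k) lam = 4 / pi * Re (LINT y:{0..}|lborel. kern k lam (Complex r y))"
proof -
  note int = kern_line_set_integrable[OF _ assms(2), where S = "{0..}", simplified]
  have "integral {0<..} (\<lambda>t. Re (kern k lam (Complex 0 t))) = integral {0..} (\<lambda>t. Re (kern k lam (Complex 0 t)))"
    by (intro integral_spike_set negligible_subset[OF negligible_sing[of 0]]) auto
  also have "... = (LINT t:{0..}|lborel. Re (kern k lam (Complex 0 t)))"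
    using set_borel_integral_eq_integral(2)[OF int(2)[of 0]] by simp
  also have "... = (LINT t:{0..}|lborel. Re (kern k lam (Complex r t)))"
    by (rule kern_line_shift[OF assms, symmetric])
  also have "... = Re (LINT t:{0..}|lborel. kern k lam (Complex r t))"
    using integral_Re[OF int(1)[OF assms(1), unfolded set_integrable_def]]
    by (simp add: set_lebesgue_integral_def)
  finally show ?thesis by (simp add: cheb_coeff_kern[OF assms(2)])
qed

section \<open>The exponent near the saddle\<close>

lemma square_minus_one: "z\<^sup>2 - 1 = (z - 1) * (z + 1)" for z :: complex
  by (simp add: expand_powers)

text \<open>The map \<open>z \<mapsto> (z - 1) / (z + 1)\<close> preserves the upper half-plane, so the principal logarithm in
\<open>psi\<close> is holomorphic there.\<close>

lemma psi_arg:
  assumes "Im z > 0"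
  shows "Im ((z - 1) / (z + 1)) > 0" "z - 1 \<noteq> 0" "z + 1 \<noteq> 0" "z\<^sup>2 - 1 \<noteq> 0"
proof -
  show nz: "z - 1 \<noteq> 0" "z + 1 \<noteq> 0" using assms by (auto simp: complex_eq_iff)
  have "Im ((z - 1) / (z + 1)) = 2 * Im z / (cmod (z + 1))\<^sup>2"
    unfolding Im_divide cmod_power2 by (simp add: algebra_simps)
  then show "Im ((z - 1) / (z + 1)) > 0" using assms nz by simp
  show "z\<^sup>2 - 1 \<noteq> 0" using nz by (simp add: square_minus_one)
qed

lemma inverse_square_difference:
  fixes z :: complex
  assumes "z - 1 \<noteq> 0" "z + 1 \<noteq> 0"
  shows "- 1 / (z - 1)\<^sup>2 + 1 / (z + 1)\<^sup>2 = - 4 * z / (z\<^sup>2 - 1)\<^sup>2"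
proof -
  have "- 1 / u\<^sup>2 + 1 / v\<^sup>2 = (u\<^sup>2 - v\<^sup>2) / (u * v)\<^sup>2" if "u \<noteq> 0" "v \<noteq> 0" for u v :: complex
    using that by (simp add: power_mult_distrib divide_simps)
  moreover have "(z - 1)\<^sup>2 - (z + 1)\<^sup>2 = - 4 * z" by (simp add: expand_powers)
  ultimately show ?thesis unfolding square_minus_one using assms by metis
qed

lemma exp_psi:
  assumes "Im z > 0"
  shows "exp (psi \<alpha> z) = (z - 1) / (z + 1) * exp (of_real \<alpha> * z\<^sup>2)"
  using psi_arg[OF assms] by (simp add: psi_def exp_add)

text \<open>The derivatives of \<open>psi\<close> up to order three, indexed as a family for Taylor's formula.\<close>

definition psi_d :: "real \<Rightarrow> nat \<Rightarrow> complex \<Rightarrow> complex" where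
  "psi_d \<alpha> j z = (if j = 0 then psi \<alpha> z
     else if j = 1 then 1 / (z - 1) - 1 / (z + 1) + 2 * of_real \<alpha> * z
     else if j = 2 then - 1 / (z - 1)\<^sup>2 + 1 / (z + 1)\<^sup>2 + 2 * of_real \<alpha>
     else 2 / (z - 1) ^ 3 - 2 / (z + 1) ^ 3)"

lemma psi_d_0: "psi_d \<alpha> 0 z = psi \<alpha> z" by (simp add: psi_d_def)

lemma psi_d_deriv:
  assumes "Im z > 0" "j \<le> 2"
  shows "(psi_d \<alpha> j has_field_derivative psi_d \<alpha> (Suc j) z) (at z within S)"
proof -
  note a = psi_arg[OF assms(1)]
  have nn: "(z - 1) / (z + 1) \<notin> \<real>\<^sub>\<le>\<^sub>0" using a(1) by (auto simp: complex_nonpos_Reals_iff)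
  consider "j = 0" | "j = 1" | "j = 2" using assms(2) by linarith
  then show ?thesis
  proof cases
    case 1
    have "((\<lambda>z. (z - 1) / (z + 1)) has_field_derivative (1 * (z + 1) - (z - 1) * 1) / ((z + 1) * (z + 1))) (at z within S)"
      using a(3) by (auto intro!: derivative_eq_intros)
    then have q: "((\<lambda>z. (z - 1) / (z + 1)) has_field_derivative 2 / (z + 1)\<^sup>2) (at z within S)"
      by (simp add: power2_eq_square)
    have "((\<lambda>z. Ln ((z - 1) / (z + 1)) + of_real \<alpha> * z\<^sup>2) has_field_derivative
        inverse ((z - 1) / (z + 1)) * (2 / (z + 1)\<^sup>2) + of_real \<alpha> * (2 * z)) (at z within S)"
    proof (rule DERIV_add)
      show "((\<lambda>z. Ln ((z - 1) / (z + 1))) has_field_derivative inverse ((z - 1) / (z + 1)) * (2 / (z + 1)\<^sup>2)) (at z within S)"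
        by (rule DERIV_chain2[OF has_field_derivative_Ln[OF nn] q])
      show "((\<lambda>z. of_real \<alpha> * z\<^sup>2) has_field_derivative of_real \<alpha> * (2 * z)) (at z within S)"
        by (auto intro!: derivative_eq_intros)
    qed
    moreover have "inverse ((z - 1) / (z + 1)) * (2 / (z + 1)\<^sup>2) = 1 / (z - 1) - 1 / (z + 1)"
    proof -
      have "inverse ((z - 1) / (z + 1)) * (2 / (z + 1)\<^sup>2) = 2 / ((z - 1) * (z + 1))"
      proof -
        have "inverse (u / v) * (2 / v\<^sup>2) = 2 / (u * v)" if "v \<noteq> 0" for u v :: complex
          using that by (simp add: power2_eq_square field_simps)
        then show ?thesis using a(3) .
      qed
      also have "... = 1 / (z - 1) - 1 / (z + 1)" using a(2,3) by (simp add: diff_frac_eq)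
      finally show ?thesis .
    qed
    ultimately show ?thesis unfolding 1 psi_d_def psi_def by (simp add: mult_ac)
  next
    case 2
    show ?thesis unfolding 2 psi_d_def using a
      by (auto intro!: derivative_eq_intros simp: power2_eq_square)
  next
    case 3
    have d: "((\<lambda>z. 1 / (z - c)\<^sup>2) has_field_derivative - 2 / (z - c) ^ 3) (at z within S)" if "z - c \<noteq> 0" for c
    proof -
      have "((\<lambda>z. 1 / (z - c)\<^sup>2) has_field_derivative (0 * (z - c)\<^sup>2 - 1 * (2 * (z - c))) / ((z - c)\<^sup>2 * (z - c)\<^sup>2)) (at z within S)"
        by (rule DERIV_divide) (use that in \<open>auto intro!: derivative_eq_intros\<close>)
      moreover have gen: "(0 * w\<^sup>2 - 1 * (2 * w)) / (w\<^sup>2 * w\<^sup>2) = - 2 / w ^ 3" if "w \<noteq> 0" for w :: complex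
        using that by (simp add: power2_eq_square power3_eq_cube)
      ultimately show ?thesis unfolding gen[OF that] by (simp only:)
    qed
    have "((\<lambda>z. - (1 / (z - 1)\<^sup>2) + 1 / (z - - 1)\<^sup>2 + 2 * of_real \<alpha>) has_field_derivative
       - (- 2 / (z - 1) ^ 3) + - 2 / (z - - 1) ^ 3 + 0) (at z within S)"
      using a by (intro DERIV_add DERIV_minus DERIV_const d) auto
    then show ?thesis unfolding 3 psi_d_def by simp
  qed
qed

lemma sector_lower:
  assumes "0 < r" "r \<le> Re z" "d * r \<le> Im z" "0 < d"
  shows "d * r * cmod (z + 1) \<le> cmod (z\<^sup>2 - 1)" "d * r\<^sup>2 \<le> cmod (z\<^sup>2 - 1)"
    "cmod z \<le> cmod (z + 1)" "r \<le> cmod (z + 1)"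
proof -
  have e: "cmod (z\<^sup>2 - 1) = cmod (z - 1) * cmod (z + 1)" by (simp only: square_minus_one norm_mult)
  have "d * r \<le> cmod (z - 1)" using abs_Im_le_cmod[of "z - 1"] assms by simp
  then show 1: "d * r * cmod (z + 1) \<le> cmod (z\<^sup>2 - 1)" unfolding e by (intro mult_right_mono) auto
  show 2: "r \<le> cmod (z + 1)" using complex_Re_le_cmod[of "z + 1"] assms by simp
  have "d * r * r \<le> d * r * cmod (z + 1)" using 2 assms by (intro mult_left_mono) auto
  then show "d * r\<^sup>2 \<le> cmod (z\<^sup>2 - 1)" using 1 by (simp add: power2_eq_square mult_ac)
  have "(cmod z)\<^sup>2 \<le> (cmod (z + 1))\<^sup>2" unfolding cmod_power2 using assms by (simp add: expand_powers)
  then show "cmod z \<le> cmod (z + 1)" by (rule power2_le_imp_le) simp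
qed

lemma psi_d3_bound:
  assumes "z\<^sup>2 - 1 \<noteq> 0" "0 < q" "q \<le> cmod (z\<^sup>2 - 1)"
  shows "cmod (psi_d \<alpha> 3 z) \<le> 12 / q\<^sup>2 + 16 / q ^ 3"
proof -
  have nz: "z - 1 \<noteq> 0" "z + 1 \<noteq> 0" using assms(1) unfolding square_minus_one by auto
  have "psi_d \<alpha> 3 z = 2 / (z - 1) ^ 3 - 2 / (z + 1) ^ 3" by (simp add: psi_d_def)
  also have "... = (2 * (z + 1) ^ 3 - 2 * (z - 1) ^ 3) / ((z - 1) * (z + 1)) ^ 3"
    using nz by (simp add: diff_frac_eq power_mult_distrib)
  also have "2 * (z + 1) ^ 3 - 2 * (z - 1) ^ 3 = 12 * (z\<^sup>2 - 1) + 16"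
    by (simp add: expand_powers)
  also have "(z - 1) * (z + 1) = z\<^sup>2 - 1" by (rule square_minus_one[symmetric])
  also have "(12 * (z\<^sup>2 - 1) + 16) / (z\<^sup>2 - 1) ^ 3 = 12 / (z\<^sup>2 - 1)\<^sup>2 + 16 / (z\<^sup>2 - 1) ^ 3"
  proof -
    have "(12 * w + 16) / w ^ 3 = 12 / w\<^sup>2 + 16 / w ^ 3" if "w \<noteq> 0" for w :: complex
      using that by (simp add: add_divide_distrib power2_eq_square power3_eq_cube)
    then show ?thesis using assms(1) .
  qed
  also have "cmod ... \<le> cmod (12 / (z\<^sup>2 - 1)\<^sup>2) + cmod (16 / (z\<^sup>2 - 1) ^ 3)" by (rule norm_triangle_ineq)
  also have "... = 12 / (cmod (z\<^sup>2 - 1))\<^sup>2 + 16 / (cmod (z\<^sup>2 - 1)) ^ 3" by (simp add: norm_divide norm_power)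
  also have "... \<le> 12 / q\<^sup>2 + 16 / q ^ 3"
    using assms by (intro add_mono divide_left_mono power_mono mult_pos_pos) auto
  finally show ?thesis .
qed

lemma norm_exp_diff_le:
  fixes a b :: complex
  assumes "Re a \<le> M" "Re b \<le> M"
  shows "cmod (exp a - exp b) \<le> exp M * cmod (a - b)"
  by (rule field_differentiable_bound[where S = "{z. Re z \<le> M}" and f' = exp])
     (use assms in \<open>auto intro!: derivative_eq_intros convex_halfspace_Re_le\<close>)

context
  fixes \<kappa> \<alpha> r y0 assumes sad: "saddle \<kappa> \<alpha> r y0"
begin

text \<open>Put \<open>w = y\<^sup>2 - y0\<^sup>2\<close>, \<open>A = \<bar>\<zeta> - 1\<bar>\<^sup>2\<close> and \<open>B = \<bar>\<zeta> + 1\<bar>\<^sup>2\<close>, so that \<open>\<alpha> A B = 2 r\<close>. At height \<open>y\<close> these two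
squared distances become \<open>A + w\<close> and \<open>B + w\<close>, and their quotient is
\<open>A / B * (1 + 2 \<alpha> B w / (B + w))\<close>. By \<open>1 + x \<le> exp x\<close> the logarithm of the left side drops by at least
\<open>\<alpha> w\<^sup>2 / (B + w)\<close>, and \<open>w = (y - y0) (y + y0)\<close>. The estimate is stated without logarithms so that it
also holds at height \<open>0\<close>, where the line may pass through the zero \<open>1\<close> of the kernel.\<close>

lemma saddle_decay:
  assumes "0 \<le> y"
  shows "cmod ((1 - Complex r y) / (1 + Complex r y)) * exp (\<alpha> * (y0\<^sup>2 - y\<^sup>2)) \<le>
     cmod ((1 - Complex r y0) / (1 + Complex r y0)) * exp (- (\<kappa>\<^sup>2 / 8) * \<alpha> * (y - y0)\<^sup>2)"
proof -
  note b = saddle_basic[OF sad]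
  define w where "w = y\<^sup>2 - y0\<^sup>2"
  define A where "A = 4 * r\<^sup>2 - 2 * r"
  define B where "B = 4 * r\<^sup>2 + 2 * r"
  define X where "X = cmod ((1 - Complex r y) / (1 + Complex r y))"
  define X0 where "X0 = cmod ((1 - Complex r y0) / (1 + Complex r y0))"
  have e: "(r - 1)\<^sup>2 = r\<^sup>2 - 2 * r + 1" "(r + 1)\<^sup>2 = r\<^sup>2 + 2 * r + 1" "(1 - r)\<^sup>2 = r\<^sup>2 - 2 * r + 1" "(1 + r)\<^sup>2 = r\<^sup>2 + 2 * r + 1"
    by (simp_all add: expand_powers)
  have Aw: "(cmod (1 - Complex r v))\<^sup>2 = A + (v\<^sup>2 - y0\<^sup>2)" "(cmod (1 + Complex r v))\<^sup>2 = B + (v\<^sup>2 - y0\<^sup>2)" for v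
    unfolding cmod_power2 by (simp_all add: A_def B_def b(6) e)
  have Bw: "B + w = (r + 1)\<^sup>2 + y\<^sup>2" using e b(6) by (simp add: B_def w_def)
  have Bw0: "B + w > 0" unfolding Bw using b(3) by (simp add: add_pos_nonneg)
  have "r * 1 < r * (2 * r)" using b by (intro mult_strict_left_mono) auto
  then have "A > 0" by (simp add: A_def power2_eq_square)
  have B0: "B > 0" using b by (simp add: B_def add_pos_pos)
  have AB: "\<alpha> * A * B = 2 * r"
  proof -
    have "A * B = 2 * r * (8 * r ^ 3 - 2 * r)"
      by (simp add: expand_powers A_def B_def)
    then have "\<alpha> * (A * B) = 2 * r * (\<alpha> * (8 * r ^ 3 - 2 * r))" by simp
    then have "\<alpha> * A * B = 2 * r * (\<alpha> * (8 * r ^ 3 - 2 * r))" by (simp only: mult.assoc)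
    then show ?thesis unfolding b(9) by simp
  qed
  define t where "t = \<alpha> * B * w / (B + w)"
  have X2: "X\<^sup>2 = (A + w) / (B + w)" "X0\<^sup>2 = A / B"
    unfolding X_def X0_def norm_divide power_divide Aw w_def by simp_all
  have "A / B * (1 + 2 * t) = A / B + 2 * (\<alpha> * A * B) * w / (B * (B + w))"
  proof -
    have "A / B * (1 + 2 * (\<alpha> * B * w / D)) = A / B + 2 * (\<alpha> * A * B) * w / (B * D)" if "D > 0" for D
      using B0 that by (simp add: field_simps)
    then show ?thesis unfolding t_def using Bw0 .
  qed
  also have "... = (A + w) / (B + w)"
    unfolding AB using B0 Bw0 by (simp add: divide_simps) (simp add: A_def B_def algebra_simps)
  finally have "X\<^sup>2 = X0\<^sup>2 * (1 + 2 * t)" unfolding X2 by simp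
  also have "... \<le> X0\<^sup>2 * exp (2 * t)"
    by (intro mult_left_mono exp_ge_add_one_self) simp
  also have "... = (X0 * exp t)\<^sup>2" by (simp add: power_mult_distrib flip: exp_double)
  finally have XX: "X \<le> X0 * exp t" by (rule power2_le_imp_le) (simp add: X0_def)
  have "t - \<alpha> * w = - \<alpha> * (w\<^sup>2 / (B + w))" using Bw0 by (simp add: t_def divide_simps) (simp add: expand_powers)
  also have "... \<le> - \<alpha> * (\<kappa>\<^sup>2 / 8 * (y - y0)\<^sup>2)"
  proof -
    have "r + 1 > 0" using b by simp
    have r8: "(r + 1)\<^sup>2 \<le> 8 * r\<^sup>2" using \<open>r * 1 < r * (2 * r)\<close> b(7) unfolding e by (simp add: power2_eq_square)
    have k1: "\<kappa>\<^sup>2 \<le> 1" using b by (simp add: power_le_one)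
    have "(\<kappa> * r)\<^sup>2 \<le> y0\<^sup>2" using b by (intro power_mono) auto
    have "\<kappa>\<^sup>2 / 8 * (B + w) \<le> \<kappa>\<^sup>2 / 8 * (8 * r\<^sup>2 + 8 * y\<^sup>2)" unfolding Bw
      by (intro mult_left_mono) (use r8 zero_le_power2[of y] in linarith, simp)
    also have "... = (\<kappa> * r)\<^sup>2 + \<kappa>\<^sup>2 * y\<^sup>2" by (simp add: algebra_simps power_mult_distrib)
    also have "... \<le> y0\<^sup>2 + 1 * y\<^sup>2" using k1 \<open>(\<kappa> * r)\<^sup>2 \<le> y0\<^sup>2\<close> by (intro add_mono mult_right_mono) auto
    also have "... \<le> (y + y0)\<^sup>2" using assms b by (simp add: power2_sum)
    finally have "\<kappa>\<^sup>2 / 8 * (B + w) * (y - y0)\<^sup>2 \<le> (y + y0)\<^sup>2 * (y - y0)\<^sup>2" by (intro mult_right_mono) auto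
    also have "... = w\<^sup>2" by (simp add: w_def power_mult_distrib[symmetric] power2_eq_square algebra_simps)
    finally have "\<kappa>\<^sup>2 / 8 * (y - y0)\<^sup>2 \<le> w\<^sup>2 / (B + w)" using Bw0 by (simp add: pos_le_divide_eq mult_ac)
    then have "\<alpha> * (\<kappa>\<^sup>2 / 8 * (y - y0)\<^sup>2) \<le> \<alpha> * (w\<^sup>2 / (B + w))" using b(8) by (intro mult_left_mono) auto
    then show ?thesis by (simp only: mult_minus_left neg_le_iff_le)
  qed
  finally have tw: "t - \<alpha> * w \<le> - (\<kappa>\<^sup>2 / 8) * \<alpha> * (y - y0)\<^sup>2" by (simp add: mult_ac)
  have "X * exp (- \<alpha> * w) \<le> X0 * exp t * exp (- \<alpha> * w)" using XX by (intro mult_right_mono) auto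
  also have "... = X0 * exp (t - \<alpha> * w)" by (simp add: exp_diff exp_minus divide_inverse)
  also have "... \<le> X0 * exp (- (\<kappa>\<^sup>2 / 8) * \<alpha> * (y - y0)\<^sup>2)" using tw by (intro mult_left_mono) (auto simp: X0_def)
  finally have "X * exp (- \<alpha> * w) \<le> X0 * exp (- (\<kappa>\<^sup>2 / 8) * \<alpha> * (y - y0)\<^sup>2)" .
  moreover have "- \<alpha> * w = \<alpha> * (y0\<^sup>2 - y\<^sup>2)" by (simp add: w_def algebra_simps)
  ultimately show ?thesis unfolding X_def X0_def by simp
qed

lemma psi_decay:
  assumes "0 < y"
  shows "Re (psi \<alpha> (Complex r y)) - Re (psi \<alpha> (Complex r y0)) \<le> - (\<kappa>\<^sup>2 / 8) * \<alpha> * (y - y0)\<^sup>2"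
proof -
  note b = saddle_basic[OF sad]
  have m: "exp (Re (psi \<alpha> (Complex r v))) = cmod ((1 - Complex r v) / (1 + Complex r v)) * exp (\<alpha> * (y0\<^sup>2 - v\<^sup>2)) * exp (\<alpha> * (r\<^sup>2 - y0\<^sup>2))"
    if "v > 0" for v
  proof -
    have "exp (Re (psi \<alpha> (Complex r v))) = cmod (exp (psi \<alpha> (Complex r v)))" by simp
    also have "... = cmod ((Complex r v - 1) / (Complex r v + 1)) * exp (\<alpha> * (r\<^sup>2 - v\<^sup>2))"
    proof -
      have "Re (of_real \<alpha> * (Complex r v)\<^sup>2) = \<alpha> * (r\<^sup>2 - v\<^sup>2)" by (simp add: Re_power2)
      moreover have "Im (Complex r v) > 0" using that by simp
      ultimately show ?thesis by (simp only: exp_psi norm_mult norm_exp_eq_Re)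
    qed
    also have "exp (\<alpha> * (r\<^sup>2 - v\<^sup>2)) = exp (\<alpha> * (y0\<^sup>2 - v\<^sup>2)) * exp (\<alpha> * (r\<^sup>2 - y0\<^sup>2))"
      unfolding exp_add[symmetric] by (simp add: algebra_simps)
    also have "cmod ((Complex r v - 1) / (Complex r v + 1)) = cmod ((1 - Complex r v) / (1 + Complex r v))"
      by (simp add: norm_divide norm_minus_commute add.commute)
    finally show ?thesis by simp
  qed
  have "exp (Re (psi \<alpha> (Complex r y))) \<le> cmod ((1 - Complex r y0) / (1 + Complex r y0)) *
        exp (- (\<kappa>\<^sup>2 / 8) * \<alpha> * (y - y0)\<^sup>2) * exp (\<alpha> * (r\<^sup>2 - y0\<^sup>2))"
    unfolding m[OF assms] using saddle_decay[of y] assms by (intro mult_right_mono) auto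
  also have "... = exp (Re (psi \<alpha> (Complex r y0))) * exp (- (\<kappa>\<^sup>2 / 8) * \<alpha> * (y - y0)\<^sup>2)"
    unfolding m[OF b(5)] by simp
  also have "... = exp (Re (psi \<alpha> (Complex r y0)) + - (\<kappa>\<^sup>2 / 8) * \<alpha> * (y - y0)\<^sup>2)"
    by (rule exp_add[symmetric])
  finally show ?thesis by simp
qed

text \<open>The cubic equation says \<open>1 / (\<zeta>\<^sup>2 - 1) = - \<alpha> \<zeta>\<close>, which turns both derivatives into polynomials in \<open>\<zeta>\<close>.\<close>

lemma psi_d_saddle:
  "psi_d \<alpha> 1 (Complex r y0) = 0"
  "psi_d \<alpha> 2 (Complex r y0) = 2 * of_real \<alpha> * (radicand \<alpha> (Complex r y0))"
proof -
  note b = saddle_basic[OF sad] and e = saddle_eqn[OF sad]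
  define z where "z = Complex r y0"
  define a where "a = (of_real \<alpha> :: complex)"
  have nz: "z - 1 \<noteq> 0" "z + 1 \<noteq> 0" "z\<^sup>2 - 1 \<noteq> 0" using psi_arg[of z] b by (auto simp: z_def)
  have az: "a * z * (z\<^sup>2 - 1) = - 1"
  proof -
    have "a * z * (z\<^sup>2 - 1) = a * (z ^ 3 - z)" by (simp add: expand_powers)
    moreover have "a * (z ^ 3 - z) = - 1"
      using e(1) unfolding z_def[symmetric] a_def[symmetric] by (simp only: eq_neg_iff_add_eq_0)
    ultimately show ?thesis by (simp only:)
  qed
  have inv: "1 / (z\<^sup>2 - 1) = - a * z" using az nz by (simp add: divide_eq_eq)
  have "1 / (z - 1) - 1 / (z + 1) = 2 * (1 / (z\<^sup>2 - 1))"
    using nz(1,2) unfolding square_minus_one by (simp add: diff_frac_eq)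
  also have "... = - 2 * a * z" unfolding inv by simp
  finally have "1 / (z - 1) - 1 / (z + 1) + 2 * a * z = 0" by simp
  then show "psi_d \<alpha> 1 (Complex r y0) = 0" by (simp add: psi_d_def z_def a_def)
  have "- 1 / (z - 1)\<^sup>2 + 1 / (z + 1)\<^sup>2 = - 4 * z * (1 / (z\<^sup>2 - 1))\<^sup>2"
    using inverse_square_difference[OF nz(1,2)] by (simp add: power_divide)
  also have "... = - 4 * a * (a * z ^ 3)" unfolding inv by (simp add: power2_eq_square power3_eq_cube)
  also have "a * z ^ 3 = a * z - 1" using az by (simp add: expand_powers)
  finally have "- 1 / (z - 1)\<^sup>2 + 1 / (z + 1)\<^sup>2 + 2 * a = 2 * a * (3 - 2 * a * z)" by (simp add: algebra_simps)
  then show "psi_d \<alpha> 2 (Complex r y0) = 2 * of_real \<alpha> * (radicand \<alpha> (Complex r y0))"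
    by (simp add: psi_d_def z_def a_def)
qed

text \<open>At the saddle \<open>\<psi>'' = 2 \<alpha> (3 - 2 \<alpha> \<zeta>)\<close>, and \<open>(z - \<zeta>)\<^sup>2 = - (y - y0)\<^sup>2\<close> on the line. The condition on
\<open>y\<close> keeps \<open>z\<close> away from \<open>1\<close>, so the third derivative is of order \<open>r\<^sup>-\<^sup>4\<close>, hence of order \<open>\<alpha> / r\<close>.\<close>

lemma psi_taylor:
  assumes "\<kappa> / 2 * r \<le> y"
  shows "cmod (psi \<alpha> (Complex r y) - psi \<alpha> (Complex r y0) + of_real \<alpha> * (radicand \<alpha> (Complex r y0)) * of_real ((y - y0)\<^sup>2))
     \<le> 1728 / \<kappa> ^ 3 * \<alpha> / r * \<bar>y - y0\<bar> ^ 3"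
proof -
  note b = saddle_basic[OF sad]
  define \<sigma> where "\<sigma> = radicand \<alpha> (Complex r y0)"
  let ?S = "{z. Re z = r \<and> \<kappa> / 2 * r \<le> Im z}"
  let ?B = "3456 / \<kappa> ^ 3 * \<alpha> / r"
  have pos: "Im z > 0" if "z \<in> ?S" for z using that b by (smt (verit) mem_Collect_eq mult_pos_pos half_gt_zero)
  have "?S = ({z. Re z \<le> r} \<inter> {z. Re z \<ge> r}) \<inter> {z. Im z \<ge> \<kappa> / 2 * r}" by auto
  moreover have "convex (({z. Re z \<le> r} \<inter> {z. Re z \<ge> r}) \<inter> {z. Im z \<ge> \<kappa> / 2 * r})"
    by (intro convex_Int convex_halfspace_Im_ge convex_halfspace_Re_le convex_halfspace_Re_ge)
  ultimately have cv: "convex ?S" by (simp only:)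
  have bd: "cmod (psi_d \<alpha> (Suc 2) z) \<le> ?B" if z: "z \<in> ?S" for z
  proof -
    have q: "\<kappa> / 2 * r\<^sup>2 \<le> cmod (z\<^sup>2 - 1)" using sector_lower(2)[of r z "\<kappa> / 2"] z b by auto
    have "cmod (psi_d \<alpha> 3 z) \<le> 12 / (\<kappa> / 2 * r\<^sup>2)\<^sup>2 + 16 / (\<kappa> / 2 * r\<^sup>2) ^ 3"
      using b psi_arg(4)[OF pos[OF z]] q by (intro psi_d3_bound) auto
    also have "12 / (\<kappa> / 2 * r\<^sup>2)\<^sup>2 \<le> 48 / \<kappa> ^ 3 * (1 / r ^ 4)"
    proof -
      have "\<kappa> ^ 3 \<le> \<kappa> ^ 2" using b by (intro power_decreasing) auto
      then have "1 / \<kappa> ^ 2 \<le> 1 / \<kappa> ^ 3" using b by (intro divide_left_mono) auto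
      then have "48 * (1 / \<kappa> ^ 2) * (1 / r ^ 4) \<le> 48 * (1 / \<kappa> ^ 3) * (1 / r ^ 4)"
        using b by (intro mult_right_mono mult_left_mono) auto
      then show ?thesis by (simp add: power_mult_distrib power_divide flip: power_mult)
    qed
    also have "16 / (\<kappa> / 2 * r\<^sup>2) ^ 3 \<le> 384 / \<kappa> ^ 3 * (1 / r ^ 4)"
    proof -
      have "1 / r\<^sup>2 \<le> 3" using b by (simp add: divide_le_eq)
      then have "128 / \<kappa> ^ 3 * (1 / r ^ 4) * (1 / r\<^sup>2) \<le> 128 / \<kappa> ^ 3 * (1 / r ^ 4) * 3"
        using b by (intro mult_left_mono) auto
      moreover have "16 / (\<kappa> / 2 * r\<^sup>2) ^ 3 = 128 / \<kappa> ^ 3 * (1 / r ^ 4) * (1 / r\<^sup>2)"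
        by (simp add: power_mult_distrib power_divide eval_nat_numeral)
      ultimately show ?thesis by simp
    qed
    also have "48 / \<kappa> ^ 3 * (1 / r ^ 4) + 384 / \<kappa> ^ 3 * (1 / r ^ 4) = 432 / \<kappa> ^ 3 * (1 / r ^ 4)"
      by (simp add: field_simps)
    also have "... \<le> 432 / \<kappa> ^ 3 * (8 * \<alpha> / r)"
    proof (intro mult_left_mono)
      show "1 / r ^ 4 \<le> 8 * \<alpha> / r" using saddle_alpha(1)[OF sad] b by (simp add: field_simps eval_nat_numeral)
    qed (use b in auto)
    finally show ?thesis by simp
  qed
  have z0: "Complex r y0 \<in> ?S" "Complex r y \<in> ?S" using b assms by (auto simp: field_simps)
  have "cmod (psi_d \<alpha> 0 (Complex r y) - (\<Sum>i\<le>2. psi_d \<alpha> i (Complex r y0) * (Complex r y - Complex r y0) ^ i / fact i))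
     \<le> ?B * cmod (Complex r y - Complex r y0) ^ Suc 2 / fact 2"
    by (rule complex_Taylor[OF cv psi_d_deriv bd z0]) (use pos in auto)
  also have "cmod (Complex r y - Complex r y0) = \<bar>y - y0\<bar>" by (simp add: cmod_def)
  also have "(\<Sum>i\<le>2. psi_d \<alpha> i (Complex r y0) * (Complex r y - Complex r y0) ^ i / fact i) =
     psi \<alpha> (Complex r y0) - of_real \<alpha> * \<sigma> * of_real ((y - y0)\<^sup>2)"
  proof -
    have "(Complex r y - Complex r y0)\<^sup>2 = - of_real ((y - y0)\<^sup>2)"
      by (simp add: complex_eq_iff power2_eq_square)
    then show ?thesis using psi_d_saddle unfolding \<sigma>_def[symmetric]
      by (simp add: eval_nat_numeral psi_d_def[of _ 0])
  qed
  finally have "cmod (psi \<alpha> (Complex r y) - (psi \<alpha> (Complex r y0) - of_real \<alpha> * \<sigma> * of_real ((y - y0)\<^sup>2)))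
     \<le> ?B * \<bar>y - y0\<bar> ^ Suc 2 / fact 2" by (simp only: psi_d_0)
  moreover have "?B * \<bar>y - y0\<bar> ^ Suc 2 / fact 2 = 1728 / \<kappa> ^ 3 * \<alpha> / r * \<bar>y - y0\<bar> ^ 3"
    by (simp add: numeral_3_eq_3 numeral_2_eq_2)
  ultimately show ?thesis unfolding \<sigma>_def by (simp only: diff_diff_eq2 diff_add_eq)
qed

end

section \<open>Laplace's method on the line\<close>

lemma Re_neg_scaled: "Re (- (of_real a * s) * of_real x) = - (Re s * (a * x))"
  by simp

lemma kern_psi:
  assumes "Im z > 0"
  shows "kern k (real (Suc k) * \<alpha>) z = (- 1) ^ Suc k * exp (of_nat (Suc k) * psi \<alpha> z) / (1 - z\<^sup>2)"
proof -
  note a = psi_arg[OF assms]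
  have "exp (of_nat (Suc k) * psi \<alpha> z) = (exp (psi \<alpha> z)) ^ Suc k"
    by (rule exp_of_nat_mult)
  also have "... = ((z - 1) / (z + 1)) ^ Suc k * exp (of_nat (Suc k) * (of_real \<alpha> * z\<^sup>2))"
    by (simp only: exp_psi[OF assms] power_mult_distrib exp_of_nat_mult)
  also have "of_nat (Suc k) * (of_real \<alpha> * z\<^sup>2) = of_real (real (Suc k) * \<alpha>) * z\<^sup>2"
    by simp
  finally have e: "exp (of_nat (Suc k) * psi \<alpha> z) = ((z - 1) / (z + 1)) ^ Suc k * exp (of_real (real (Suc k) * \<alpha>) * z\<^sup>2)" .
  have "(1 - z) ^ k / (1 + z) ^ (k + 2) = (- 1) ^ Suc k * ((z - 1) / (z + 1)) ^ Suc k / (1 - z\<^sup>2)"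
  proof -
    have "(1 - z) * (1 + z) = 1 - z\<^sup>2" by (simp add: expand_powers)
    moreover have "1 - z \<noteq> 0" "1 + z \<noteq> 0" using a(2,3) by (auto simp: add.commute)
    ultimately have "(1 - z) ^ k / (1 + z) ^ (k + 2) = ((1 - z) / (1 + z)) ^ Suc k / (1 - z\<^sup>2)"
      using power_quotient_split by metis
    also have "(1 - z) / (1 + z) = (- 1) * ((z - 1) / (z + 1))" by (simp add: add.commute minus_divide_left)
    finally show ?thesis by (simp only: power_mult_distrib)
  qed
  then show ?thesis unfolding kern_def e by (simp only: times_divide_eq_left times_divide_eq_right mult.assoc)
qed

text \<open>The kernel on the line, normalised at the saddle and extended by \<open>0\<close> so that it can be compared
with a Gaussian on the whole real line.\<close>

definition kern_ratio :: "real \<Rightarrow> real \<Rightarrow> real \<Rightarrow> nat \<Rightarrow> real \<Rightarrow> complex" where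
  "kern_ratio \<alpha> r y0 k y =
    (if 0 \<le> y then kern k (real (Suc k) * \<alpha>) (Complex r y) / kern k (real (Suc k) * \<alpha>) (Complex r y0) else 0)"

context
  fixes \<kappa> \<alpha> r y0 assumes sad: "saddle \<kappa> \<alpha> r y0"
begin

text \<open>The decay estimate concerns the \<open>n\<close>-th power, while the remaining factor \<open>1 / (1 - z\<^sup>2)\<close> of the kernel
may blow up at height \<open>0\<close>. The remedy is to use the decay of \<open>k = n - 1\<close> of the \<open>n\<close> factors only and
to let the last one cancel the pole; since \<open>2 k \<ge> n\<close>, this at most halves the exponent.\<close>

lemma kern_ratio_far:
  assumes "1 \<le> k"
  shows "cmod (kern_ratio \<alpha> r y0 k y) \<le> 108 * exp (- (\<kappa>\<^sup>2 / 16) * (real (Suc k) * \<alpha>) * (y - y0)\<^sup>2)"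
proof (cases "0 \<le> y")
  case True
  note b = saddle_basic[OF sad]
  define n where "n = real (Suc k)"
  define X where "X = (\<lambda>y. cmod ((1 - Complex r y) / (1 + Complex r y)))"
  define h where "h = exp (\<alpha> * (y0\<^sup>2 - y\<^sup>2))"
  define E where "E = exp (- (\<kappa>\<^sup>2 / 8) * \<alpha> * (y - y0)\<^sup>2)"
  have nz: "1 + Complex r y \<noteq> 0" for y using b by (simp add: complex_eq_iff)
  have nm: "cmod (kern k (n * \<alpha>) (Complex r y)) = X y ^ k / (cmod (1 + Complex r y))\<^sup>2 * exp (n * \<alpha> * (r\<^sup>2 - y\<^sup>2))" for y
  proof -
    have "Re (of_real (n * \<alpha>) * (Complex r y)\<^sup>2) = n * \<alpha> * (r\<^sup>2 - y\<^sup>2)" by (simp add: Re_power2)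
    then show ?thesis unfolding kern_def X_def norm_mult norm_exp_eq_Re norm_divide norm_power power_divide power_add
      by (simp only: divide_divide_eq_left)
  qed
  have X0: "X y0 > 0" using psi_arg[of "Complex r y0"] b nz by (auto simp: X_def)
  have Xpos: "X y \<ge> 0" by (simp add: X_def)
  have dec: "X y * h \<le> X y0 * E" using saddle_decay[OF sad True] by (simp add: X_def h_def E_def)
  have "cmod (kern_ratio \<alpha> r y0 k y) = (X y * h / X y0) ^ k * h * ((cmod (1 + Complex r y0))\<^sup>2 / (cmod (1 + Complex r y))\<^sup>2)"
  proof -
    have "exp (n * \<alpha> * (r\<^sup>2 - y\<^sup>2)) = h ^ Suc k * exp (n * \<alpha> * (r\<^sup>2 - y0\<^sup>2))"
      unfolding h_def exp_of_nat_mult[symmetric] exp_add[symmetric] n_def by (simp add: algebra_simps)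
    then have "cmod (kern_ratio \<alpha> r y0 k y) = (X y ^ k / (cmod (1 + Complex r y))\<^sup>2 * (h ^ Suc k * exp (n * \<alpha> * (r\<^sup>2 - y0\<^sup>2))))
       / (X y0 ^ k / (cmod (1 + Complex r y0))\<^sup>2 * exp (n * \<alpha> * (r\<^sup>2 - y0\<^sup>2)))"
      using True unfolding kern_ratio_def n_def[symmetric] by (simp add: norm_divide nm)
    also have "... = (X y * h / X y0) ^ k * h * ((cmod (1 + Complex r y0))\<^sup>2 / (cmod (1 + Complex r y))\<^sup>2)"
      using nz[of y0] nz[of y] X0 by (simp add: field_simps power_mult_distrib)
    finally show ?thesis .
  qed
  also have "... \<le> E ^ k * 27 * 4"
  proof (intro mult_mono power_mono)
    show "X y * h / X y0 \<le> E" using dec X0 by (simp add: divide_le_eq mult.commute)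
    \<comment> \<open>\<open>\<alpha> y0\<^sup>2 \<le> 3 \<alpha> r\<^sup>2 \<le> 3\<close> and \<open>exp 1 \<le> 3\<close>\<close>
    show "h \<le> 27"
    proof -
      have "\<alpha> * (y0\<^sup>2 - y\<^sup>2) \<le> \<alpha> * (3 * r\<^sup>2)" using b(8,11) zero_le_power2[of y] by (intro mult_left_mono) linarith+
      also have "... \<le> 3" using saddle_alpha(5)[OF sad] by simp
      finally have "h \<le> exp 3" by (simp add: h_def)
      also have "exp (3::real) = exp 1 ^ 3" by (simp flip: exp_of_nat_mult)
      also have "... \<le> 3 ^ 3" by (intro power_mono exp_le) auto
      finally show ?thesis by simp
    qed
    have "(cmod (1 + Complex r y0))\<^sup>2 \<le> 4 * (cmod (1 + Complex r y))\<^sup>2"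
    proof -
      have "(cmod (1 + Complex r y0))\<^sup>2 = 4 * r\<^sup>2 + 2 * r" using saddle_norms(3)[OF sad] by (simp add: add.commute)
      also have "... \<le> 4 * ((1 + r)\<^sup>2 + y\<^sup>2)" using b by (simp add: expand_powers)
      finally show ?thesis by (simp add: cmod_power2)
    qed
    then show "(cmod (1 + Complex r y0))\<^sup>2 / (cmod (1 + Complex r y))\<^sup>2 \<le> 4"
      using nz[of y] by (simp add: divide_le_eq)
  qed (use Xpos X0 in \<open>auto simp: h_def E_def\<close>)
  also have "E ^ k \<le> exp (- (\<kappa>\<^sup>2 / 16) * (n * \<alpha>) * (y - y0)\<^sup>2)"
  proof -
    have "n \<le> 2 * real k" using assms by (simp add: n_def)
    then have "n * (\<kappa>\<^sup>2 / 16 * \<alpha> * (y - y0)\<^sup>2) \<le> 2 * real k * (\<kappa>\<^sup>2 / 16 * \<alpha> * (y - y0)\<^sup>2)"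
      using b by (intro mult_right_mono) auto
    then show ?thesis unfolding E_def exp_of_nat_mult[symmetric] by (simp add: mult_ac)
  qed
  finally show ?thesis by (simp add: n_def mult.commute)
qed (simp add: kern_ratio_def)

text \<open>The deviation from the Gaussian has two sources, the cubic Taylor remainder in the exponent and the
variation of \<open>1 / (1 - z\<^sup>2)\<close>. The factor \<open>n \<alpha> (y - y0)\<^sup>2\<close> in the first is absorbed by half of the
exponential decay.\<close>

lemma kern_ratio_near:
  assumes "\<bar>y - y0\<bar> \<le> \<kappa> / 2 * r"
  shows "cmod (kern_ratio \<alpha> r y0 k y - exp (- (of_real (real (Suc k) * \<alpha>) * (radicand \<alpha> (Complex r y0))) * of_real ((y - y0)\<^sup>2))) \<le>
     27654 / \<kappa> ^ 5 * (\<bar>y - y0\<bar> / r) * exp (- (\<kappa>\<^sup>2 / 16) * (real (Suc k) * \<alpha>) * (y - y0)\<^sup>2)"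
proof -
  note b = saddle_basic[OF sad]
  define n where "n = real (Suc k)"
  define N where "N = n * \<alpha>"
  define v where "v = y - y0"
  define z where "z = Complex r y"
  define z0 where "z0 = Complex r y0"
  define D where "D = of_real n * (psi \<alpha> z - psi \<alpha> z0)"
  define g where "g = - (of_real N * (radicand \<alpha> (Complex r y0))) * of_real (v\<^sup>2)"
  define E where "E = exp (- (\<kappa>\<^sup>2 / 16) * N * v\<^sup>2)"
  have n0: "n > 0" by (simp add: n_def)
  then have N0: "N > 0" using b by (simp add: N_def)
  have yk: "\<kappa> / 2 * r \<le> y" using assms b(4) unfolding abs_le_iff by linarith
  then have y: "y > 0" using b by (smt (verit) mult_pos_pos half_gt_zero)
  have nz: "1 - z\<^sup>2 \<noteq> 0" "1 - z0\<^sup>2 \<noteq> 0" using psi_arg(4)[of z] psi_arg(4)[of z0] b y by (auto simp: z_def z0_def)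
  have rat: "kern_ratio \<alpha> r y0 k y = exp D * ((1 - z0\<^sup>2) / (1 - z\<^sup>2))"
  proof -
    have "kern_ratio \<alpha> r y0 k y = exp (of_nat (Suc k) * psi \<alpha> z) / (1 - z\<^sup>2) / (exp (of_nat (Suc k) * psi \<alpha> z0) / (1 - z0\<^sup>2))"
    proof -
      have Im: "Im z > 0" "Im z0 > 0" using y b by (simp_all add: z_def z0_def)
      have gen: "a * u / v / (a * u' / v') = u / v / (u' / v')" if "a \<noteq> 0" for a u v u' v' :: complex
        using that by simp
      have "(- 1 :: complex) ^ Suc k \<noteq> 0" by simp
      note gen = gen[OF this]
      moreover have "kern_ratio \<alpha> r y0 k y = kern k (real (Suc k) * \<alpha>) z / kern k (real (Suc k) * \<alpha>) z0"
        unfolding kern_ratio_def z_def z0_def using y by simp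
      ultimately show ?thesis unfolding kern_psi[OF Im(1)] kern_psi[OF Im(2)] by (simp only: gen)
    qed
    also have "... = exp D * ((1 - z0\<^sup>2) / (1 - z\<^sup>2))"
    proof -
      have gen: "a / v / (b / w) = a / b * (w / v)" for a b v w :: complex by simp
      have "exp D = exp (of_nat (Suc k) * psi \<alpha> z) / exp (of_nat (Suc k) * psi \<alpha> z0)"
        by (simp only: D_def n_def of_real_of_nat_eq right_diff_distrib exp_diff)
      then show ?thesis by (simp only: gen)
    qed
    finally show ?thesis .
  qed
  have ReD: "Re D \<le> - (\<kappa>\<^sup>2 / 8) * N * v\<^sup>2"
  proof -
    have "Re D = n * (Re (psi \<alpha> z) - Re (psi \<alpha> z0))" by (simp add: D_def)
    also have "... \<le> n * (- (\<kappa>\<^sup>2 / 8) * \<alpha> * (y - y0)\<^sup>2)"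
      using psi_decay[OF sad y] n0 unfolding z_def z0_def by (intro mult_left_mono) auto
    finally show ?thesis by (simp add: N_def v_def mult_ac)
  qed
  have Reg: "Re g \<le> - (\<kappa>\<^sup>2 / 8) * N * v\<^sup>2"
  proof -
    have "\<kappa>\<^sup>2 / 8 \<le> Re (radicand \<alpha> (Complex r y0))" using saddle_radicand(1)[OF sad] zero_le_power2[of \<kappa>] by linarith
    then have "\<kappa>\<^sup>2 / 8 * (N * v\<^sup>2) \<le> Re (radicand \<alpha> (Complex r y0)) * (N * v\<^sup>2)" using N0 by (intro mult_right_mono) auto
    moreover have "Re g = - (Re (radicand \<alpha> (Complex r y0)) * (N * v\<^sup>2))"
      unfolding g_def by (rule Re_neg_scaled)
    ultimately show ?thesis by (simp add: mult_ac)
  qed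
  have E8: "exp (- (\<kappa>\<^sup>2 / 8) * N * v\<^sup>2) \<le> E" unfolding E_def using N0 by (simp add: mult_right_mono)
  have diff: "cmod (exp D - exp g) \<le> 27648 / \<kappa> ^ 5 * (\<bar>v\<bar> / r) * E"
  proof -
    have "cmod (D - g) = n * cmod (psi \<alpha> z - psi \<alpha> z0 + of_real \<alpha> * (radicand \<alpha> (Complex r y0)) * of_real (v\<^sup>2))"
    proof -
      have "D - g = of_real n * (psi \<alpha> z - psi \<alpha> z0 + of_real \<alpha> * (radicand \<alpha> (Complex r y0)) * of_real (v\<^sup>2))"
        unfolding D_def g_def N_def by (simp only: of_real_mult distrib_left minus_mult_left[symmetric] diff_minus_eq_add mult.assoc)
      then show ?thesis using n0 by (simp add: norm_mult)
    qed
    also have "... \<le> n * (1728 / \<kappa> ^ 3 * \<alpha> / r * \<bar>v\<bar> ^ 3)"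
      using psi_taylor[OF sad yk] n0 unfolding z_def z0_def v_def by (intro mult_left_mono) auto
    also have "... = 1728 / \<kappa> ^ 3 * (\<bar>v\<bar> / r) * (N * v\<^sup>2)"
    proof -
      have "\<bar>v\<bar> ^ 3 = \<bar>v\<bar> * v\<^sup>2" by (simp add: power3_eq_cube power2_eq_square)
      then show ?thesis by (simp add: N_def)
    qed
    finally have Dg: "cmod (D - g) \<le> 1728 / \<kappa> ^ 3 * (\<bar>v\<bar> / r) * (N * v\<^sup>2)" .
    \<comment> \<open>half of the exponential decay pays for the factor \<open>N v\<^sup>2\<close>, by \<open>x \<le> exp x\<close>\<close>
    have xe: "N * v\<^sup>2 * exp (- (\<kappa>\<^sup>2 / 8) * N * v\<^sup>2) \<le> 16 / \<kappa>\<^sup>2 * E"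
    proof -
      define x where "x = \<kappa>\<^sup>2 / 16 * N * v\<^sup>2"
      have "x \<le> exp x" using exp_ge_add_one_self[of x] by linarith
      then have "x * exp (- 2 * x) \<le> exp x * exp (- 2 * x)" by (intro mult_right_mono) auto
      also have "... = exp (- x)" by (simp flip: exp_add)
      finally have "16 / \<kappa>\<^sup>2 * (x * exp (- 2 * x)) \<le> 16 / \<kappa>\<^sup>2 * exp (- x)" by (intro mult_left_mono) auto
      then show ?thesis using b(1) by (simp add: x_def E_def mult_ac)
    qed
    have "cmod (exp D - exp g) \<le> exp (- (\<kappa>\<^sup>2 / 8) * N * v\<^sup>2) * cmod (D - g)"
      by (rule norm_exp_diff_le[OF ReD Reg])
    also have "... \<le> exp (- (\<kappa>\<^sup>2 / 8) * N * v\<^sup>2) * (1728 / \<kappa> ^ 3 * (\<bar>v\<bar> / r) * (N * v\<^sup>2))"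
      using Dg by (intro mult_left_mono) auto
    also have "... = 1728 / \<kappa> ^ 3 * (\<bar>v\<bar> / r) * (N * v\<^sup>2 * exp (- (\<kappa>\<^sup>2 / 8) * N * v\<^sup>2))" by (simp only: mult_ac)
    also have "... \<le> 1728 / \<kappa> ^ 3 * (\<bar>v\<bar> / r) * (16 / \<kappa>\<^sup>2 * E)" using xe b by (intro mult_left_mono) auto
    also have "... = 27648 / \<kappa> ^ 5 * (\<bar>v\<bar> / r) * E"
    proof -
      have k5: "\<kappa> ^ 5 = \<kappa> ^ 3 * \<kappa>\<^sup>2" by (simp flip: power_add)
      have "1728 / a * V * (16 / b * E) = 27648 / (a * b) * V * E" for a b V :: real by simp
      then show ?thesis unfolding k5 .
    qed
    finally show ?thesis .
  qed
  have amp: "cmod ((1 - z0\<^sup>2) / (1 - z\<^sup>2) - 1) \<le> 6 / \<kappa> * (\<bar>v\<bar> / r)"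
  proof -
    have s: "\<kappa> / 2 * r * cmod (z + 1) \<le> cmod (z\<^sup>2 - 1)" "cmod z \<le> cmod (z + 1)" "r \<le> cmod (z + 1)"
      using sector_lower[of r z "\<kappa> / 2"] b yk by (auto simp: z_def)
    have "(1 - z0\<^sup>2) / (1 - z\<^sup>2) - 1 = (z - z0) * (z + z0) / (1 - z\<^sup>2)"
      using nz by (simp add: divide_simps) (simp add: expand_powers)
    then have "cmod ((1 - z0\<^sup>2) / (1 - z\<^sup>2) - 1) = cmod (z - z0) * cmod (z + z0) / cmod (z\<^sup>2 - 1)"
      by (simp add: norm_mult norm_divide norm_minus_commute)
    also have "cmod (z - z0) = \<bar>v\<bar>" by (simp add: z_def z0_def v_def cmod_def)
    also have "\<bar>v\<bar> * cmod (z + z0) / cmod (z\<^sup>2 - 1) \<le> \<bar>v\<bar> * (3 * cmod (z + 1)) / (\<kappa> / 2 * r * cmod (z + 1))"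
    proof (intro frac_le mult_left_mono s mult_pos_pos)
      have "cmod (z + z0) \<le> cmod z + cmod z0" by (rule norm_triangle_ineq)
      also have "cmod z0 \<le> 2 * cmod (z + 1)" using saddle_norms(5)[OF sad] s(3) by (simp add: z0_def)
      finally show "cmod (z + z0) \<le> 3 * cmod (z + 1)" using s(2) by simp
    qed (use b s(3) in auto)
    also have "... = 6 / \<kappa> * (\<bar>v\<bar> / r)"
    proof -
      have "V * (3 * c) / (\<kappa> / 2 * r * c) = 6 / \<kappa> * (V / r)" if "c > 0" for V c :: real
        using that by simp
      moreover have "cmod (z + 1) > 0" using b(3) s(3) by linarith
      ultimately show ?thesis .
    qed
    finally show ?thesis .
  qed
  have eD: "cmod (exp D) \<le> E"
  proof -
    have "cmod (exp D) = exp (Re D)" by simp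
    also have "... \<le> exp (- (\<kappa>\<^sup>2 / 8) * N * v\<^sup>2)" using ReD by simp
    finally show ?thesis using E8 by linarith
  qed
  have "kern_ratio \<alpha> r y0 k y - exp g = exp D * ((1 - z0\<^sup>2) / (1 - z\<^sup>2) - 1) + (exp D - exp g)"
    unfolding rat by (simp add: algebra_simps)
  then have "cmod (kern_ratio \<alpha> r y0 k y - exp g) \<le> cmod (exp D) * cmod ((1 - z0\<^sup>2) / (1 - z\<^sup>2) - 1) + cmod (exp D - exp g)"
    by (metis norm_mult norm_triangle_ineq)
  also have "... \<le> E * (6 / \<kappa> * (\<bar>v\<bar> / r)) + 27648 / \<kappa> ^ 5 * (\<bar>v\<bar> / r) * E"
    using eD amp diff b by (intro add_mono mult_mono) (auto simp: E_def)
  also have "... \<le> E * (6 / \<kappa> ^ 5 * (\<bar>v\<bar> / r)) + 27648 / \<kappa> ^ 5 * (\<bar>v\<bar> / r) * E"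
  proof -
    have "\<kappa> ^ 5 \<le> \<kappa> ^ 1" using b by (intro power_decreasing) auto
    then have "6 / \<kappa> \<le> 6 / \<kappa> ^ 5" using b by (intro divide_left_mono) auto
    then show ?thesis using b by (intro add_mono mult_left_mono mult_right_mono) (auto simp: E_def)
  qed
  also have "... = 27654 / \<kappa> ^ 5 * (\<bar>v\<bar> / r) * E"
  proof -
    have "E * (6 / K * X) + 27648 / K * X * E = 27654 / K * X * E" for K X :: real
      by (cases "K = 0") (auto simp: field_simps)
    then show ?thesis .
  qed
  finally show ?thesis unfolding g_def E_def N_def n_def v_def .
qed

text \<open>Away from the saddle both terms are small and \<open>\<bar>y - y0\<bar> / r\<close> is bounded below, so the estimate near
the saddle extends to all heights, including the negative ones where the ratio is \<open>0\<close>.\<close>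

lemma kern_ratio_gauss:
  assumes "1 \<le> k"
  shows "cmod (kern_ratio \<alpha> r y0 k y - exp (- (of_real (real (Suc k) * \<alpha>) * (radicand \<alpha> (Complex r y0))) * of_real ((y - y0)\<^sup>2))) \<le>
     28000 / \<kappa> ^ 5 * (\<bar>y - y0\<bar> / r) * exp (- (\<kappa>\<^sup>2 / 16) * (real (Suc k) * \<alpha>) * (y - y0)\<^sup>2)"
proof -
  note b = saddle_basic[OF sad]
  define N where "N = real (Suc k) * \<alpha>"
  define v where "v = y - y0"
  define E where "E = exp (- (\<kappa>\<^sup>2 / 16) * N * v\<^sup>2)"
  have N0: "N > 0" using b by (simp add: N_def)
  show ?thesis
  proof (cases "\<bar>v\<bar> \<le> \<kappa> / 2 * r")
    case True
    have "27654 / \<kappa> ^ 5 * (\<bar>v\<bar> / r) * E \<le> 28000 / \<kappa> ^ 5 * (\<bar>v\<bar> / r) * E"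
      using b by (intro mult_right_mono divide_right_mono) (auto simp: E_def)
    then show ?thesis using kern_ratio_near[of y k] True unfolding E_def N_def v_def by linarith
  next
    case False
    \<comment> \<open>the missing factor \<open>\<bar>v\<bar> / r\<close> can be inserted here\<close>
    then have vr: "1 \<le> 2 / \<kappa> * (\<bar>v\<bar> / r)" using b by (simp add: field_simps)
    have "cmod (exp (- (of_real N * (radicand \<alpha> (Complex r y0))) * of_real (v\<^sup>2))) = exp (- (Re (radicand \<alpha> (Complex r y0)) * N) * v\<^sup>2)"
      unfolding cmod_exp_quadratic
      by (simp only: times_complex.sel Re_complex_of_real Im_complex_of_real mult_zero_left diff_zero mult.commute)
    also have "... \<le> E"
    proof -
      have "\<kappa>\<^sup>2 / 16 \<le> Re (radicand \<alpha> (Complex r y0))" using saddle_radicand(1)[OF sad] zero_le_power2[of \<kappa>] by linarith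
      then have "\<kappa>\<^sup>2 / 16 * (N * v\<^sup>2) \<le> Re (radicand \<alpha> (Complex r y0)) * (N * v\<^sup>2)" using N0 by (intro mult_right_mono) auto
      then show ?thesis unfolding E_def by (simp only: exp_le_cancel_iff mult_minus_left neg_le_iff_le mult.assoc)
    qed
    finally have g: "cmod (exp (- (of_real N * (radicand \<alpha> (Complex r y0))) * of_real (v\<^sup>2))) \<le> E" .
    have "cmod (kern_ratio \<alpha> r y0 k y - exp (- (of_real N * (radicand \<alpha> (Complex r y0))) * of_real (v\<^sup>2))) \<le> 109 * E"
      using kern_ratio_far[OF assms, of y] g norm_triangle_ineq4[of "kern_ratio \<alpha> r y0 k y" "exp (- (of_real N * (radicand \<alpha> (Complex r y0))) * of_real (v\<^sup>2))"]
      unfolding E_def N_def v_def by linarith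
    also have "109 * E = 109 * 1 * E" by simp
    also have "... \<le> 109 * (2 / \<kappa> * (\<bar>v\<bar> / r)) * E" using vr by (intro mult_mono) (auto simp: E_def)
    also have "... = 218 / \<kappa> * (\<bar>v\<bar> / r) * E" by simp
    also have "... \<le> 28000 / \<kappa> ^ 5 * (\<bar>v\<bar> / r) * E"
    proof -
      have "\<kappa> ^ 5 \<le> \<kappa> ^ 1" using b by (intro power_decreasing) auto
      then have "218 / \<kappa> \<le> 28000 / \<kappa> ^ 5" using b by (intro frac_le) auto
      then show ?thesis using b by (intro mult_right_mono) (auto simp: E_def)
    qed
    finally show ?thesis unfolding E_def N_def v_def .
  qed
qed


text \<open>Integration of the pointwise comparison. The Gaussian \<open>q\<close> is of order \<open>N^(-1/2)\<close>, so the error is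
smaller by the factor \<open>1 / (r sqrt N)\<close>.\<close>

lemma laplace_integral:
  assumes "1 \<le> k"
  defines "N \<equiv> real (Suc k) * \<alpha>"
  obtains q err where "(LINT y:{0..}|lborel. kern k N (Complex r y)) = kern k N (Complex r y0) * (q + err)"
    "q\<^sup>2 = of_real pi / (of_real N * (radicand \<alpha> (Complex r y0)))"
    "cmod err \<le> 448000 / (\<kappa> ^ 7 * r * N)"
proof -
  note b = saddle_basic[OF sad]
  let ?s = "radicand \<alpha> (Complex r y0)"
  let ?g = "\<lambda>v. exp (- (of_real N * ?s) * of_real (v\<^sup>2))"
  let ?E = "\<lambda>v. \<bar>v\<bar> * exp (- (\<kappa>\<^sup>2 / 16 * N) * v\<^sup>2)"
  let ?K0 = "kern k N (Complex r y0)"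
  let ?D = "kern_ratio \<alpha> r y0 k"
  have N0: "N > 0" using b by (simp add: N_def)
  have Ns: "Re (of_real N * ?s) > 0"
    using N0 saddle_radicand(3)[OF sad] by (simp only: times_complex.sel Re_complex_of_real Im_complex_of_real mult_zero_left diff_zero) (rule mult_pos_pos)
  have K0: "?K0 \<noteq> 0"
    using kern_psi[of "Complex r y0" k \<alpha>] psi_arg(4)[of "Complex r y0"] b by (simp add: N_def)
  define q where "q = (LINT v|lborel. ?g v)"
  have q2: "q\<^sup>2 = of_real pi / (of_real N * ?s)" unfolding q_def by (rule complex_gauss_square[OF Ns])
  have ig: "integrable lborel (\<lambda>y. ?g (y - y0))"
    using lborel_integrable_real_affine[OF complex_gauss_integrable[OF Ns], of 1 "- y0"] by (simp add: add.commute)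
  have qs: "(LINT y|lborel. ?g (y - y0)) = q"
    unfolding q_def using lborel_integral_real_affine[of 1 ?g "- y0"] by (simp add: add.commute)
  have c0: "\<kappa>\<^sup>2 / 16 * N > 0" using b N0 by simp
  have hE: "has_bochner_integral lborel ?E (1 / (\<kappa>\<^sup>2 / 16 * N))"
    by (rule gauss_abs_moment[OF c0])
  have iE: "integrable lborel (\<lambda>y. ?E (y - y0))"
    using lborel_integrable_real_affine[of ?E 1 "- y0"] hE by (simp add: add.commute has_bochner_integral_iff)
  have E: "(LINT y|lborel. ?E (y - y0)) = 16 / (\<kappa>\<^sup>2 * N)"
    using lborel_integral_real_affine[of 1 ?E "- y0"] hE by (simp add: add.commute has_bochner_integral_iff)
  have iK: "integrable lborel (\<lambda>y. indicator {0..} y *\<^sub>R kern k N (Complex r y))"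
    by (intro integrable_mult_indicator kern_line_integrable) (use b N0 in auto)
  have De: "?D = (\<lambda>y. indicator {0..} y *\<^sub>R kern k N (Complex r y) / ?K0)"
    by (auto simp: fun_eq_iff kern_ratio_def N_def indicator_def)
  have iD: "integrable lborel ?D" unfolding De by (intro integrable_divide iK)
  define err where "err = (LINT y|lborel. ?D y - ?g (y - y0))"
  have err: "(LINT y|lborel. ?D y) = q + err" unfolding err_def using iD ig qs by simp
  have "(LINT y:{0..}|lborel. kern k N (Complex r y)) = ?K0 * (LINT y|lborel. ?D y)"
    unfolding De set_lebesgue_integral_def using K0 by simp
  moreover have "cmod err \<le> 448000 / (\<kappa> ^ 7 * r * N)"
  proof -
    have "cmod err \<le> (LINT y|lborel. 28000 / \<kappa> ^ 5 / r * ?E (y - y0))"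
      unfolding err_def
    proof (rule Bochner_Integration.integral_norm_bound_integral)
      show "integrable lborel (\<lambda>y. ?D y - ?g (y - y0))" using iD ig by simp
      show "integrable lborel (\<lambda>y. 28000 / \<kappa> ^ 5 / r * ?E (y - y0))" using iE by simp
      show "cmod (?D y - ?g (y - y0)) \<le> 28000 / \<kappa> ^ 5 / r * ?E (y - y0)" for y
        using kern_ratio_gauss[OF assms(1), of y] unfolding N_def by (simp add: mult_ac)
    qed
    also have "... = 28000 / \<kappa> ^ 5 / r * (16 / (\<kappa>\<^sup>2 * N))" using E by simp
    also have "... = 448000 / (\<kappa> ^ 7 * r * N)"
    proof -
      have k7: "\<kappa> ^ 7 = \<kappa> ^ 5 * \<kappa>\<^sup>2" by (simp flip: power_add)
      have "28000 / a / r * (16 / (b * N)) = 448000 / (a * b * r * N)" for a b :: real by simp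
      then show ?thesis unfolding k7 .
    qed
    finally show ?thesis .
  qed
  ultimately show ?thesis using that q2 err by metis
qed

end

lemma norm_eq_of_square_eq:
  fixes x z :: complex
  assumes "x\<^sup>2 = z\<^sup>2"
  obtains e where "x = of_real e * z" "\<bar>e\<bar> = 1"
  using assms that[of 1] that[of "-1"] by (auto simp: power2_eq_iff)

text \<open>At the saddle \<open>1 / (1 - \<zeta>\<^sup>2) = \<alpha> \<zeta>\<close>, and the Gaussian integral is \<open>sqrt (\<pi> / \<lambda>) / sqrt (3 - 2 \<alpha> \<zeta>)\<close> up
to sign; their product is the amplitude \<open>C_amp\<close> up to normalisation. The sign disappears in absolute
values. The relative error is that of Laplace's method, of order \<open>1 / (r sqrt \<lambda>)\<close>.\<close>

theorem cheb_coeff_asymptotics: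
  assumes sad: "zeta_saddle \<kappa> \<alpha>" and al: "0 < \<alpha>" "\<alpha> < alpha_c" and n: "2 \<le> n"
  defines "lam \<equiv> real n * \<alpha>"
  defines "M \<equiv> P_amp (real n) lam * exp (A_exp (real n) lam)"
  shows "\<bar>\<bar>cheb_coeff n lam\<bar> - M * \<bar>cos (vartheta (real n) lam)\<bar>\<bar> \<le> 1344000 / (\<kappa> ^ 7 * (zre \<alpha> * sqrt lam)) * M"
proof -
  define r where "r = zre \<alpha>"
  define y0 where "y0 = zim \<alpha>"
  obtain k where k: "n = Suc k" "1 \<le> k" using n by (cases n) auto
  note b = saddle_basic[OF sad, folded r_def y0_def]
  have lam0: "lam > 0" using al n by (simp add: lam_def)
  have ln: "lam / real n = \<alpha>" using n by (simp add: lam_def)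
  define z where "z = Complex r y0"
  have zz: "zeta \<alpha> = z" by (simp add: zeta_Complex z_def r_def y0_def)
  define s where "s = sqrt_branch \<alpha>"
  have s2: "s\<^sup>2 = 3 - 2 * of_real \<alpha> * z" unfolding s_def zz[symmetric] by (rule sqrt_branch_spec(2)[OF al])
  have s0: "s \<noteq> 0" using Re_sqrt_branch_pos[OF al] by (auto simp: s_def)
  have s3: "cmod s \<le> 3"
  proof -
    have "(cmod s)\<^sup>2 \<le> 3\<^sup>2" using saddle_radicand(2)[OF sad] s2 by (simp add: z_def r_def y0_def flip: norm_power)
    then show ?thesis by (rule power2_le_imp_le) simp
  qed
  define \<psi> where "\<psi> = psi \<alpha> z"
  have S: "S_phase (real n) lam = of_nat n * \<psi>" by (simp add: S_phase_def ln zz \<psi>_def)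
  have A: "A_exp (real n) lam = Re (of_nat n * \<psi>)" by (simp add: A_exp_def S)
  have P: "P_amp (real n) lam = cmod (C_amp \<alpha>) / sqrt (real n)"
  proof -
    have "real n powr (- 1 / 2) = real n powr (- (1 / 2))" by simp
    also have "... = 1 / sqrt (real n)" unfolding powr_minus by (simp add: powr_half_sqrt inverse_eq_divide)
    finally show ?thesis unfolding P_amp_def ln B_amp_def by simp
  qed
  obtain q err where qe:
    "(LINT y:{0..}|lborel. kern k lam (Complex r y)) = kern k lam z * (q + err)"
    "q\<^sup>2 = of_real pi / (of_real lam * s\<^sup>2)" "cmod err \<le> 448000 / (\<kappa> ^ 7 * r * lam)"
    using laplace_integral[OF sad k(2)] unfolding s2 z_def lam_def k(1) r_def y0_def by metis
  define p where "p = sqrt (pi / lam)"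
  have "q\<^sup>2 = (of_real p / s)\<^sup>2"
    using lam0 by (simp add: qe(2) p_def power_divide flip: of_real_power)
  then obtain e where e: "q = of_real e * (of_real p / s)" "\<bar>e\<bar> = 1" by (rule norm_eq_of_square_eq)
  have kz: "kern k lam z = (- 1) ^ n * (exp (of_nat n * \<psi>) * (of_real \<alpha> * z))"
    using kern_psi[of z k \<alpha>] b saddle_eqn(2)[OF sad]
    by (simp add: lam_def k(1) z_def \<psi>_def r_def y0_def)
  define W where "W = exp (of_nat n * \<psi>) * (C_amp \<alpha> / of_real (sqrt (real n)))"
  have ps: "4 / pi * \<alpha> * p = 4 * sqrt \<alpha> / sqrt pi / sqrt (real n)"
  proof -
    have "p = sqrt pi / (sqrt (real n) * sqrt \<alpha>)" by (simp add: p_def lam_def real_sqrt_divide real_sqrt_mult)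
    moreover have "4 / (c * c) * (a * a) * (c / (m * a)) = 4 * a / c / m" if "a \<noteq> 0" "c \<noteq> 0" for a c m :: real
      using that by simp
    from this[of "sqrt \<alpha>" "sqrt pi" "sqrt (real n)"]
    have "4 / pi * \<alpha> * (sqrt pi / (sqrt (real n) * sqrt \<alpha>)) = 4 * sqrt \<alpha> / sqrt pi / sqrt (real n)"
      using al by simp
    ultimately show ?thesis by simp
  qed
  have main: "of_real (4 / pi) * (kern k lam z * q) = of_real (e * (- 1) ^ n) * W"
  proof -
    have "of_real (4 / pi) * (kern k lam z * q) = of_real (e * (- 1) ^ n) * (exp (of_nat n * \<psi>) * (of_real (4 / pi * \<alpha> * p) * (z / s)))"
      unfolding kz e(1) by simp
    also have "of_real (4 / pi * \<alpha> * p) * (z / s) = C_amp \<alpha> / of_real (sqrt (real n))"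
      unfolding ps C_amp_def zz s_def[symmetric] by simp
    finally show ?thesis by (simp add: W_def)
  qed
  have M: "M = cmod W"
    unfolding M_def P A W_def by (simp add: norm_mult norm_divide)
  have ReW: "\<bar>Re W\<bar> = M * \<bar>cos (vartheta (real n) lam)\<bar>"
  proof -
    have "exp (of_nat n * \<psi>) = of_real (exp (A_exp (real n) lam)) * cis (Im (of_nat n * \<psi>))"
      by (simp add: exp_eq_polar A)
    moreover have "C_amp \<alpha> = of_real (B_amp \<alpha>) * cis (beta \<alpha>)"
      using beta_spec[OF al] by (simp add: cis_conv_exp)
    ultimately have "W = of_real M * (cis (Im (of_nat n * \<psi>)) * cis (beta \<alpha>))"
      unfolding W_def M_def P B_amp_def by simp
    also have "cis (Im (of_nat n * \<psi>)) * cis (beta \<alpha>) = cis (vartheta (real n) lam)"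
      unfolding cis_mult vartheta_def S ln ..
    finally have "Re W = M * cos (vartheta (real n) lam)" by simp
    then show ?thesis by (simp add: abs_mult M)
  qed
  have "cheb_coeff n lam = 4 / pi * Re (kern k lam z * (q + err))"
    unfolding k(1) using cheb_coeff_vertical_line[of r lam k] b lam0 qe(1) by simp
  also have "... = Re (of_real (4 / pi) * (kern k lam z * q)) + Re (of_real (4 / pi) * (kern k lam z * err))"
    by (simp add: distrib_left)
  finally have a: "cheb_coeff n lam = e * (- 1) ^ n * Re W + Re (of_real (4 / pi) * (kern k lam z * err))"
    unfolding main by simp
  have "\<bar>e * (- 1) ^ n * Re W\<bar> = \<bar>Re W\<bar>" using e(2) by (simp add: abs_mult power_abs)
  then have "\<bar>\<bar>cheb_coeff n lam\<bar> - \<bar>Re W\<bar>\<bar> \<le> \<bar>Re (of_real (4 / pi) * (kern k lam z * err))\<bar>"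
    unfolding a by linarith
  also have "... \<le> cmod (of_real (4 / pi) * (kern k lam z * err))" by (rule abs_Re_le_cmod)
  also have "... = cmod (of_real (4 / pi) * (kern k lam z * q)) * (cmod err / cmod q)"
  proof -
    have "q \<noteq> 0" using e s0 lam0 by (auto simp: p_def)
    then have q0: "cmod q \<noteq> 0" by simp
    have "a * (b * x) = a * (b * y) * (x / y)" if "y \<noteq> 0" for a b x y :: real
      using that by simp
    then show ?thesis unfolding norm_mult using q0 .
  qed
  also have "cmod (of_real (4 / pi) * (kern k lam z * q)) = M"
    unfolding main M using e(2) by (simp add: norm_mult norm_power)
  also have "M * (cmod err / cmod q) \<le> M * (1344000 / (\<kappa> ^ 7 * (r * sqrt lam)))"
  proof (intro mult_left_mono)
    have p0: "p > 0" using lam0 by (simp add: p_def)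
    have cq: "cmod q = p / cmod s" using e p0 by (simp add: norm_mult norm_divide)
    have "cmod err / cmod q = cmod err * (cmod s / p)" by (simp add: cq)
    also have "... \<le> 448000 / (\<kappa> ^ 7 * r * lam) * (3 * sqrt lam)"
    proof (intro mult_mono qe(3))
      have "1 / p \<le> sqrt lam"
      proof -
        have "1 / p = sqrt lam / sqrt pi" by (simp add: p_def real_sqrt_divide)
        also have "... \<le> sqrt lam / 1" using lam0 pi_gt3 by (intro divide_left_mono) auto
        finally show ?thesis by simp
      qed
      then have "cmod s * (1 / p) \<le> 3 * sqrt lam" using s3 p0 by (intro mult_mono) auto
      then show "cmod s / p \<le> 3 * sqrt lam" by simp
    qed (use b lam0 p0 in auto)
    also have "... = 1344000 / (\<kappa> ^ 7 * (r * sqrt lam)) * (sqrt lam * sqrt lam / lam)"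
      using b lam0 by (simp add: field_simps)
    finally show "cmod err / cmod q \<le> 1344000 / (\<kappa> ^ 7 * (r * sqrt lam))" using lam0 by simp
  qed (simp add: M)
  finally show ?thesis unfolding ReW r_def by (simp add: mult.commute)
qed

section \<open>Variation of the saddle with the degree\<close>

lemma saddle_delta:
  assumes "saddle \<kappa> \<alpha> r y" "0 < \<delta>" "\<delta> ^ 3 = \<alpha>"
  shows "1 / 2 \<le> \<delta> * r" "\<delta> * r \<le> 1"
proof -
  note b = saddle_basic[OF assms(1)] and a = saddle_alpha[OF assms(1)]
  have e: "(\<delta> * r) ^ 3 = \<alpha> * r ^ 3" by (simp add: power_mult_distrib assms(3))
  have "(1 / 2) ^ 3 \<le> (\<delta> * r) ^ 3" unfolding e using a(1) by (simp add: power3_eq_cube)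
  then show "1 / 2 \<le> \<delta> * r" by (rule power_le_imp_le_base[of _ 2, simplified]) (use assms b in simp)
  have "(\<delta> * r) ^ 3 \<le> 1 ^ 3" unfolding e using a(2) by simp
  then show "\<delta> * r \<le> 1" by (rule power_le_imp_le_base[of _ 2, simplified]) simp
qed

text \<open>A relative change \<open>h / x\<close> of \<open>1 / \<alpha>\<close> moves the saddle by a comparable relative amount: the real part
by the monotonicity of the cubic, the imaginary part by \<open>y\<^sup>2 = 3 r\<^sup>2 - 1\<close>.\<close>

lemma saddle_move:
  assumes s: "saddle \<kappa> \<alpha> r y" and s': "saddle \<kappa> \<alpha>' r' y'"
    and "\<alpha>' * (x + h) = \<alpha> * x" "0 < x" "0 \<le> h"
  shows "r \<le> r'" "y \<le> y'" "cmod (Complex r' y' - Complex r y) \<le> 2 / \<kappa> * r * (h / x)"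
    "\<alpha>' \<le> \<alpha>" "\<alpha> - \<alpha>' \<le> \<alpha> * (h / x)"
proof -
  note b = saddle_basic[OF s] and b' = saddle_basic[OF s']
  have al: "\<alpha>' = \<alpha> * x / (x + h)" using assms by (simp add: eq_divide_eq)
  have hx: "0 \<le> h / x" using assms by simp
  have q: "8 * r ^ 3 - 2 * r = 1 / \<alpha>" using b by (simp add: field_simps)
  have q': "8 * r' ^ 3 - 2 * r' = 1 / \<alpha> * (1 + h / x)"
  proof -
    have "8 * r' ^ 3 - 2 * r' = 1 / \<alpha>'" using b' by (simp add: field_simps)
    also have "... = 1 / \<alpha> * (1 + h / x)" unfolding al using assms(4) by (simp add: field_simps)
    finally show ?thesis .
  qed
  have d: "(8 * r' ^ 3 - 2 * r') - (8 * r ^ 3 - 2 * r) = 1 / \<alpha> * (h / x)" unfolding q q' by (simp add: algebra_simps)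
  have d0: "1 / \<alpha> * (h / x) \<ge> 0" using b(8) hx by (intro mult_nonneg_nonneg) auto
  show rr: "r \<le> r'"
  proof (rule ccontr)
    assume "\<not> r \<le> r'"
    then have lt: "r' < r" by simp
    have "18 * r'\<^sup>2 * (r - r') \<le> (8 * r ^ 3 - 2 * r) - (8 * r' ^ 3 - 2 * r')"
      by (rule cubic_strict_mono) (use b' lt in auto)
    moreover have "18 * r'\<^sup>2 * (r - r') > 0" using b' lt by simp
    ultimately show False using d d0 by linarith
  qed
  have dr: "r' - r \<le> r * (h / x) / 2"
  proof (cases "r = r'")
    case True
    have "0 \<le> r * (h / x)" by (rule mult_nonneg_nonneg[OF less_imp_le[OF b(3)] hx])
    then show ?thesis unfolding True[symmetric] diff_self by (rule divide_nonneg_nonneg) simp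
  next
    case False
    have "18 * r\<^sup>2 * (r' - r) \<le> (8 * r' ^ 3 - 2 * r') - (8 * r ^ 3 - 2 * r)"
      by (rule cubic_strict_mono) (use b rr False in auto)
    also have "... = 1 / \<alpha> * (h / x)" by (rule d)
    also have "... \<le> 8 * r ^ 3 * (h / x)" using q hx b by (intro mult_right_mono) auto
    finally have "r\<^sup>2 * (18 * (r' - r)) \<le> r\<^sup>2 * (8 * r * (h / x))" by (simp add: power2_eq_square power3_eq_cube mult_ac)
    then have "18 * (r' - r) \<le> 8 * r * (h / x)"
      by (rule mult_left_le_imp_le) (use b(3) in simp)
    then have 1: "18 * (r' - r) \<le> 8 * (r * (h / x))" by (simp only: mult.assoc)
    have 2: "0 \<le> r * (h / x)" by (rule mult_nonneg_nonneg[OF less_imp_le[OF b(3)] hx])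
    have "A \<le> B / 2" if "18 * A \<le> 8 * B" "0 \<le> B" for A B :: real using that by linarith
    from this[OF 1 2] show ?thesis .
  qed
  have "y\<^sup>2 \<le> y'\<^sup>2" unfolding b(6) b'(6) using rr b(3) by (simp add: power_mono)
  then show yy: "y \<le> y'" by (rule power2_le_imp_le) (use b'(5) in simp)
  have dy: "y' - y \<le> 3 / \<kappa> * (r' - r)"
  proof -
    have pos: "0 < \<kappa> * (r + r')" using b b' by simp
    have "\<kappa> * (r + r') \<le> y + y'" using b(4) b'(4) by (simp add: distrib_left)
    then have "(y' - y) * (\<kappa> * (r + r')) \<le> (y' - y) * (y + y')" using yy by (intro mult_left_mono) simp_all
    also have "... = y'\<^sup>2 - y\<^sup>2" by (simp add: expand_powers)
    also have "... = 3 * (r' - r) * (r + r')" unfolding b(6) b'(6) by (simp add: expand_powers)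
    also have "... = 3 / \<kappa> * (r' - r) * (\<kappa> * (r + r'))" using b(1) by simp
    finally show ?thesis using pos by (rule mult_right_le_imp_le)
  qed
  have "cmod (Complex r' y' - Complex r y) \<le> \<bar>r' - r\<bar> + \<bar>y' - y\<bar>"
    using cmod_le[of "Complex r' y' - Complex r y"] by simp
  also have "... \<le> (r' - r) + 3 / \<kappa> * (r' - r)" using rr yy dy by simp
  also have "... \<le> 1 / \<kappa> * (r' - r) + 3 / \<kappa> * (r' - r)"
  proof -
    have "1 \<le> 1 / \<kappa>" using b(1,2) by simp
    then have "1 * (r' - r) \<le> 1 / \<kappa> * (r' - r)" using rr by (intro mult_right_mono) simp_all
    then show ?thesis by simp
  qed
  also have "... = 4 / \<kappa> * (r' - r)"
  proof -
    have "1 / \<kappa> * d + 3 / \<kappa> * d = 4 / \<kappa> * d" for d :: real by (simp add: add_divide_distrib[symmetric])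
    then show ?thesis .
  qed
  also have "... \<le> 4 / \<kappa> * (r * (h / x) / 2)" using dr b(1) by (intro mult_left_mono) simp_all
  also have "... = 2 / \<kappa> * r * (h / x)" by simp
  finally show "cmod (Complex r' y' - Complex r y) \<le> 2 / \<kappa> * r * (h / x)" .
  show "\<alpha>' \<le> \<alpha>" unfolding al using assms(4,5) b(8) by (simp add: divide_le_eq mult_left_mono)
  have "\<alpha> - \<alpha>' = \<alpha> * (h / (x + h))" unfolding al using assms(4,5) by (simp add: field_simps)
  also have "... \<le> \<alpha> * (h / x)" using assms(4,5) b(8) by (intro mult_left_mono divide_left_mono) auto
  finally show "\<alpha> - \<alpha>' \<le> \<alpha> * (h / x)" .
qed

text \<open>Taylor's formula of order one at the stationary point for \<open>\<alpha>'\<close>, hence quadratic in the displacement.\<close>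

lemma psi_second_order:
  assumes s: "saddle \<kappa> \<alpha> r y" and s': "saddle \<kappa> \<alpha>' r' y'" and "r \<le> r'" "y \<le> y'" "\<alpha>' \<le> \<alpha>"
  shows "cmod (psi \<alpha>' (Complex r y) - psi \<alpha>' (Complex r' y')) \<le> 34 * \<alpha> / \<kappa>\<^sup>2 * (cmod (Complex r' y' - Complex r y))\<^sup>2"
proof -
  note b = saddle_basic[OF s] and b' = saddle_basic[OF s']
  let ?S = "{z. Re z \<ge> r} \<inter> {z. Im z \<ge> \<kappa> * r}"
  have cv: "convex ?S" by (intro convex_Int convex_halfspace_Im_ge convex_halfspace_Re_ge)
  have kr: "\<kappa> * r > 0" using b by simp
  have pos: "Im z > 0" if "z \<in> ?S" for z using that kr by auto
  have bd: "cmod (psi_d \<alpha>' (Suc 1) z) \<le> 34 * \<alpha> / \<kappa>\<^sup>2" if z: "z \<in> ?S" for z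
  proof -
    note a = psi_arg[OF pos[OF z]]
    have sl: "\<kappa> * r * cmod (z + 1) \<le> cmod (z\<^sup>2 - 1)" "\<kappa> * r\<^sup>2 \<le> cmod (z\<^sup>2 - 1)" "cmod z \<le> cmod (z + 1)"
      using sector_lower[of r z \<kappa>] z b by auto
    have c0: "cmod (z + 1) > 0" using a by simp
    have "psi_d \<alpha>' (Suc 1) z = - 4 * z / (z\<^sup>2 - 1)\<^sup>2 + 2 * of_real \<alpha>'"
      using inverse_square_difference[OF a(2,3)] by (simp add: psi_d_def)
    then have "cmod (psi_d \<alpha>' (Suc 1) z) \<le> cmod (- 4 * z / (z\<^sup>2 - 1)\<^sup>2) + cmod (2 * of_real \<alpha>')"
      by (simp only: norm_triangle_ineq)
    also have "cmod (- 4 * z / (z\<^sup>2 - 1)\<^sup>2) = 4 * cmod z / (cmod (z\<^sup>2 - 1) * cmod (z\<^sup>2 - 1))"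
      by (simp add: norm_divide norm_mult power2_eq_square)
    also have "... \<le> 4 * cmod (z + 1) / ((\<kappa> * r * cmod (z + 1)) * (\<kappa> * r\<^sup>2))"
      using sl b c0 by (intro frac_le mult_left_mono mult_mono mult_pos_pos) auto
    also have "... = 4 / \<kappa>\<^sup>2 * (1 / r ^ 3)"
      using c0 by (simp add: power2_eq_square power3_eq_cube)
    also have "... \<le> 4 / \<kappa>\<^sup>2 * (8 * \<alpha>)"
      using saddle_alpha(1)[OF s] b by (intro mult_left_mono) (auto simp: field_simps)
    also have "cmod (2 * of_real \<alpha>') = 2 * \<alpha>'" using b' by (simp add: norm_mult)
    also have "2 * \<alpha>' \<le> 2 * \<alpha> / \<kappa>\<^sup>2"
    proof -
      have "\<kappa>\<^sup>2 \<le> 1" using b by (simp add: power_le_one)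
      then have "2 * \<alpha> * 1 \<le> 2 * \<alpha> * (1 / \<kappa>\<^sup>2)" using b by (intro mult_left_mono) auto
      then show ?thesis using assms(5) by simp
    qed
    finally show ?thesis by (simp add: field_simps)
  qed
  have zS: "Complex r' y' \<in> ?S" "Complex r y \<in> ?S" using b b' assms by auto
  have "cmod (psi_d \<alpha>' 0 (Complex r y) - (\<Sum>i\<le>1. psi_d \<alpha>' i (Complex r' y') * (Complex r y - Complex r' y') ^ i / fact i))
     \<le> 34 * \<alpha> / \<kappa>\<^sup>2 * cmod (Complex r y - Complex r' y') ^ Suc 1 / fact 1"
    by (rule complex_Taylor[OF cv psi_d_deriv bd zS]) (use pos in auto)
  also have "(\<Sum>i\<le>1. psi_d \<alpha>' i (Complex r' y') * (Complex r y - Complex r' y') ^ i / fact i) = psi \<alpha>' (Complex r' y')"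
    using psi_d_saddle(1)[OF s'] by (simp add: psi_d_0)
  finally show ?thesis unfolding psi_d_0 by (simp add: norm_minus_commute numeral_2_eq_2)
qed

text \<open>The derivative of \<open>S_phase\<close> in its first argument: as \<open>psi\<close> is stationary at the saddle, only the
explicit dependence on that argument contributes.\<close>

definition phase_rate :: "real \<Rightarrow> complex" where
  "phase_rate \<alpha> = Ln ((zeta \<alpha> - 1) / (zeta \<alpha> + 1))"

text \<open>For \<open>\<alpha> = \<lambda> / x\<close> and a fixed point \<open>z\<close>, \<open>x \<psi>(z) = x log ((z - 1) / (z + 1)) + \<lambda> z\<^sup>2\<close> is affine in \<open>x\<close>. The
remaining effect of moving the saddle is of second order.\<close>

lemma S_phase_increment:
  assumes s: "zeta_saddle \<kappa> (lam / x)"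
    and s': "zeta_saddle \<kappa> (lam / (x + h))"
    and x: "0 < x" "0 \<le> h" "h \<le> x" and d: "0 < \<delta>" "\<delta> ^ 3 = lam / x"
  shows "cmod (S_phase (x + h) lam - S_phase x lam - of_real h * phase_rate (lam / x)) \<le> 272 / \<kappa> ^ 4 * \<delta> * h\<^sup>2 / x"
proof -
  define \<alpha> where "\<alpha> = lam / x"
  define \<alpha>' where "\<alpha>' = lam / (x + h)"
  define r where "r = zre \<alpha>"
  note b = saddle_basic[OF s, folded \<alpha>_def, folded r_def]
  have eq: "\<alpha>' * (x + h) = \<alpha> * x" using x by (simp add: \<alpha>_def \<alpha>'_def)
  note mv = saddle_move[OF s[folded \<alpha>_def] s'[folded \<alpha>'_def] eq x(1,2)]
  have z: "zeta \<alpha> = Complex r (zim \<alpha>)" "zeta \<alpha>' = Complex (zre \<alpha>') (zim \<alpha>')"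
    by (simp_all add: zeta_Complex r_def)
  have "S_phase (x + h) lam - S_phase x lam - of_real h * phase_rate \<alpha> = of_real (x + h) * (psi \<alpha>' (zeta \<alpha>') - psi \<alpha>' (zeta \<alpha>))"
  proof -
    have 1: "of_real x * of_real \<alpha> = (of_real lam :: complex)" "of_real (x + h) * of_real \<alpha>' = (of_real lam :: complex)"
    proof -
      have "x * \<alpha> = lam" "(x + h) * \<alpha>' = lam" using x by (simp_all add: \<alpha>_def \<alpha>'_def)
      then show "of_real x * of_real \<alpha> = (of_real lam :: complex)" "of_real (x + h) * of_real \<alpha>' = (of_real lam :: complex)"
        by (simp_all only: of_real_mult[symmetric])
    qed
    have "of_real (x + h) * psi \<alpha>' (zeta \<alpha>) = of_real (x + h) * phase_rate \<alpha> + of_real lam * (zeta \<alpha>)\<^sup>2"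
      unfolding psi_def phase_rate_def distrib_left mult.assoc[symmetric] 1 ..
    moreover have "S_phase x lam = of_real x * phase_rate \<alpha> + of_real lam * (zeta \<alpha>)\<^sup>2"
      unfolding S_phase_def \<alpha>_def[symmetric] psi_def phase_rate_def distrib_left mult.assoc[symmetric] 1 ..
    moreover have "S_phase (x + h) lam = of_real (x + h) * psi \<alpha>' (zeta \<alpha>')" by (simp add: S_phase_def \<alpha>'_def)
    ultimately show ?thesis by (simp add: algebra_simps)
  qed
  then have "cmod (S_phase (x + h) lam - S_phase x lam - of_real h * phase_rate \<alpha>) = (x + h) * cmod (psi \<alpha>' (zeta \<alpha>) - psi \<alpha>' (zeta \<alpha>'))"
    using x by (simp add: norm_mult norm_minus_commute del: of_real_add)
  also have "... \<le> (2 * x) * (34 * \<alpha> / \<kappa>\<^sup>2 * (2 / \<kappa> * r * (h / x))\<^sup>2)"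
  proof (intro mult_mono)
    have "cmod (psi \<alpha>' (zeta \<alpha>) - psi \<alpha>' (zeta \<alpha>')) \<le> 34 * \<alpha> / \<kappa>\<^sup>2 * (cmod (zeta \<alpha>' - zeta \<alpha>))\<^sup>2"
      unfolding z r_def by (rule psi_second_order[OF s[folded \<alpha>_def] s'[folded \<alpha>'_def] mv(1,2,4)])
    also have "... \<le> 34 * \<alpha> / \<kappa>\<^sup>2 * (2 / \<kappa> * r * (h / x))\<^sup>2"
      using mv(3) b unfolding z r_def by (intro mult_left_mono power_mono) auto
    finally show "cmod (psi \<alpha>' (zeta \<alpha>) - psi \<alpha>' (zeta \<alpha>')) \<le> 34 * \<alpha> / \<kappa>\<^sup>2 * (2 / \<kappa> * r * (h / x))\<^sup>2" .
  qed (use x in auto)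
  also have "... = 272 / \<kappa> ^ 4 * (\<alpha> * r\<^sup>2) * h\<^sup>2 / x"
  proof -
    have k4: "\<kappa> ^ 4 = \<kappa>\<^sup>2 * \<kappa>\<^sup>2" by (simp flip: power_add)
    have "(2 * x) * (34 * \<alpha> / a * (2 / b * r * (h / x))\<^sup>2) = 272 / (a * b\<^sup>2) * (\<alpha> * r\<^sup>2) * h\<^sup>2 / x" for a b
      using x(1) by (simp add: power_mult_distrib power_divide power2_eq_square mult_ac)
    then show ?thesis unfolding k4 .
  qed
  also have "... \<le> 272 / \<kappa> ^ 4 * \<delta> * h\<^sup>2 / x"
  proof (intro divide_right_mono mult_right_mono mult_left_mono)
    have "\<alpha> * r\<^sup>2 \<le> 1 / (2 * r)" unfolding r_def by (rule saddle_alpha(3)[OF s[folded \<alpha>_def]])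
    also have "... \<le> \<delta>" using saddle_delta(1)[OF s d] b(3) by (simp add: divide_le_eq r_def \<alpha>_def)
    finally show "\<alpha> * r\<^sup>2 \<le> \<delta>" .
  qed (use b x in auto)
  finally show ?thesis unfolding \<alpha>_def .
qed

text \<open>With \<open>w = (\<zeta> - 1) / (\<zeta> + 1)\<close> one has \<open>\<bar>w\<bar>\<^sup>2 = (2 r - 1) / (2 r + 1)\<close> and
\<open>sin (arg w) = Im w / \<bar>w\<bar> = 2 y \<alpha> \<bar>\<zeta>\<bar>\<close>; both are controlled by \<open>1 / r\<close>, that is, by \<open>\<delta>\<close>.\<close>

lemma phase_rate_bounds:
  assumes s: "zeta_saddle \<kappa> \<alpha>" and d: "0 < \<delta>" "\<delta> ^ 3 = \<alpha>"
  shows "\<bar>Re (phase_rate \<alpha>)\<bar> \<le> 8 * \<delta>" "\<kappa>\<^sup>2 / 4 * \<delta> \<le> sin (Im (phase_rate \<alpha>))"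
proof -
  define r where "r = zre \<alpha>"
  define y where "y = zim \<alpha>"
  define z where "z = Complex r y"
  define w where "w = (z - 1) / (z + 1)"
  note s = s[folded r_def y_def]
  note b = saddle_basic[OF s] and dl = saddle_delta[OF s d]
  have zz: "zeta \<alpha> = z" by (simp add: zeta_Complex z_def r_def y_def)
  have Imz: "Im z > 0" using b by (simp add: z_def)
  note a = psi_arg[OF Imz]
  have w0: "w \<noteq> 0" using a by (simp add: w_def)
  have L: "phase_rate \<alpha> = Ln w" by (simp add: phase_rate_def zz w_def)
  \<comment> \<open>\<open>4/7 < 1 / sqrt 3\<close>; it gives \<open>2 r - 1 \<ge> r / 4\<close>\<close>
  have r47: "4 / 7 < r"
  proof (rule power2_less_imp_less)
    show "(4 / 7)\<^sup>2 < r\<^sup>2" using b(7) by (simp add: power2_eq_square)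
  qed (use b in simp)
  have n1: "(cmod (z - 1))\<^sup>2 = 2 * r * (2 * r - 1)" "(cmod (z + 1))\<^sup>2 = 2 * r * (2 * r + 1)"
    using saddle_norms(2,3)[OF s] unfolding z_def[symmetric] by (auto simp: expand_powers)
  have cw2: "(cmod w)\<^sup>2 = (2 * r - 1) / (2 * r + 1)"
    unfolding w_def norm_divide power_divide n1 using b by simp
  have "2 * Re (phase_rate \<alpha>) = ln ((cmod w)\<^sup>2)" unfolding L using w0 by (simp add: ln_realpow)
  also have "... = - ln ((2 * r + 1) / (2 * r - 1))" unfolding cw2 using b(10) by (simp add: ln_div)
  finally have R: "2 * Re (phase_rate \<alpha>) = - ln ((2 * r + 1) / (2 * r - 1))" .
  have "ln ((2 * r + 1) / (2 * r - 1)) \<ge> 0" using b(10) by (simp add: divide_simps)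
  moreover have "ln ((2 * r + 1) / (2 * r - 1)) \<le> 16 * \<delta>"
  proof -
    have "(2 * r + 1) / (2 * r - 1) = 1 + 2 / (2 * r - 1)" using b(10) by (simp add: field_simps)
    then have "ln ((2 * r + 1) / (2 * r - 1)) \<le> 2 / (2 * r - 1)"
      using ln_add_one_self_le_self[of "2 / (2 * r - 1)"] b(10) by simp
    also have "... \<le> 2 / (r / 4)" using r47 by (intro divide_left_mono) auto
    also have "... = 8 * (1 / r)" by simp
    also have "1 / r \<le> 2 * \<delta>" using dl(1) b(3) by (simp add: divide_le_eq)
    finally show ?thesis by simp
  qed
  ultimately show "\<bar>Re (phase_rate \<alpha>)\<bar> \<le> 8 * \<delta>" using R by linarith
  have "sin (Im (phase_rate \<alpha>)) = Im w / cmod w"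
  proof -
    have "w = of_real (cmod w) * cis (Im (Ln w))"
      using w0 by (metis exp_Ln exp_eq_polar Re_Ln exp_ln zero_less_norm_iff)
    then have "Im w = cmod w * sin (Im (Ln w))" by (metis cis.sel(2) Im_complex_of_real Re_complex_of_real times_complex.sel(2) add.right_neutral mult_zero_left cis.sel(1))
    then show ?thesis unfolding L using w0 by simp
  qed
  also have "Im w = 2 * y / (cmod (z + 1))\<^sup>2"
    unfolding w_def Im_divide cmod_power2 by (simp add: algebra_simps z_def)
  also have "2 * y / (cmod (z + 1))\<^sup>2 / cmod w = 2 * y / (cmod (z - 1) * cmod (z + 1))"
  proof -
    have "2 * y / q\<^sup>2 / (p / q) = 2 * y / (p * q)" if "p \<noteq> 0" "q \<noteq> 0" for p q :: real
      using that by (simp add: power2_eq_square)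
    then show ?thesis unfolding w_def norm_divide using a by simp
  qed
  also have "cmod (z - 1) * cmod (z + 1) = cmod (1 - z\<^sup>2)"
    by (metis norm_minus_commute norm_mult square_minus_one)
  also have "2 * y / cmod (1 - z\<^sup>2) = 2 * y * cmod (of_real \<alpha> * z)"
    using saddle_eqn(2)[OF s] by (simp add: z_def norm_divide)
  also have "... = 2 * y * (\<alpha> * cmod z)" using b by (simp add: norm_mult)
  finally have sn: "sin (Im (phase_rate \<alpha>)) = 2 * y * (\<alpha> * cmod z)" .
  have "\<kappa>\<^sup>2 / 4 * \<delta> \<le> \<kappa>\<^sup>2 / 4 * (1 / r)" using dl(2) b(3) by (intro mult_left_mono) (auto simp: le_divide_eq)
  also have "... \<le> \<kappa>\<^sup>2 / 4 * (8 * \<alpha> * r\<^sup>2)"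
    using saddle_alpha(1)[OF s] b(3) by (intro mult_left_mono) (auto simp: divide_le_eq power2_eq_square power3_eq_cube)
  also have "... = 2 * \<alpha> * (\<kappa> * r)\<^sup>2" by (simp add: power_mult_distrib)
  also have "... \<le> 2 * \<alpha> * (y * y)"
  proof (rule mult_left_mono)
    show "(\<kappa> * r)\<^sup>2 \<le> y * y" unfolding power2_eq_square by (intro mult_mono) (use b(1,3,4,5) in simp_all)
  qed (use b(8) in simp)
  also have "... \<le> 2 * \<alpha> * (y * cmod z)"
    using b abs_Im_le_cmod[of z] by (intro mult_left_mono) (auto simp: z_def)
  finally show "\<kappa>\<^sup>2 / 4 * \<delta> \<le> sin (Im (phase_rate \<alpha>))" unfolding sn by (simp add: mult_ac)
qed

lemma sgn_diff_le:
  fixes a b :: complex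
  assumes "b \<noteq> 0"
  shows "cmod (sgn a - sgn b) \<le> 2 * cmod (a - b) / cmod b"
proof (cases "a = 0")
  case True
  then show ?thesis using assms by (simp add: norm_sgn)
next
  case False
  have "sgn a - sgn b = (a - b) / of_real (cmod b) + a * of_real (1 / cmod a - 1 / cmod b)"
    using assms False by (simp add: sgn_eq field_simps)
  then have "cmod (sgn a - sgn b) \<le> cmod (a - b) / cmod b + cmod a * \<bar>1 / cmod a - 1 / cmod b\<bar>"
    by (smt (verit) norm_divide norm_mult norm_of_real norm_triangle_ineq abs_norm_cancel)
  also have "cmod a * \<bar>1 / cmod a - 1 / cmod b\<bar> = \<bar>cmod b - cmod a\<bar> / cmod b"
  proof -
    have "cmod a * \<bar>1 / cmod a - 1 / cmod b\<bar> = \<bar>cmod a * (1 / cmod a - 1 / cmod b)\<bar>" by (simp add: abs_mult)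
    also have "cmod a * (1 / cmod a - 1 / cmod b) = (cmod b - cmod a) / cmod b" using assms False by (simp add: field_simps)
    finally show ?thesis by simp
  qed
  also have "... \<le> cmod (a - b) / cmod b"
    by (intro divide_right_mono) (metis norm_triangle_ineq3 abs_minus_commute, simp)
  finally show ?thesis by (simp add: field_simps)
qed

text \<open>Doubling the argument replaces the square root by its radicand, so no branch has to be followed
when \<open>\<alpha>\<close> varies.\<close>

lemma cis_double_beta:
  assumes "0 < \<alpha>" "\<alpha> < alpha_c"
  shows "cis (2 * beta \<alpha>) = (sgn (zeta \<alpha>))\<^sup>2 / sgn (radicand \<alpha> (zeta \<alpha>))"
proof -
  let ?s = "sqrt_branch \<alpha>"
  have s0: "?s \<noteq> 0" using Re_sqrt_branch_pos[OF assms] by auto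
  obtain \<kappa> where s: "zeta_saddle \<kappa> \<alpha>" using saddle_at[OF assms] .
  have z0: "zeta \<alpha> \<noteq> 0" using saddle_basic[OF s] by (auto simp: zeta_Complex complex_eq_iff)
  have k: "4 * sqrt \<alpha> / sqrt pi > 0" using assms by simp
  have C: "C_amp \<alpha> = of_real (B_amp \<alpha>) * cis (beta \<alpha>)" using beta_spec[OF assms] by (simp add: cis_conv_exp)
  have B0: "B_amp \<alpha> > 0" using assms(1) k z0 s0 by (simp add: B_amp_def C_amp_def)
  have "sgn (of_real (B_amp \<alpha>) * cis (beta \<alpha>)) = cis (beta \<alpha>)"
    using B0 by (simp add: sgn_mult sgn_of_real sgn_eq norm_mult)
  then have "cis (beta \<alpha>) = sgn (C_amp \<alpha>)" unfolding C by simp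
  also have "... = sgn (of_real (4 * sqrt \<alpha> / sqrt pi)) * sgn (zeta \<alpha> / ?s)" unfolding C_amp_def by (rule sgn_mult)
  also have "sgn (of_real (4 * sqrt \<alpha> / sqrt pi) :: complex) = 1"
  proof -
    have "sgn (4 * sqrt \<alpha> / sqrt pi) = 1" using k by (simp only: sgn_1_pos)
    then show ?thesis by (simp only: sgn_of_real of_real_1)
  qed
  finally have c: "cis (beta \<alpha>) = sgn (zeta \<alpha>) / sgn ?s" by (simp add: divide_inverse sgn_mult sgn_inverse)
  have "cis (2 * beta \<alpha>) = (cis (beta \<alpha>))\<^sup>2" by (simp add: power2_eq_square cis_mult)
  also have "... = (sgn (zeta \<alpha>))\<^sup>2 / sgn (?s\<^sup>2)" unfolding c power_divide by (simp add: power2_eq_square sgn_mult)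
  finally show ?thesis unfolding sqrt_branch_spec(2)[OF assms] .
qed

section \<open>Phase, amplitude and sums of squared cosines\<close>

text \<open>The directions of \<open>\<zeta>\<close> and of the radicand change by at most twice the relative change of these
numbers, and the radicand is bounded below by \<open>\<kappa>\<^sup>2\<close>.\<close>

lemma cis_double_beta_move:
  assumes s: "zeta_saddle \<kappa> \<alpha>" and s': "zeta_saddle \<kappa> \<alpha>'"
    and c: "\<alpha> < alpha_c" "\<alpha>' < alpha_c"
    and h: "\<alpha>' * (x + h) = \<alpha> * x" "0 < x" "0 \<le> h"
  shows "cmod (cis (2 * beta \<alpha>') - cis (2 * beta \<alpha>)) \<le> 32 / \<kappa> ^ 3 * (h / x)"
proof -
  note b = saddle_basic[OF s] and b' = saddle_basic[OF s'] and mv = saddle_move[OF s s' h]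
  define t where "t = h / x"
  define z where "z = zeta \<alpha>"
  define z' where "z' = zeta \<alpha>'"
  define v where "v = 3 - 2 * of_real \<alpha> * z"
  define v' where "v' = 3 - 2 * of_real \<alpha>' * z'"
  have t0: "t \<ge> 0" using h by (simp add: t_def)
  have zc: "z = Complex (zre \<alpha>) (zim \<alpha>)" "z' = Complex (zre \<alpha>') (zim \<alpha>')" by (simp_all add: z_def z'_def zeta_Complex)
  have dz: "cmod (z' - z) \<le> 2 / \<kappa> * zre \<alpha> * t" using mv(3) by (simp add: zc t_def)
  have nz: "zre \<alpha> \<le> cmod z" "cmod z \<le> 2 * zre \<alpha>" using saddle_norms(4,5)[OF s] by (simp_all add: zc)
  have z0: "z \<noteq> 0" "z' \<noteq> 0" using b b' by (auto simp: zc complex_eq_iff)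
  have vk: "\<kappa>\<^sup>2 \<le> cmod v" using saddle_radicand(1)[OF s] complex_Re_le_cmod[of v] by (simp only: v_def zc)
  then have v0: "v \<noteq> 0" using b(1) by auto
  have "Re v' > 0" unfolding v'_def zc by (rule saddle_radicand(3)[OF s'])
  then have v0': "v' \<noteq> 0" by auto
  have du: "cmod (sgn z' - sgn z) \<le> 4 / \<kappa> * t"
  proof -
    have "cmod (sgn z' - sgn z) \<le> 2 * cmod (z' - z) / cmod z" by (rule sgn_diff_le[OF z0(1)])
    also have "... \<le> 2 * (2 / \<kappa> * zre \<alpha> * t) / zre \<alpha>"
      using dz nz b(1,3) t0 by (intro frac_le mult_left_mono) auto
    finally show ?thesis using b(3) by simp
  qed
  have dv: "cmod (sgn v' - sgn v) \<le> 24 / \<kappa> ^ 3 * t"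
  proof -
    have "v' - v = - 2 * (of_real \<alpha>' * (z' - z) - of_real (\<alpha> - \<alpha>') * z)"
      by (simp add: v_def v'_def algebra_simps)
    moreover have "cmod (- 2 * u) = 2 * cmod u" for u :: complex by (simp add: norm_mult)
    ultimately have "cmod (v' - v) = 2 * cmod (of_real \<alpha>' * (z' - z) - of_real (\<alpha> - \<alpha>') * z)" by (simp only:)
    also have "... \<le> 2 * (cmod (of_real \<alpha>' * (z' - z)) + cmod (of_real (\<alpha> - \<alpha>') * z))"
      by (intro mult_left_mono norm_triangle_ineq4) simp
    also have "... = 2 * (\<alpha>' * cmod (z' - z) + (\<alpha> - \<alpha>') * cmod z)"
      using b'(8) mv(4) by (simp add: norm_mult del: of_real_diff)
    also have "... \<le> 2 * (\<alpha> * (2 / \<kappa> * zre \<alpha> * t) + \<alpha> * t * (2 * zre \<alpha>))"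
      using mv(4,5) dz nz b b' t0 unfolding t_def[symmetric] by (intro mult_left_mono add_mono mult_mono) auto
    also have "... = 4 * (\<alpha> * zre \<alpha>) * t * (1 / \<kappa> + 1)" by (simp add: algebra_simps)
    also have "... \<le> 4 * (3 / 2) * t * (1 / \<kappa> + 1 / \<kappa>)"
      using saddle_alpha(4)[OF s] b t0 by (intro mult_mono mult_nonneg_nonneg add_mono) auto
    finally have d: "cmod (v' - v) \<le> 12 / \<kappa> * t" by simp
    have "cmod (sgn v' - sgn v) \<le> 2 * cmod (v' - v) / cmod v" by (rule sgn_diff_le[OF v0])
    also have "... \<le> 2 * (12 / \<kappa> * t) / \<kappa>\<^sup>2"
      using d vk b t0 by (intro frac_le mult_left_mono) auto
    also have "... = 24 / \<kappa> ^ 3 * t" by (simp add: power2_eq_square power3_eq_cube)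
    finally show ?thesis .
  qed
  have unit: "cmod (u'\<^sup>2 / w' - u\<^sup>2 / w) \<le> 2 * cmod (u' - u) + cmod (w' - w)"
    if "cmod u = 1" "cmod u' = 1" "cmod w = 1" "cmod w' = 1" for u u' w w' :: complex
  proof -
    have "w \<noteq> 0" "w' \<noteq> 0" using that by auto
    then have "u'\<^sup>2 / w' - u\<^sup>2 / w = (u' - u) * (u' + u) / w' + u\<^sup>2 * ((w - w') / (w * w'))"
      by (simp add: divide_simps) (simp add: expand_powers)
    then have "cmod (u'\<^sup>2 / w' - u\<^sup>2 / w) \<le> cmod ((u' - u) * (u' + u) / w') + cmod (u\<^sup>2 * ((w - w') / (w * w')))"
      by (simp only: norm_triangle_ineq)
    also have "... = cmod (u' - u) * cmod (u' + u) + cmod (w' - w)"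
      using that by (simp add: norm_mult norm_divide norm_power norm_minus_commute)
    also have "cmod (u' - u) * cmod (u' + u) \<le> cmod (u' - u) * 2"
      using norm_triangle_ineq[of u' u] that by (intro mult_left_mono) auto
    finally show ?thesis by simp
  qed
  have "cmod (cis (2 * beta \<alpha>') - cis (2 * beta \<alpha>)) \<le> 2 * cmod (sgn z' - sgn z) + cmod (sgn v' - sgn v)"
    unfolding cis_double_beta[OF b(8) c(1)] cis_double_beta[OF b'(8) c(2)] z_def[symmetric] z'_def[symmetric] v_def[symmetric] v'_def[symmetric]
    using z0 v0 v0' by (intro unit) (auto simp: norm_sgn)
  also have "... \<le> 2 * (4 / \<kappa> * t) + 24 / \<kappa> ^ 3 * t" using du dv by (intro add_mono mult_left_mono) auto
  also have "2 * (4 / \<kappa> * t) \<le> 8 / \<kappa> ^ 3 * t"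
  proof -
    have "\<kappa> ^ 3 \<le> \<kappa> ^ 1" using b by (intro power_decreasing) auto
    then have "8 / \<kappa> \<le> 8 / \<kappa> ^ 3" using b by (intro divide_left_mono) auto
    then have "8 / \<kappa> * t \<le> 8 / \<kappa> ^ 3 * t" using t0 by (rule mult_right_mono)
    then show ?thesis by simp
  qed
  finally show ?thesis by (simp add: t_def field_simps)
qed

text \<open>Here \<open>\<bar>\<zeta>\<bar>\<close> is comparable with \<open>\<alpha>^(-1/3)\<close> and the root with \<open>1\<close>, so \<open>B_amp \<alpha>\<close> is comparable with
\<open>\<alpha>^(1/6)\<close>.\<close>

lemma P_amp_bounds:
  assumes s: "zeta_saddle \<kappa> (lam / x)" and c: "lam / x < alpha_c" and x: "0 < x" "0 < lam"
  shows "lam powr (1/6) * x powr (-2/3) / 3 \<le> P_amp x lam" "P_amp x lam \<le> 8 / \<kappa> * (lam powr (1/6) * x powr (-2/3))"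
proof -
  define \<alpha> where "\<alpha> = lam / x"
  define \<delta> where "\<delta> = \<alpha> powr (1/3)"
  define r where "r = zre \<alpha>"
  define g where "g = \<alpha> powr (1/6)"
  note s = s[folded \<alpha>_def]
  note b = saddle_basic[OF s, folded r_def]
  have a0: "\<alpha> > 0" by (rule b(8))
  have g0: "g > 0" using a0 by (simp add: g_def)
  have d: "\<delta> > 0" "\<delta> ^ 3 = \<alpha>" using a0 by (simp_all add: \<delta>_def powr_power)
  note dl = saddle_delta[OF s d, folded r_def]
  have sq: "sqrt \<alpha> = g * \<delta>"
    using a0 by (simp add: g_def \<delta>_def powr_half_sqrt[symmetric] powr_add[symmetric])
  have P: "x powr (-1/2) * g = lam powr (1/6) * x powr (-2/3)"
  proof -
    have "x powr (-1/6) = inverse (x powr (1/6))" using powr_minus[of x "1/6"] by simp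
    moreover have "g = lam powr (1/6) / x powr (1/6)" unfolding g_def \<alpha>_def by (rule powr_divide)
    ultimately have "g = lam powr (1/6) * x powr (-1/6)" by (simp only: divide_inverse)
    then have "x powr (-1/2) * g = lam powr (1/6) * (x powr (-1/2) * x powr (-1/6))" by simp
    also have "x powr (-1/2) * x powr (-1/6) = x powr (-2/3)" by (simp add: powr_add[symmetric])
    finally show ?thesis .
  qed
  let ?s = "sqrt_branch \<alpha>"
  have s0: "?s \<noteq> 0" using Re_sqrt_branch_pos[OF a0] c by (auto simp: \<alpha>_def)
  have s2: "(cmod ?s)\<^sup>2 = cmod (radicand \<alpha> (Complex r (zim \<alpha>)))"
    using sqrt_branch_spec(2)[OF a0] c by (simp add: \<alpha>_def r_def zeta_Complex flip: norm_power)
  have s3: "cmod ?s \<le> 3"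
    by (rule power2_le_imp_le) (use saddle_radicand(2)[OF s, folded r_def] s2 in auto)
  have sk: "\<kappa> \<le> cmod ?s"
    by (rule power2_le_imp_le)
       (use saddle_radicand(1)[OF s, folded r_def] complex_Re_le_cmod[of "3 - 2 * of_real \<alpha> * Complex r (zim \<alpha>)"] s2 in linarith, simp)
  have nz: "r \<le> cmod (zeta \<alpha>)" "cmod (zeta \<alpha>) \<le> 2 * r" using saddle_norms(4,5)[OF s] by (simp_all add: zeta_Complex r_def)
  have pi: "1 \<le> sqrt pi" "sqrt pi \<le> 2"
    using pi_gt3 pi_less_4 real_sqrt_le_mono[of pi 4] by auto
  have B: "B_amp \<alpha> = 4 / sqrt pi * (g * \<delta>) * (cmod (zeta \<alpha>) / cmod ?s)"
    unfolding B_amp_def C_amp_def norm_mult norm_divide norm_of_real sq using g0 d by simp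
  have lower: "g / 3 \<le> B_amp \<alpha>"
  proof -
    have "g / 3 = 2 * g * (1 / 2) / 3" by simp
    also have "... \<le> 2 * g * (\<delta> * r) / 3" using dl g0 by (intro divide_right_mono mult_left_mono) auto
    also have "... = 2 * (g * \<delta>) * (r / 3)" by simp
    also have "... \<le> 4 / sqrt pi * (g * \<delta>) * (cmod (zeta \<alpha>) / cmod ?s)"
    proof (intro mult_mono frac_le)
      show "2 \<le> 4 / sqrt pi" using pi by (simp add: le_divide_eq)
    qed (use g0 d b nz s3 s0 in auto)
    finally show ?thesis unfolding B .
  qed
  have upper: "B_amp \<alpha> \<le> 8 / \<kappa> * g"
  proof -
    have "B_amp \<alpha> \<le> 4 * (g * \<delta>) * (2 * r / \<kappa>)" unfolding B
    proof (intro mult_mono frac_le)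
      show "4 / sqrt pi \<le> 4" using pi by (simp add: divide_le_eq)
    qed (use g0 d b nz sk in auto)
    also have "... = 8 / \<kappa> * g * (\<delta> * r)" by simp
    also have "... \<le> 8 / \<kappa> * g * 1" using dl g0 b by (intro mult_left_mono) auto
    finally show ?thesis by simp
  qed
  have xp: "x powr (-1/2) \<ge> 0" by simp
  have "x powr (-1/2) * (g / 3) \<le> P_amp x lam"
    unfolding P_amp_def \<alpha>_def[symmetric] using lower xp by (rule mult_left_mono)
  then show "lam powr (1/6) * x powr (-2/3) / 3 \<le> P_amp x lam" unfolding P[symmetric] by simp
  have "P_amp x lam \<le> x powr (-1/2) * (8 / \<kappa> * g)"
    unfolding P_amp_def \<alpha>_def[symmetric] using upper xp by (rule mult_left_mono)
  also have "... = 8 / \<kappa> * (x powr (-1/2) * g)" by (rule mult.left_commute)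
  finally show "P_amp x lam \<le> 8 / \<kappa> * (lam powr (1/6) * x powr (-2/3))" unfolding P[symmetric] .
qed

lemma sum_cis_bound:
  assumes "0 < sin w"
  shows "cmod (\<Sum>j = 1..J. cis (2 * (w * real j))) \<le> 1 / sin w"
proof -
  define q where "q = cis (2 * w)"
  have qj: "cis (2 * (w * real j)) = q ^ j" for j
  proof -
    have "q ^ j = cis (real j * (2 * w))" unfolding q_def by (rule Complex.DeMoivre)
    also have "real j * (2 * w) = 2 * (w * real j)" by simp
    finally show ?thesis ..
  qed
  have "(cmod (1 - q))\<^sup>2 = (1 - cos (2 * w))\<^sup>2 + (sin (2 * w))\<^sup>2" unfolding cmod_power2 by (simp add: q_def)
  also have "... = 2 - 2 * cos (2 * w)" using sin_cos_squared_add[of "2 * w"] by (simp add: power2_diff)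
  also have "... = (2 * sin w)\<^sup>2" by (simp add: cos_double_sin power_mult_distrib)
  finally have n: "cmod (1 - q) = 2 * sin w" by (rule power2_eq_imp_eq) (use assms in simp_all)
  then have q1: "1 - q \<noteq> 0" using assms by auto
  have "(\<Sum>j = 1..J. q ^ j) = q * (\<Sum>i<J. q ^ i)"
    unfolding sum_distrib_left by (rule sum.reindex_bij_witness[of _ Suc "\<lambda>j. j - 1"]) (auto simp flip: power_Suc)
  moreover have "1 - q ^ J = (1 - q) * (\<Sum>i<J. q ^ i)" by (rule one_diff_power_eq)
  ultimately have "(\<Sum>j = 1..J. q ^ j) = q * ((1 - q ^ J) / (1 - q))" using q1 by simp
  then have "cmod (\<Sum>j = 1..J. q ^ j) = cmod (1 - q ^ J) / (2 * sin w)"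
    by (simp add: norm_mult norm_divide n) (simp add: q_def)
  also have "... \<le> 2 / (2 * sin w)"
    using norm_triangle_ineq4[of 1 "q ^ J"] assms by (intro divide_right_mono) (auto simp: norm_power q_def)
  finally show ?thesis unfolding qj by simp
qed

lemma norm_cis_diff_le: "cmod (cis u - cis v) \<le> \<bar>u - v\<bar>"
proof -
  have "cmod (exp (\<i> * of_real u) - exp (\<i> * of_real v)) \<le> exp 0 * cmod (\<i> * of_real u - \<i> * of_real v)"
    by (rule norm_exp_diff_le) auto
  also have "\<i> * of_real u - \<i> * of_real v = \<i> * of_real (u - v)" by (simp add: right_diff_distrib)
  finally show ?thesis by (simp add: cis_conv_exp norm_mult del: of_real_diff)
qed

text \<open>From \<open>cos\<^sup>2 t = (1 + Re (exp (2 i t))) / 2\<close> and the bound for the geometric sum.\<close>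

lemma sum_cos_squared_lower:
  assumes "0 < sin w" and E: "cmod E = 1"
    and close: "\<And>j. j \<in> {1..J} \<Longrightarrow> cmod (cis (2 * t j) - E * cis (2 * (w * real j))) \<le> \<epsilon>"
  shows "real J / 2 - real J * \<epsilon> / 2 - 1 / (2 * sin w) \<le> (\<Sum>j = 1..J. (cos (t j))\<^sup>2)"
proof -
  have c: "(cos u)\<^sup>2 = (1 + Re (cis (2 * u))) / 2" for u by (simp add: cos_double_cos)
  have "(\<Sum>j = 1..J. (cos (t j))\<^sup>2) = (real J + (\<Sum>j = 1..J. Re (cis (2 * t j)))) / 2"
    unfolding c by (simp add: sum.distrib flip: sum_divide_distrib)
  moreover have "(\<Sum>j = 1..J. Re (cis (2 * t j))) \<ge> - (1 / sin w) - real J * \<epsilon>"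
  proof -
    have "(\<Sum>j = 1..J. Re (E * cis (2 * (w * real j))) - \<epsilon>) \<le> (\<Sum>j = 1..J. Re (cis (2 * t j)))"
    proof (rule sum_mono)
      fix j assume "j \<in> {1..J}"
      then have "\<bar>Re (cis (2 * t j) - E * cis (2 * (w * real j)))\<bar> \<le> \<epsilon>"
        using close abs_Re_le_cmod order_trans by blast
      then show "Re (E * cis (2 * (w * real j))) - \<epsilon> \<le> Re (cis (2 * t j))" by (simp del: cis.sel times_complex.sel)
    qed
    moreover have "(\<Sum>j = 1..J. Re (E * cis (2 * (w * real j))) - \<epsilon>) = Re (E * (\<Sum>j = 1..J. cis (2 * (w * real j)))) - real J * \<epsilon>"
      unfolding sum_distrib_left Re_sum by (simp add: sum_subtractf)
    moreover have "\<bar>Re (E * (\<Sum>j = 1..J. cis (2 * (w * real j))))\<bar> \<le> 1 / sin w"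
    proof -
      have "\<bar>Re (E * (\<Sum>j = 1..J. cis (2 * (w * real j))))\<bar> \<le> cmod (E * (\<Sum>j = 1..J. cis (2 * (w * real j))))" by (rule abs_Re_le_cmod)
      also have "... \<le> 1 / sin w" using sum_cis_bound[OF assms(1), of J] by (simp add: norm_mult E)
      finally show ?thesis .
    qed
    ultimately show ?thesis by linarith
  qed
  ultimately show ?thesis by (simp add: field_simps)
qed

section \<open>Estimates over one window\<close>

text \<open>The factor \<open>8 / \<kappa>\<close> comes from the amplitude and the exponential from the change of \<open>A_exp\<close>
across a window with \<open>K = 16 / \<kappa>\<^sup>2\<close>.\<close>

definition amp_const :: "real \<Rightarrow> real" where
  "amp_const \<kappa> = 8 / \<kappa> * exp (16 * (16 / \<kappa>\<^sup>2) + 1)"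

text \<open>A single window of degrees. In the last assumption each summand serves one estimate: the
linearisation of \<open>S_phase\<close>, the variation of \<open>beta\<close>, the error of the asymptotic formula, and \<open>J \<le> m\<close>.\<close>

context
  fixes \<kappa> \<alpha>\<^sub>0 lam \<delta> K :: real and m J :: nat
  assumes sads: "\<And>\<alpha>. 0 < \<alpha> \<Longrightarrow> \<alpha> \<le> \<alpha>\<^sub>0 \<Longrightarrow> zeta_saddle \<kappa> \<alpha>"
    and a0: "\<alpha>\<^sub>0 < alpha_c" and lam: "0 < lam" "lam / real m \<le> \<alpha>\<^sub>0" and m: "1 \<le> m"
    and \<delta>: "0 < \<delta>" "\<delta> ^ 3 = lam / real m" and K: "K = 16 / \<kappa>\<^sup>2"
    and J: "K / \<delta> \<le> real J" "real J \<le> 2 * K / \<delta>"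
    and large: "8704 * K\<^sup>2 / \<kappa> ^ 4 + 256 * K / \<kappa> ^ 3 + (21504000 / \<kappa> ^ 7)\<^sup>2 + 2 * K \<le> \<delta> * real m"
begin

abbreviation (input) "theta j \<equiv> vartheta (real m + real j) lam"
abbreviation (input) "height j \<equiv> P_amp (real m + real j) lam * exp (A_exp (real m + real j) lam)"
abbreviation (input) "S_error j \<equiv> S_phase (real m + real j) lam - S_phase (real m) lam - of_real (real j) * phase_rate (lam / real m)"

lemma window_saddle:
  "0 < lam / (real m + real j)" "lam / (real m + real j) < alpha_c"
  "zeta_saddle \<kappa> (lam / (real m + real j))"
proof -
  show 1: "0 < lam / (real m + real j)" using lam m by simp
  have "lam / (real m + real j) \<le> lam / real m" using lam m by (intro divide_left_mono) auto
  then have 2: "lam / (real m + real j) \<le> \<alpha>\<^sub>0" using lam by linarith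
  then show "lam / (real m + real j) < alpha_c" using a0 by linarith
  show "zeta_saddle \<kappa> (lam / (real m + real j))"
    using 1 2 by (rule sads)
qed

lemma window_saddle0: "0 < lam / real m" "lam / real m < alpha_c" "zeta_saddle \<kappa> (lam / real m)"
  using window_saddle[of 0] by simp_all

lemma window_pos: "0 < \<kappa>" "\<kappa> \<le> 1" "0 < K" "0 < \<delta> * real m" "0 < real m"
proof -
  show k: "0 < \<kappa>" "\<kappa> \<le> 1" using saddle_basic(1,2)[OF window_saddle0(3)] by auto
  show "0 < K" using k by (simp add: K)
  show "0 < \<delta> * real m" "0 < real m" using \<delta> m by auto
qed

lemma window_large:
  "8704 * K\<^sup>2 / \<kappa> ^ 4 \<le> \<delta> * real m" "256 * K / \<kappa> ^ 3 \<le> \<delta> * real m"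
  "(21504000 / \<kappa> ^ 7)\<^sup>2 \<le> \<delta> * real m" "2 * K \<le> \<delta> * real m"
proof -
  have "0 \<le> 8704 * K\<^sup>2 / \<kappa> ^ 4" "0 \<le> 256 * K / \<kappa> ^ 3" "0 \<le> (21504000 / \<kappa> ^ 7)\<^sup>2" "0 \<le> 2 * K"
    using window_pos by auto
  then show "8704 * K\<^sup>2 / \<kappa> ^ 4 \<le> \<delta> * real m" "256 * K / \<kappa> ^ 3 \<le> \<delta> * real m"
    "(21504000 / \<kappa> ^ 7)\<^sup>2 \<le> \<delta> * real m" "2 * K \<le> \<delta> * real m" using large by linarith+
qed

lemma window_offset:
  assumes "j \<in> {1..J}"
  shows "real j \<le> real m" "272 / \<kappa> ^ 4 * \<delta> * (real j)\<^sup>2 / real m \<le> 1 / 8"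
    "32 / \<kappa> ^ 3 * (real j / real m) \<le> 1 / 4" "\<delta> * real j \<le> 2 * K"
proof -
  note p = window_pos and l = window_large
  have "real j \<le> 2 * K / \<delta>" using assms J by simp
  then show dj: "\<delta> * real j \<le> 2 * K" using \<delta>(1) by (simp add: le_divide_eq mult.commute)
  then have "\<delta> * real j \<le> \<delta> * real m" using l(4) by linarith
  then show "real j \<le> real m" using \<delta>(1) by simp
  have k3: "0 < \<kappa> ^ 3" "0 < \<kappa> ^ 4" using p by auto
  have q: "A / B \<le> 1" if "A \<le> B" "0 < B" for A B :: real using that by (simp add: divide_le_eq)
  have "272 / \<kappa> ^ 4 * \<delta> * (real j)\<^sup>2 / real m = 272 / \<kappa> ^ 4 * (\<delta> * real j)\<^sup>2 / (\<delta> * real m)"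
    using \<delta>(1) by (simp add: power2_eq_square)
  also have "... \<le> 272 / \<kappa> ^ 4 * (2 * K)\<^sup>2 / (\<delta> * real m)"
    using dj \<delta>(1) p k3 by (intro divide_right_mono mult_left_mono power_mono) auto
  also have "... = (8704 * K\<^sup>2 / \<kappa> ^ 4) / (\<delta> * real m) / 8" by (simp add: power_mult_distrib)
  also have "... \<le> 1 / 8" using l(1) p(4) by (intro divide_right_mono q) simp_all
  finally show "272 / \<kappa> ^ 4 * \<delta> * (real j)\<^sup>2 / real m \<le> 1 / 8" .
  have "32 / \<kappa> ^ 3 * (real j / real m) = 32 / \<kappa> ^ 3 * ((\<delta> * real j) / (\<delta> * real m))"
    using \<delta>(1) by simp
  also have "... \<le> 32 / \<kappa> ^ 3 * ((2 * K) / (\<delta> * real m))"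
    using dj p k3 by (intro mult_left_mono divide_right_mono) auto
  also have "... = (256 * K / \<kappa> ^ 3) / (\<delta> * real m) / 4" by simp
  also have "... \<le> 1 / 4" using l(2) p(4) by (intro divide_right_mono q) simp_all
  finally show "32 / \<kappa> ^ 3 * (real j / real m) \<le> 1 / 4" .
qed

lemma window_S_phase:
  assumes "j \<in> {1..J}"
  shows "cmod (S_error j) \<le> 1 / 8"
proof -
  have "cmod (S_error j)
      \<le> 272 / \<kappa> ^ 4 * \<delta> * (real j)\<^sup>2 / real m"
    by (rule S_phase_increment[OF window_saddle0(3) window_saddle(3) window_pos(5) _ window_offset(1)[OF assms] \<delta>]) simp
  then show ?thesis using window_offset(2)[OF assms] by linarith
qed

text \<open>The doubled phases deviate by at most \<open>1 / 2\<close> from an arithmetic progression, which costs a quarter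
of \<open>J\<close>; the choice \<open>K = 16 / \<kappa>\<^sup>2\<close> makes the geometric sum cost at most an eighth.\<close>

lemma window_cos_sum: "real J / 8 \<le> (\<Sum>j = 1..J. (cos (theta j))\<^sup>2)"
proof -
  note p = window_pos
  define w where "w = Im (phase_rate (lam / real m))"
  define E where "E = cis (2 * vartheta (real m) lam)"
  have sw: "\<kappa>\<^sup>2 / 4 * \<delta> \<le> sin w" unfolding w_def by (rule phase_rate_bounds(2)[OF window_saddle0(3) \<delta>])
  have sw0: "0 < \<kappa>\<^sup>2 / 4 * \<delta>" using p \<delta> by simp
  have close: "cmod (cis (2 * theta j) - E * cis (2 * (w * real j))) \<le> 1 / 2" if j: "j \<in> {1..J}" for j
  proof -
    define u where "u = 2 * Im (S_phase (real m + real j) lam)"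
    define u0 where "u0 = 2 * Im (S_phase (real m) lam) + 2 * (w * real j)"
    define b where "b = cis (2 * beta (lam / (real m + real j)))"
    define b0 where "b0 = cis (2 * beta (lam / real m))"
    have e1: "cis (2 * theta j) = cis u * b"
      by (simp add: vartheta_def u_def b_def cis_mult distrib_left)
    have e2: "E * cis (2 * (w * real j)) = cis u0 * b0"
      by (simp add: E_def vartheta_def u0_def b0_def cis_mult algebra_simps)
    have "\<bar>Im (S_error j)\<bar> \<le> 1 / 8"
      using abs_Im_le_cmod window_S_phase[OF j] order_trans by blast
    moreover have "u - u0 = 2 * Im (S_error j)"
      by (simp add: u_def u0_def w_def)
    ultimately have uu: "\<bar>u - u0\<bar> \<le> 1 / 4" by linarith
    have bb: "cmod (b - b0) \<le> 1 / 4"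
    proof -
      have "cmod (b - b0) \<le> 32 / \<kappa> ^ 3 * (real j / real m)" unfolding b_def b0_def
        by (rule cis_double_beta_move[OF window_saddle0(3) window_saddle(3) window_saddle0(2) window_saddle(2) _ p(5)])
           (use m in auto)
      then show ?thesis using window_offset(3)[OF j] by linarith
    qed
    have "cis u * b - cis u0 * b0 = (cis u - cis u0) * b + cis u0 * (b - b0)" by (simp add: algebra_simps)
    then have "cmod (cis u * b - cis u0 * b0) \<le> cmod ((cis u - cis u0) * b) + cmod (cis u0 * (b - b0))"
      by (simp only: norm_triangle_ineq)
    also have "... = cmod (cis u - cis u0) + cmod (b - b0)" by (simp add: norm_mult b_def)
    also have "... \<le> 1 / 4 + 1 / 4" using norm_cis_diff_le[of u u0] uu bb by linarith
    finally show ?thesis unfolding e1 e2 by simp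
  qed
  have "real J / 2 - real J * (1 / 2) / 2 - 1 / (2 * sin w) \<le> (\<Sum>j = 1..J. (cos (theta j))\<^sup>2)"
    by (rule sum_cos_squared_lower[of _ E]) (use sw sw0 close in \<open>auto simp: E_def\<close>)
  moreover have "1 / (2 * sin w) \<le> real J / 8"
  proof -
    have "1 / (2 * sin w) \<le> 1 / (2 * (\<kappa>\<^sup>2 / 4 * \<delta>))" by (rule frac_le) (use sw sw0 in linarith)+
    also have "... = K / \<delta> / 8" by (simp add: K)
    also have "... \<le> real J / 8" using J by (intro divide_right_mono) auto
    finally show ?thesis .
  qed
  ultimately show ?thesis by simp
qed

lemma window_A_exp:
  assumes "j \<in> {1..J}"
  shows "\<bar>A_exp (real m + real j) lam - A_exp (real m) lam\<bar> \<le> 16 * K + 1"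
proof -
  have "\<bar>Re (S_error j)\<bar> \<le> 1 / 8"
    using abs_Re_le_cmod window_S_phase[OF assms] order_trans by blast
  then have "\<bar>A_exp (real m + real j) lam - A_exp (real m) lam - real j * Re (phase_rate (lam / real m))\<bar> \<le> 1 / 8"
    by (simp add: A_exp_def)
  moreover have "\<bar>real j * Re (phase_rate (lam / real m))\<bar> \<le> 16 * K"
  proof -
    have "\<bar>real j * Re (phase_rate (lam / real m))\<bar> \<le> real j * (8 * \<delta>)"
      unfolding abs_mult using phase_rate_bounds(1)[OF window_saddle0(3) \<delta>] by (intro mult_mono) auto
    also have "... = 8 * (\<delta> * real j)" by simp
    also have "... \<le> 16 * K" using window_offset(4)[OF assms] by simp
    finally show ?thesis .
  qed
  ultimately show ?thesis by linarith
qed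

text \<open>For \<open>m \<le> x \<le> 2 m\<close> the power \<open>x^(-2/3)\<close> lies between half of \<open>m^(-2/3)\<close> and \<open>m^(-2/3)\<close>.\<close>

lemma window_amplitude:
  assumes j: "j \<in> {1..J}"
  shows "lam powr (1/6) * exp (A_exp (real m) lam) / (amp_const \<kappa> * real m powr (2/3))
      \<le> height j" (is "?L \<le> ?M")
    and "height j
      \<le> amp_const \<kappa> * lam powr (1/6) * exp (A_exp (real m) lam) / real m powr (2/3)" (is "_ \<le> ?U")
proof -
  note p = window_pos
  define G where "G = lam powr (1/6)"
  define Y where "Y = real m powr (2/3)"
  define e where "e = exp (A_exp (real m) lam)"
  define D where "D = exp (16 * K + 1)"
  define x where "x = real m + real j"
  have x0: "x > 0" "real m \<le> x" "x \<le> 2 * real m" using p window_offset(1)[OF j] by (auto simp: x_def)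
  have Y0: "Y > 0" "G > 0" "e > 0" "D > 0" using p lam by (auto simp: Y_def G_def e_def D_def)
  have Cc: "amp_const \<kappa> = 8 / \<kappa> * D" by (simp add: amp_const_def D_def K)
  have xm: "x powr (-2/3) \<le> 1 / Y" "1 / (2 * Y) \<le> x powr (-2/3)"
  proof -
    have n: "t powr (-2/3) = 1 / t powr (2/3)" for t :: real
      using powr_minus_divide[of t "2/3"] by simp
    have "real m powr (2/3) \<le> x powr (2/3)" using x0 p by (intro powr_mono2) auto
    then show "x powr (-2/3) \<le> 1 / Y" unfolding n Y_def using x0(1) p(5) by (intro divide_left_mono mult_pos_pos) simp_all
    have "x powr (2/3) \<le> (2 * real m) powr (2/3)" using x0 p by (intro powr_mono2) auto
    also have "... = 2 powr (2/3) * Y" by (simp add: powr_mult Y_def)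
    also have "... \<le> 2 powr 1 * Y" using Y0 by (intro mult_right_mono powr_mono) auto
    finally show "1 / (2 * Y) \<le> x powr (-2/3)" unfolding n using x0(1) Y0(1) by (intro divide_left_mono mult_pos_pos) simp_all
  qed
  note P = P_amp_bounds[OF window_saddle(3) window_saddle(2), of j, folded x_def, OF x0(1) lam(1), folded G_def]
  have ex: "e / D \<le> exp (A_exp x lam)" "exp (A_exp x lam) \<le> e * D"
  proof -
    have a: "\<bar>A_exp x lam - A_exp (real m) lam\<bar> \<le> 16 * K + 1" using window_A_exp[OF j] by (simp add: x_def)
    have "e / D = exp (A_exp (real m) lam - (16 * K + 1))" unfolding e_def D_def exp_diff ..
    also have "... \<le> exp (A_exp x lam)" using a by simp
    finally show "e / D \<le> exp (A_exp x lam)" .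
    have "exp (A_exp x lam) \<le> exp (A_exp (real m) lam + (16 * K + 1))" using a by simp
    then show "exp (A_exp x lam) \<le> e * D" unfolding e_def D_def exp_add .
  qed
  have "G * e / (8 / \<kappa> * D * Y) \<le> G * e / (6 * D * Y)"
  proof (intro divide_left_mono mult_right_mono)
    show "6 \<le> 8 / \<kappa>" using p by (simp add: le_divide_eq)
  qed (use Y0 p in auto)
  also have "... = G * (1 / (2 * Y)) / 3 * (e / D)" by simp
  also have "... \<le> G * x powr (-2/3) / 3 * exp (A_exp x lam)"
    using xm ex Y0 by (intro mult_mono divide_right_mono) auto
  also have "... \<le> P_amp x lam * exp (A_exp x lam)" using P(1) by (intro mult_right_mono) auto
  finally show "?L \<le> ?M" unfolding Cc G_def e_def Y_def x_def .
  have "P_amp x lam * exp (A_exp x lam) \<le> 8 / \<kappa> * (G * x powr (-2/3)) * exp (A_exp x lam)"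
    using P(2) by (intro mult_right_mono) auto
  also have "... \<le> 8 / \<kappa> * (G * (1 / Y)) * (e * D)"
    using xm ex Y0 p by (intro mult_mono) auto
  also have "... = 8 / \<kappa> * D * G * e / Y" by simp
  finally show "?M \<le> ?U" unfolding Cc G_def e_def Y_def x_def .
qed

text \<open>The relative error in the asymptotic formula is at most \<open>1 / 8\<close> in the window, and
\<open>(c - 1/8)\<^sup>2 \<ge> c\<^sup>2 / 2 - 1/64\<close>. For \<open>c < 1/8\<close> the left side is not positive.\<close>

lemma window_coeff:
  assumes j: "j \<in> {1..J}"
  defines "M \<equiv> height j"
  shows "M\<^sup>2 * ((cos (theta j))\<^sup>2 / 2 - 1 / 64) \<le> (cheb_coeff (m + j) lam)\<^sup>2"
proof -
  note p = window_pos
  define \<alpha> where "\<alpha> = lam / real m"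
  define \<alpha>' where "\<alpha>' = lam / (real m + real j)"
  define c where "c = \<bar>cos (theta j)\<bar>"
  define a where "a = \<bar>cheb_coeff (m + j) lam\<bar>"
  have lam': "real (m + j) * \<alpha>' = lam" using m by (simp add: \<alpha>'_def add_pos_nonneg)
  have eta: "1344000 / (\<kappa> ^ 7 * (zre \<alpha>' * sqrt lam)) \<le> 1 / 8"
  proof -
    have eq: "\<alpha>' * (real m + real j) = \<alpha> * real m" using m by (simp add: \<alpha>_def \<alpha>'_def)
    have r: "zre \<alpha> \<le> zre \<alpha>'"
      using saddle_move(1)[OF window_saddle0(3) window_saddle(3), of j "real m" "real j", folded \<alpha>_def \<alpha>'_def, OF eq p(5)] by simp
    have r0: "zre \<alpha> > 0" using saddle_basic(3)[OF window_saddle0(3)] by (simp add: \<alpha>_def)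
    \<comment> \<open>\<open>r sqrt \<lambda> = (\<delta> r) sqrt (\<delta> m)\<close>, and \<open>\<delta> r \<ge> 1/2\<close>\<close>
    have half: "1 / 2 \<le> \<delta> * zre \<alpha>" unfolding \<alpha>_def by (rule saddle_delta(1)[OF window_saddle0(3) \<delta>])
    have lamd: "lam = \<delta> ^ 3 * real m" using \<delta>(2) m by simp
    have "(21504000 / \<kappa> ^ 7) \<le> sqrt (\<delta> * real m)" by (rule real_le_rsqrt[OF window_large(3)])
    then have "1 / 2 * (21504000 / \<kappa> ^ 7) \<le> \<delta> * zre \<alpha> * sqrt (\<delta> * real m)"
      using half p by (intro mult_mono) auto
    also have "... = zre \<alpha> * sqrt lam"
    proof -
      have "lam = \<delta>\<^sup>2 * (\<delta> * real m)" unfolding lamd by (simp add: power2_eq_square power3_eq_cube)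
      then have "sqrt lam = \<delta> * sqrt (\<delta> * real m)" using \<delta>(1) by (simp add: real_sqrt_mult)
      then show ?thesis by simp
    qed
    also have "... \<le> zre \<alpha>' * sqrt lam" using r lam by (intro mult_right_mono) auto
    finally have "\<kappa> ^ 7 * (1 / 2 * (21504000 / \<kappa> ^ 7)) \<le> \<kappa> ^ 7 * (zre \<alpha>' * sqrt lam)" using p by (intro mult_left_mono) auto
    then have k: "10752000 \<le> \<kappa> ^ 7 * (zre \<alpha>' * sqrt lam)" using p by simp
    then have "1344000 / (\<kappa> ^ 7 * (zre \<alpha>' * sqrt lam)) \<le> 1344000 / 10752000" by (intro divide_left_mono) auto
    then show ?thesis by simp
  qed
  have two: "2 \<le> m + j" using m j by auto
  have M0: "M \<ge> 0" by (simp add: M_def P_amp_def B_amp_def)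
  have "\<bar>a - M * c\<bar> \<le> 1344000 / (\<kappa> ^ 7 * (zre \<alpha>' * sqrt lam)) * M"
    using cheb_coeff_asymptotics[OF window_saddle(3) window_saddle(1,2) two, of j, folded \<alpha>'_def, unfolded lam']
    unfolding a_def M_def c_def by simp
  also have "... \<le> 1 / 8 * M" using eta M0 by (rule mult_right_mono)
  finally have aM: "M * (c - 1 / 8) \<le> a" unfolding right_diff_distrib by linarith
  have "M\<^sup>2 * (c\<^sup>2 / 2 - 1 / 64) \<le> a\<^sup>2"
  proof (cases "c \<ge> 1 / 8")
    case True
    have "c\<^sup>2 / 2 - 1 / 64 \<le> (c - 1 / 8)\<^sup>2"
      using zero_le_power2[of "c - 1 / 4"] by (simp add: expand_powers)
    then have "M\<^sup>2 * (c\<^sup>2 / 2 - 1 / 64) \<le> M\<^sup>2 * (c - 1 / 8)\<^sup>2" by (intro mult_left_mono) auto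
    also have "... = (M * (c - 1 / 8))\<^sup>2" by (simp add: power_mult_distrib)
    also have "... \<le> a\<^sup>2" using aM M0 True by (intro power_mono mult_nonneg_nonneg) auto
    finally show ?thesis .
  next
    case False
    then have "c\<^sup>2 \<le> (1 / 8)\<^sup>2" by (intro power_mono) (auto simp: c_def)
    then have "c\<^sup>2 / 2 - 1 / 64 \<le> 0" by (simp add: power2_eq_square)
    then have "M\<^sup>2 * (c\<^sup>2 / 2 - 1 / 64) \<le> 0" by (intro mult_nonneg_nonpos) auto
    then show ?thesis using zero_le_power2[of a] by linarith
  qed
  then show ?thesis by (simp add: a_def c_def)
qed

text \<open>The squared amplitude is at least a multiple of \<open>\<delta> / m * exp (2 A)\<close>, and the window has at least
\<open>K / \<delta>\<close> terms, so the powers of \<open>\<delta>\<close> cancel.\<close>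

lemma window_energy:
  "K / (32 * (amp_const \<kappa>)\<^sup>2) * inverse (real m) * exp (2 * A_exp (real m) lam) \<le> (\<Sum>j = 1..J. (cheb_coeff (m + j) lam)\<^sup>2)"
proof -
  note p = window_pos
  define G where "G = lam powr (1/6)"
  define Y where "Y = real m powr (2/3)"
  define e where "e = exp (A_exp (real m) lam)"
  define C where "C = amp_const \<kappa>"
  define L where "L = G * e / (C * Y)"
  have C0: "C > 0" using p by (simp add: C_def amp_const_def)
  have Y0: "Y > 0" "G > 0" "e > 0" using p lam by (auto simp: Y_def G_def e_def)
  have GY: "G\<^sup>2 / Y\<^sup>2 = \<delta> / real m"
  proof -
    have d: "\<delta> = lam powr (1/3) / real m powr (1/3)"
    proof -
      have "\<delta> = (\<delta> ^ 3) powr (1/3)" using \<delta>(1) by (simp flip: powr_numeral add: powr_powr)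
      then show ?thesis unfolding \<delta>(2) powr_divide .
    qed
    have G2: "G\<^sup>2 = lam powr (1/3)" unfolding G_def power2_eq_square powr_add[symmetric] by simp
    have "real m powr (4/3) = real m powr (1/3 + 1)" by simp
    also have "... = real m powr (1/3) * real m" unfolding powr_add using p by simp
    finally have Y2: "Y\<^sup>2 = real m powr (1/3) * real m" unfolding Y_def power2_eq_square powr_add[symmetric] by simp
    show ?thesis unfolding G2 Y2 d by simp
  qed
  have L2: "L\<^sup>2 = e\<^sup>2 / C\<^sup>2 * (\<delta> / real m)" unfolding GY[symmetric] by (simp add: L_def power_divide power_mult_distrib)
  have "K / (32 * C\<^sup>2) * inverse (real m) * e\<^sup>2 = L\<^sup>2 * (K / \<delta> / 32)"
  proof -
    have "K / (32 * c) * inverse M * E = E / c * (d / M) * (K / d / 32)" if "d > 0" for c M E d :: real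
      using that by (simp add: inverse_eq_divide mult_ac)
    then show ?thesis unfolding L2 using \<delta>(1) .
  qed
  also have "... \<le> L\<^sup>2 * (real J / 32)" using J(1) by (intro mult_left_mono divide_right_mono) auto
  also have "... \<le> L\<^sup>2 * (\<Sum>j = 1..J. (cos (theta j))\<^sup>2 / 2 - 1 / 64)"
  proof (rule mult_left_mono)
    have "(\<Sum>j = 1..J. (cos (theta j))\<^sup>2 / 2 - 1 / 64) =
        (\<Sum>j = 1..J. (cos (theta j))\<^sup>2) / 2 - real J / 64"
      by (simp add: sum_subtractf flip: sum_divide_distrib)
    then show "real J / 32 \<le> (\<Sum>j = 1..J. (cos (theta j))\<^sup>2 / 2 - 1 / 64)"
      using window_cos_sum by simp
  qed simp
  also have "... = (\<Sum>j = 1..J. L\<^sup>2 * ((cos (theta j))\<^sup>2 / 2 - 1 / 64))" by (rule sum_distrib_left)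
  also have "... \<le> (\<Sum>j = 1..J. (cheb_coeff (m + j) lam)\<^sup>2)"
  proof (rule sum_mono)
    fix j assume j: "j \<in> {1..J}"
    define f where "f = (cos (theta j))\<^sup>2 / 2 - 1 / 64"
    define M where "M = height j"
    have LM: "L \<le> M" using window_amplitude(1)[OF j] unfolding L_def M_def G_def e_def C_def Y_def .
    have co: "M\<^sup>2 * f \<le> (cheb_coeff (m + j) lam)\<^sup>2" using window_coeff[OF j] unfolding f_def M_def .
    \<comment> \<open>individual terms \<open>f\<close> may be negative, so the lower bound for \<open>M\<close> is used only where \<open>f \<ge> 0\<close>\<close>
    show "L\<^sup>2 * f \<le> (cheb_coeff (m + j) lam)\<^sup>2"
    proof (cases "0 \<le> f")
      case True
      have "L\<^sup>2 \<le> M\<^sup>2" using LM C0 Y0 by (intro power_mono) (auto simp: L_def)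
      then have "L\<^sup>2 * f \<le> M\<^sup>2 * f" using True by (rule mult_right_mono)
      then show ?thesis using co by linarith
    next
      case False
      then have "L\<^sup>2 * f \<le> 0" by (intro mult_nonneg_nonpos) auto
      then show ?thesis using zero_le_power2[of "cheb_coeff (m + j) lam"] by linarith
    qed
  qed
  finally have "K / (32 * C\<^sup>2) * inverse (real m) * e\<^sup>2 \<le> (\<Sum>j = 1..J. (cheb_coeff (m + j) lam)\<^sup>2)" .
  moreover have "e\<^sup>2 = exp (2 * A_exp (real m) lam)" by (simp add: e_def exp_double)
  ultimately show ?thesis unfolding C_def by simp
qed

end

section \<open>The theorem\<close>

lemma window_length:
  fixes K \<delta> :: real
  assumes "0 < \<delta>" "\<delta> \<le> K"
  shows "K / \<delta> \<le> real (nat \<lceil>K / \<delta>\<rceil>)" "real (nat \<lceil>K / \<delta>\<rceil>) \<le> 2 * K / \<delta>"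
proof -
  have 1: "1 \<le> K / \<delta>" using assms by (simp add: le_divide_eq)
  then show "K / \<delta> \<le> real (nat \<lceil>K / \<delta>\<rceil>)" by linarith
  have "real (nat \<lceil>K / \<delta>\<rceil>) \<le> K / \<delta> + 1" using 1 by linarith
  also have "... \<le> 2 * (K / \<delta>)" using 1 by simp
  finally show "real (nat \<lceil>K / \<delta>\<rceil>) \<le> 2 * K / \<delta>" by simp
qed

lemma cube_root_alpha:
  assumes "0 < a" "a < alpha_c"
  shows "0 < a powr (1/3)" "(a powr (1/3)) ^ 3 = a" "a powr (1/3) < 2"
proof -
  show "0 < a powr (1/3)" and c: "(a powr (1/3)) ^ 3 = a" using assms by (simp_all add: powr_power)
  have "sqrt 3 < 2" by (rule real_less_lsqrt) auto
  then have "(a powr (1/3)) ^ 3 < 2 ^ 3" unfolding c using assms by (simp add: alpha_c_def)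
  then show "a powr (1/3) < 2" by (rule power_less_imp_less_base) simp
qed

lemma cube_root_scale:
  assumes "0 < l" "1 \<le> m"
  shows "(l / real m) powr (1/3) * real m = (l * (real m)\<^sup>2) powr (1/3)"
proof -
  have "real m = (real m ^ 3) powr (1/3)" using assms by (simp flip: powr_numeral add: powr_powr)
  then have "(l / real m) powr (1/3) * real m = (l / real m * real m ^ 3) powr (1/3)"
    unfolding powr_mult[of "l / real m" "real m ^ 3"] by simp
  also have "l / real m * real m ^ 3 = l * (real m)\<^sup>2" using assms by (simp add: power2_eq_square power3_eq_cube)
  finally show ?thesis .
qed

theorem lemma5p2:
  fixes \<alpha>\<^sub>0 :: real
  assumes "0 < \<alpha>\<^sub>0" and "\<alpha>\<^sub>0 < alpha_c"
  shows "\<exists>K c C :: real. K > 0 \<and> c > 0 \<and> C > 0 \<and>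
    (\<forall>lam :: nat \<Rightarrow> real.
      (\<forall>m\<ge>1. 0 < lam m \<and> 0 < lam m / real m \<and> lam m / real m \<le> \<alpha>\<^sub>0) \<and>
      filterlim (\<lambda>m. (lam m * (real m)\<^sup>2) powr (1/3)) at_top sequentially \<longrightarrow>
      (let \<delta> = (\<lambda>m. (lam m / real m) powr (1/3));
           J = (\<lambda>m. nat \<lceil>K / \<delta> m\<rceil>)
       in (\<lambda>m. real (J m)) \<in> o(\<lambda>m. real m) \<and>
          (\<forall>\<^sub>F m in sequentially.
             (\<Sum>j = 1..J m. (cos (vartheta (real (m + j)) (lam m)))\<^sup>2) \<ge> c * real (J m)) \<and>
          (\<forall>\<^sub>F m in sequentially. \<forall>j\<in>{1..J m}.
             lam m powr (1/6) * exp (A_exp (real m) (lam m)) / (C * real m powr (2/3))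
               \<le> P_amp (real (m + j)) (lam m) * exp (A_exp (real (m + j)) (lam m)) \<and>
             P_amp (real (m + j)) (lam m) * exp (A_exp (real (m + j)) (lam m))
               \<le> C * lam m powr (1/6) * exp (A_exp (real m) (lam m)) / real m powr (2/3)) \<and>
          (\<forall>\<^sub>F m in sequentially.
             (\<Sum>j = 1..J m. \<bar>cheb_coeff (m + j) (lam m)\<bar>\<^sup>2)
               \<ge> c * inverse (real m) * exp (2 * A_exp (real m) (lam m)))))"
proof -
  obtain \<kappa> where sads: "\<And>\<alpha>. 0 < \<alpha> \<Longrightarrow> \<alpha> \<le> \<alpha>\<^sub>0 \<Longrightarrow> zeta_saddle \<kappa> \<alpha>"
    using saddle_exists[OF assms] unfolding zre_def zim_def by blast
  have k: "0 < \<kappa>" "\<kappa> \<le> 1" using saddle_basic(1,2)[OF sads[OF assms(1) order_refl]] .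
  define K where "K = 16 / \<kappa>\<^sup>2"
  define C where "C = amp_const \<kappa>"
  define c where "c = min (1 / 8) (K / (32 * C\<^sup>2))"
  \<comment> \<open>the threshold for \<open>\<delta> m = \<Lambda>\<close> beyond which all error terms in a window are small enough\<close>
  define T where "T = 8704 * K\<^sup>2 / \<kappa> ^ 4 + 256 * K / \<kappa> ^ 3 + (21504000 / \<kappa> ^ 7)\<^sup>2 + 2 * K"
  have K2: "2 \<le> K"
  proof -
    have "\<kappa>\<^sup>2 \<le> 1" using k by (simp add: power_le_one)
    then have "16 / 1 \<le> 16 / \<kappa>\<^sup>2" using k by (intro divide_left_mono) auto
    then show ?thesis by (simp add: K_def)
  qed
  have C0: "C > 0" using k by (simp add: C_def amp_const_def)
  have c0: "c > 0" using K2 C0 by (simp add: c_def)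
  show ?thesis
  proof (rule exI[of _ K], rule exI[of _ c], rule exI[of _ C], intro conjI allI impI, goal_cases)
    case 1
    show ?case using K2 by simp
  next
    case 2
    show ?case by (rule c0)
  next
    case 3
    show ?case by (rule C0)
  next
    case hyp: (4 lam)
    define \<delta> where "\<delta> = (\<lambda>m. (lam m / real m) powr (1/3))"
    define J where "J = (\<lambda>m. nat \<lceil>K / \<delta> m\<rceil>)"
    have lamm: "0 < lam m" "lam m / real m \<le> \<alpha>\<^sub>0" "0 < lam m / real m" "lam m / real m < alpha_c" if "1 \<le> m" for m
      using hyp that assms(2) by (auto intro: le_less_trans)
    have dm: "0 < \<delta> m" "\<delta> m ^ 3 = lam m / real m" "\<delta> m \<le> K" if "1 \<le> m" for m
      using cube_root_alpha[OF lamm(3,4)[OF that]] K2 by (auto simp: \<delta>_def)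
    have Jm: "K / \<delta> m \<le> real (J m)" "real (J m) \<le> 2 * K / \<delta> m" if "1 \<le> m" for m
      unfolding J_def using window_length[OF dm(1,3)[OF that]] by auto
    have scale: "\<delta> m * real m = (lam m * (real m)\<^sup>2) powr (1/3)" if "1 \<le> m" for m
      unfolding \<delta>_def by (rule cube_root_scale[OF lamm(1)[OF that] that])
    have big: "\<forall>\<^sub>F m in sequentially. 1 \<le> m \<and> B \<le> \<delta> m * real m" for B
    proof -
      have "\<forall>\<^sub>F m in sequentially. B \<le> (lam m * (real m)\<^sup>2) powr (1/3)"
        using hyp by (simp add: filterlim_at_top)
      then show ?thesis using eventually_ge_at_top[of 1] by eventually_elim (simp add: scale)
    qed
    have large: "8704 * K\<^sup>2 / \<kappa> ^ 4 + 256 * K / \<kappa> ^ 3 + (21504000 / \<kappa> ^ 7)\<^sup>2 + 2 * K \<le> \<delta> m * real m"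
      if "T \<le> \<delta> m * real m" for m using that unfolding T_def .
    have J_eq: "nat \<lceil>K / (lam m / real m) powr (1/3)\<rceil> = J m" for m by (simp add: J_def \<delta>_def)
    show ?case
      unfolding Let_def J_eq
    proof (intro conjI, goal_cases)
      case 1
      show ?case
      proof (rule landau_o.smallI)
        fix e :: real assume e: "e > 0"
        show "\<forall>\<^sub>F m in sequentially. norm (real (J m)) \<le> e * norm (real m)"
          using big[of "2 * K / e"]
        proof eventually_elim
          case (elim m)
          then have "2 * K \<le> e * real m * \<delta> m" using e by (simp add: divide_le_eq mult_ac)
          then have "2 * K / \<delta> m \<le> e * real m" using dm(1)[of m] elim by (simp add: divide_le_eq)
          then show ?case using Jm(2)[of m] elim by simp
        qed
      qed
    next
      case 2
      show ?case using big[of T]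
      proof eventually_elim
        case (elim m)
        then have m: "1 \<le> m" and L: "T \<le> \<delta> m * real m" by simp_all
        have "real (J m) / 8 \<le> (\<Sum>j = 1..J m. (cos (vartheta (real m + real j) (lam m)))\<^sup>2)"
          by (rule window_cos_sum[OF sads assms(2) lamm(1,2)[OF m] m dm(1,2)[OF m] K_def Jm[OF m] large[OF L]])
        moreover have "c * real (J m) \<le> 1 / 8 * real (J m)" by (intro mult_right_mono) (auto simp: c_def)
        ultimately show ?case by simp
      qed
    next
      case 3
      show ?case using big[of T]
      proof eventually_elim
        case (elim m)
        then have m: "1 \<le> m" and L: "T \<le> \<delta> m * real m" by simp_all
        show ?case
          using window_amplitude[OF sads assms(2) lamm(1,2)[OF m] m dm(1,2)[OF m] K_def Jm[OF m] large[OF L], folded C_def]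
          by simp
      qed
    next
      case 4
      show ?case using big[of T]
      proof eventually_elim
        case (elim m)
        then have m: "1 \<le> m" and L: "T \<le> \<delta> m * real m" by simp_all
        have "c * inverse (real m) * exp (2 * A_exp (real m) (lam m)) \<le> K / (32 * C\<^sup>2) * inverse (real m) * exp (2 * A_exp (real m) (lam m))"
          by (intro mult_right_mono) (auto simp: c_def)
        also have "... \<le> (\<Sum>j = 1..J m. (cheb_coeff (m + j) (lam m))\<^sup>2)"
          unfolding C_def by (rule window_energy[OF sads assms(2) lamm(1,2)[OF m] m dm(1,2)[OF m] K_def Jm[OF m] large[OF L]])
        finally show ?case by simp
      qed
    qed
  qed
qed

end
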